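(* Let $a>b>0$, $c>d>0$ and let $$Q_2=\Big\{(x,y,z,t)\in\mathbb R^4:\ \frac{x^2}{a^2}+\frac{y^2}{b^2}-\frac{z^2}{c^2}-\frac{t^2}{d^2}-1=0\Big\},$$ positively oriented by the unit normal directed by $\nabla\big(\frac{x^2}{a^2}+\frac{y^2}{b^2}-\frac{z^2}{c^2}-\frac{t^2}{d^2}\big)$. Then the umbilic set of $Q_2$ is empty and its partially umbilic set consists of two curves $\mathcal P_{23}^1,\mathcal P_{23}^2$ (contained in $\mathcal P_{23}$). In the parametrizations $\alpha_\pm(u,v,w)=\big(au,bv,cw,\pm d\sqrt{u^2+v^2-w^2-1}\big)$ of $Q_2$ the partially umbilic set is given by $$\frac{(d^2+a^2)u^2}{c^2+a^2}+\frac{(b^2+d^2)v^2}{b^2+c^2}-1=0,\qquad w=0.$$ The partially umbilic curves $\mathcal P_{23}^1$ and $\mathcal P_{23}^2$ are of type $D_1$, and their partially umbilic separatrix surfaces (of the foliation $\mathcal F_3$) span an open band $W_{23}^1$ such that $\partial W_{23}^1=\mathcal P_{23}^1\cup\mathcal P_{23}^2$. Moreover: (i) All leaves of the principal foliation $\mathcal F_3$ outside the separatrix surface $W_{23}^1$ are closed (compact). (ii) All leaves of the principal foliation $\mathcal F_2$ are open arcs, diffeomorphic to $\mathbb R$. (iii) All leaves of the principal foliation $\mathcal F_1$ are compact.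
   Context: For an oriented hypersurface $M\subset\mathbb R^4$ with unit normal $N$, the principal curvatures $k_1\le k_2\le k_3$ are the eigenvalues of $D(-N)$ on the tangent bundle. Umbilic set: $\mathcal U=\{k_1=k_2=k_3\}$. Partially umbilic set: $\mathcal P_{12}\cup\mathcal P_{23}$, with $\mathcal P_{12}=\{k_1=k_2<k_3\}$ and $\mathcal P_{23}=\{k_1<k_2=k_3\}$. The eigenline field $\mathcal L_i$ of $k_i$ is defined off $\mathcal U\cup\mathcal P_{12}$ for $i=1$, off $\mathcal U\cup\mathcal P_{23}$ for $i=3$, and off $\mathcal U\cup\mathcal P_{12}\cup\mathcal P_{23}$ for $i=2$; $\mathcal F_i$ is the foliation of that domain by the integral curves (principal lines) of $\mathcal L_i$. Type $D_1$: let $p$ be a partially umbilic point, and $e_1,e_2,e_3$ an orthonormal basis of $T_pM$ with $e_1,e_2$ spanning the two-dimensional eigenspace (double principal curvature). Near $p$, $M=\{p+x_1e_1+x_2e_2+x_3e_3+h(x_1,x_2,x_3)N(p)\}$. After a suitable rotation of $e_1,e_2$ the third-order part of $h(x_1,x_2,0)$ is $\frac16(Ax_1^3+3Bx_1x_2^2+Cx_2^3)$. The point is of (Darbouxian) type $D_1$ if $B(B-A)\neq0$ and $\frac AB>\big(\frac{C}{2B}\big)^2+2$. A partially umbilic curve is of type $D_1$ if it is a regular curve all of whose points are of type $D_1$. Partially umbilic separatrix surface: for a partially umbilic curve $\mathcal C\subset\mathcal P_{ij}$ and $k\in\{i,j\}$, the separatrix surface of $\mathcal F_k$ at $\mathcal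 C$ is the union of those leaves of $\mathcal F_k$ having a point of $\mathcal C$ as a limiting endpoint. An open band here is a surface diffeomorphic to $\mathbb S^1\times(0,1)$, and $\partial W$ denotes the topological boundary $\overline W\setminus W$ in $Q_2$. *)

theory Defs
  imports "HOL-Analysis.Analysis"
begin
text \<open>Meaningful for open \<open>U\<close>: the derivatives are two-sided.\<close>

primrec Ck_on :: "nat \<Rightarrow> ('a::euclidean_space \<Rightarrow> 'b::euclidean_space) \<Rightarrow> 'a set \<Rightarrow> bool" where
  "Ck_on 0 f U \<longleftrightarrow> continuous_on U f"
| "Ck_on (Suc n) f U \<longleftrightarrow>
     (\<forall>x\<in>U. f differentiable (at x)) \<and> (\<forall>v. Ck_on n (\<lambda>x. frechet_derivative f (at x) v) U)"

definition smooth_on :: "('a::euclidean_space \<Rightarrow> 'b::euclidean_space) \<Rightarrow> 'a set \<Rightarrow> bool" where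
  "smooth_on f U \<longleftrightarrow> (\<forall>n. Ck_on n f U)"

text \<open>A map on an arbitrary subset is smooth if it locally extends to a smooth map on an open
  set. A subset that is diffeomorphic in this sense to a manifold is an embedded submanifold.\<close>

definition smooth_map_on :: "('a::euclidean_space \<Rightarrow> 'b::euclidean_space) \<Rightarrow> 'a set \<Rightarrow> bool" where
  "smooth_map_on f A \<longleftrightarrow>
     (\<forall>x\<in>A. \<exists>U F. open U \<and> x \<in> U \<and> smooth_on F U \<and> (\<forall>y\<in>A \<inter> U. F y = f y))"

definition diffeomorphic :: "'a::euclidean_space set \<Rightarrow> 'b::euclidean_space set \<Rightarrow> bool" where
  "diffeomorphic A B \<longleftrightarrow>
     (\<exists>f g. smooth_map_on f A \<and> smooth_map_on g B \<and> f ` A = B \<and> g ` B = A \<and>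
            (\<forall>x\<in>A. g (f x) = x) \<and> (\<forall>y\<in>B. f (g y) = y))"

definition regular_curve :: "'a::euclidean_space set \<Rightarrow> bool" where
  "regular_curve C \<longleftrightarrow> C \<noteq> {} \<and> connected C \<and>
     (\<forall>p\<in>C. \<exists>V. open V \<and> p \<in> V \<and> diffeomorphic (C \<inter> V) {0<..<1::real})"

definition open_band :: "'a::euclidean_space set \<Rightarrow> bool" where
  "open_band W \<longleftrightarrow> diffeomorphic W (sphere (0 :: real \<times> real) 1 \<times> {0<..<1::real})"

definition tangent_space :: "(real^4) set \<Rightarrow> real^4 \<Rightarrow> (real^4) set" where
  "tangent_space M p =
     {v. \<exists>\<gamma> \<epsilon>. \<epsilon> > 0 \<and> \<gamma> 0 = p \<and> (\<forall>s\<in>{-\<epsilon><..<\<epsilon>}. \<gamma> s \<in> M) \<and>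
              (\<gamma> has_vector_derivative v) (at (0::real))}"

text \<open>The derivative within \<open>M\<close> is determined only on tangent vectors, and the operator below
  is only ever applied to those.\<close>

definition shape_operator ::
    "(real^4) set \<Rightarrow> (real^4 \<Rightarrow> real^4) \<Rightarrow> real^4 \<Rightarrow> real^4 \<Rightarrow> real^4" where
  "shape_operator M N p v = frechet_derivative (\<lambda>q. - N q) (at p within M) v"

definition eigenspace ::
    "(real^4) set \<Rightarrow> (real^4 \<Rightarrow> real^4) \<Rightarrow> real^4 \<Rightarrow> real \<Rightarrow> (real^4) set" where
  "eigenspace M N p \<kappa> = {v \<in> tangent_space M p. shape_operator M N p v = \<kappa> *\<^sub>R v}"

text \<open>The multiplicity of an eigenvalue is the dimension of its eigenspace, as the operator is
  self-adjoint; so the list below has length 3.\<close>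

definition principal_curvatures ::
    "(real^4) set \<Rightarrow> (real^4 \<Rightarrow> real^4) \<Rightarrow> real^4 \<Rightarrow> real list" where
  "principal_curvatures M N p =
     (THE ks. sorted ks \<and> (\<forall>\<kappa>. count_list ks \<kappa> = dim (eigenspace M N p \<kappa>)))"

definition principal_curvature ::
    "(real^4) set \<Rightarrow> (real^4 \<Rightarrow> real^4) \<Rightarrow> nat \<Rightarrow> real^4 \<Rightarrow> real" where
  "principal_curvature M N i p = principal_curvatures M N p ! (i - 1)"

definition umbilic_set :: "(real^4) set \<Rightarrow> (real^4 \<Rightarrow> real^4) \<Rightarrow> (real^4) set" where
  "umbilic_set M N = {p \<in> M.
     principal_curvature M N 1 p = principal_curvature M N 2 p \<and>
     principal_curvature M N 2 p = principal_curvature M N 3 p}"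

definition part_umb_12 :: "(real^4) set \<Rightarrow> (real^4 \<Rightarrow> real^4) \<Rightarrow> (real^4) set" where
  "part_umb_12 M N = {p \<in> M.
     principal_curvature M N 1 p = principal_curvature M N 2 p \<and>
     principal_curvature M N 2 p < principal_curvature M N 3 p}"

definition part_umb_23 :: "(real^4) set \<Rightarrow> (real^4 \<Rightarrow> real^4) \<Rightarrow> (real^4) set" where
  "part_umb_23 M N = {p \<in> M.
     principal_curvature M N 1 p < principal_curvature M N 2 p \<and>
     principal_curvature M N 2 p = principal_curvature M N 3 p}"

definition part_umb_set :: "(real^4) set \<Rightarrow> (real^4 \<Rightarrow> real^4) \<Rightarrow> (real^4) set" where
  "part_umb_set M N = part_umb_12 M N \<union> part_umb_23 M N"

definition eigenline ::
    "(real^4) set \<Rightarrow> (real^4 \<Rightarrow> real^4) \<Rightarrow> nat \<Rightarrow> real^4 \<Rightarrow> (real^4) set" where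
  "eigenline M N i p = eigenspace M N p (principal_curvature M N i p)"

definition foliation_domain ::
    "(real^4) set \<Rightarrow> (real^4 \<Rightarrow> real^4) \<Rightarrow> nat \<Rightarrow> (real^4) set" where
  "foliation_domain M N i =
     (if i = 1 then M - (umbilic_set M N \<union> part_umb_12 M N)
      else if i = 2 then M - (umbilic_set M N \<union> part_umb_12 M N \<union> part_umb_23 M N)
      else if i = 3 then M - (umbilic_set M N \<union> part_umb_23 M N)
      else {})"

text \<open>Since every regular parametrization is allowed, it is no restriction to consider only
  integral curves over bounded open intervals.\<close>

definition integral_curve ::
    "(real^4) set \<Rightarrow> (real^4 \<Rightarrow> real^4) \<Rightarrow> nat \<Rightarrow> (real \<Rightarrow> real^4) \<Rightarrow> real \<Rightarrow> real \<Rightarrow> bool" where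
  "integral_curve M N i \<gamma> \<alpha> \<beta> \<longleftrightarrow> \<alpha> < \<beta> \<and>
     (\<exists>\<gamma>'. continuous_on {\<alpha><..<\<beta>} \<gamma>' \<and>
       (\<forall>s\<in>{\<alpha><..<\<beta>}. (\<gamma> has_vector_derivative \<gamma>' s) (at s) \<and> \<gamma>' s \<noteq> 0 \<and>
          \<gamma> s \<in> foliation_domain M N i \<and> \<gamma>' s \<in> eigenline M N i (\<gamma> s)))"

definition leaf_through ::
    "(real^4) set \<Rightarrow> (real^4 \<Rightarrow> real^4) \<Rightarrow> nat \<Rightarrow> real^4 \<Rightarrow> (real^4) set" where
  "leaf_through M N i p =
     {q. \<exists>\<gamma> \<alpha> \<beta>. integral_curve M N i \<gamma> \<alpha> \<beta> \<and>
                 p \<in> \<gamma> ` {\<alpha><..<\<beta>} \<and> q \<in> \<gamma> ` {\<alpha><..<\<beta>}}"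

definition leaves :: "(real^4) set \<Rightarrow> (real^4 \<Rightarrow> real^4) \<Rightarrow> nat \<Rightarrow> (real^4) set set" where
  "leaves M N i = leaf_through M N i ` foliation_domain M N i"

definition limiting_endpoint ::
    "(real^4) set \<Rightarrow> (real^4 \<Rightarrow> real^4) \<Rightarrow> nat \<Rightarrow> (real^4) set \<Rightarrow> real^4 \<Rightarrow> bool" where
  "limiting_endpoint M N i L q \<longleftrightarrow>
     (\<exists>\<gamma> \<alpha> \<beta>. integral_curve M N i \<gamma> \<alpha> \<beta> \<and> \<gamma> ` {\<alpha><..<\<beta>} = L \<and>
        ((\<gamma> \<longlongrightarrow> q) (at_right \<alpha>) \<or> (\<gamma> \<longlongrightarrow> q) (at_left \<beta>)))"

definition separatrix_surface ::
    "(real^4) set \<Rightarrow> (real^4 \<Rightarrow> real^4) \<Rightarrow> nat \<Rightarrow> (real^4) set \<Rightarrow> (real^4) set" where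
  "separatrix_surface M N i C = \<Union>{L \<in> leaves M N i. \<exists>q\<in>C. limiting_endpoint M N i L q}"

text \<open>The third-order part of \<open>g\<close> at the origin, evaluated at \<open>x\<close>, is one sixth of the third
  derivative at \<open>0\<close> of \<open>s \<mapsto> g (s x)\<close>; the factor \<open>1/6\<close> is cancelled on both sides below.\<close>

definition type_D1_point ::
    "(real^4) set \<Rightarrow> (real^4 \<Rightarrow> real^4) \<Rightarrow> real^4 \<Rightarrow> bool" where
  "type_D1_point M N p \<longleftrightarrow> p \<in> part_umb_set M N \<and>
     (\<exists>e1 e2 e3 (h :: real \<times> real \<times> real \<Rightarrow> real) U V A B C.
        norm e1 = 1 \<and> norm e2 = 1 \<and> norm e3 = 1 \<and>
        e1 \<bullet> e2 = 0 \<and> e1 \<bullet> e3 = 0 \<and> e2 \<bullet> e3 = 0 \<and>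
        span {e1, e2, e3} = tangent_space M p \<and>
        (\<exists>\<kappa>. span {e1, e2} = eigenspace M N p \<kappa>) \<and>
        open U \<and> (0, 0, 0) \<in> U \<and> smooth_on h U \<and> open V \<and> p \<in> V \<and>
        M \<inter> V = {p + x1 *\<^sub>R e1 + x2 *\<^sub>R e2 + x3 *\<^sub>R e3 + h (x1, x2, x3) *\<^sub>R N p | x1 x2 x3.
                   (x1, x2, x3) \<in> U} \<and>
        (\<forall>x1 x2. (deriv ^^ 3) (\<lambda>s. h (s * x1, s * x2, 0)) 0
                   = A * x1 ^ 3 + 3 * B * x1 * x2 ^ 2 + C * x2 ^ 3) \<and>
        B * (B - A) \<noteq> 0 \<and> A / B > (C / (2 * B)) ^ 2 + 2)"

definition type_D1_curve :: "(real^4) set \<Rightarrow> (real^4 \<Rightarrow> real^4) \<Rightarrow> (real^4) set \<Rightarrow> bool" where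
  "type_D1_curve M N C \<longleftrightarrow> regular_curve C \<and> (\<forall>p\<in>C. type_D1_point M N p)"

definition Q2_form :: "real \<Rightarrow> real \<Rightarrow> real \<Rightarrow> real \<Rightarrow> real^4 \<Rightarrow> real" where
  "Q2_form a b c d p =
     (p $ 1)\<^sup>2 / a\<^sup>2 + (p $ 2)\<^sup>2 / b\<^sup>2 - (p $ 3)\<^sup>2 / c\<^sup>2 - (p $ 4)\<^sup>2 / d\<^sup>2"

definition Q2 :: "real \<Rightarrow> real \<Rightarrow> real \<Rightarrow> real \<Rightarrow> (real^4) set" where
  "Q2 a b c d = {p. Q2_form a b c d p - 1 = 0}"

definition gradient :: "('a::real_inner \<Rightarrow> real) \<Rightarrow> 'a \<Rightarrow> 'a" where
  "gradient f p = (THE G. GDERIV f p :> G)"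

definition Q2_normal :: "real \<Rightarrow> real \<Rightarrow> real \<Rightarrow> real \<Rightarrow> real^4 \<Rightarrow> real^4" where
  "Q2_normal a b c d p = sgn (gradient (Q2_form a b c d) p)"

text \<open>The sign in the last coordinate is \<open>\<sigma> = 1\<close> or \<open>\<sigma> = -1\<close>.\<close>

definition Q2_param ::
    "real \<Rightarrow> real \<Rightarrow> real \<Rightarrow> real \<Rightarrow> real \<Rightarrow> real \<Rightarrow> real \<Rightarrow> real \<Rightarrow> real^4" where
  "Q2_param a b c d \<sigma> u v w =
     vector [a * u, b * v, c * w, \<sigma> * d * sqrt (u\<^sup>2 + v\<^sup>2 - w\<^sup>2 - 1)]"

end

theory Submission
  imports Defs
begin

text \<open>Put \<open>A = a\<^sup>2\<close>, \<open>B = b\<^sup>2\<close>, \<open>C = c\<^sup>2\<close>, \<open>D = d\<^sup>2\<close> and \<open>Dm = diag(A, B, -C, -D)\<close>. At a point \<open>p\<close> of the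
  quadric, the principal curvature \<open>- 1 / (norm (Am p) * \<nu>)\<close>, where \<open>Am = Dm\<^bsup>-1\<^esup>\<close>, has as its eigenspace the
  eigenspace for \<open>\<nu>\<close> of the symmetric map \<open>v \<mapsto> Dm v - (v \<bullet> p) p\<close>. The values \<open>\<nu>\<close> are
  the ellipsoidal coordinates of \<open>p\<close>, with \<open>\<nu>\<^sub>2 \<le> - C \<le> \<nu>\<^sub>3 \<le> - D < 0 < B \<le> \<nu>\<^sub>1 \<le> A\<close>. Hence the
  only coincidence is \<open>\<nu>\<^sub>2 = \<nu>\<^sub>3 = - C\<close>. Along a principal line of the \<open>i\<close>-th foliation the other
  two coordinates are constant, and the line is the level curve of these coordinates, for which there are
  explicit trigonometric or algebraic parametrizations. The separatrix surface is \<open>\<nu>\<^sub>2 = - C < \<nu>\<^sub>3\<close>. At a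
  partially umbilic point the cubic part of the height function on the double eigenspace is the norm
  squared times a nonzero linear form, so \<open>C = 0\<close> and \<open>A / B = 3\<close> in the notation of type \<open>D\<^sub>1\<close>.\<close>

text \<open>A leaf is a union of arbitrary integral curves, so exhibiting an explicit principal line
  is not enough: every integral curve through one of its points must be shown to stay on it.
  Conservation laws play the role of a uniqueness theorem for the differential equation. The sorted
  coordinates are roots of a polynomial and need not be differentiable where two of them meet;
  therefore the values \<open>\<Phi> p \<nu>\<close> at a fixed \<nu>, which are polynomial in
  \<open>p\<close>, are differentiated instead. The two conserved coordinates determine the squares
  of the entries of \<open>p\<close> as functions of the moving one. Connectedness fixes the sign of
  an entry that cannot vanish along the curve; the signs of the others are produced by the sine,
  cosine or linear factor of the parametrization. The map \<open>S p\<close> arises when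
  \<open>Dm\<close> is applied to the eigenvalue equation of the shape operator: the tangential
  projection there leaves a multiple of \<open>Am p\<close>, which becomes a multiple of
  \<open>p\<close>.\<close>

section \<open>Calculus of smooth maps\<close>

text \<open>Openness gives equal functions equal two-sided derivatives, so the induction passes from
  values to derivatives.\<close>

lemma Ck_on_cong:
  assumes "open U" "\<And>x. x \<in> U \<Longrightarrow> f x = g x" "Ck_on n f U"
  shows "Ck_on n g U"
  using assms(2,3)
proof (induction n arbitrary: f g)
  case 0
  then show ?case by (simp cong: continuous_on_cong)
next
  case (Suc n)
  have D: "(g has_derivative frechet_derivative f (at x)) (at x)" if "x \<in> U" for x
  proof -
    have "(f has_derivative frechet_derivative f (at x)) (at x)"
      using Suc.prems(2) that by (simp add: frechet_derivative_works)
    then show ?thesis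
      by (rule has_derivative_transform_within_open[OF _ \<open>open U\<close> that]) (simp add: Suc.prems(1))
  qed
  have "frechet_derivative f (at x) = frechet_derivative g (at x)" if "x \<in> U" for x
    by (rule frechet_derivative_at[OF D[OF that]])
  then have "Ck_on n (\<lambda>x. frechet_derivative g (at x) v) U" for v
    using Suc.IH[of "\<lambda>x. frechet_derivative f (at x) v" "\<lambda>x. frechet_derivative g (at x) v"]
      Suc.prems(2) by auto
  moreover have "\<forall>x\<in>U. g differentiable at x"
    using D by (auto simp: differentiable_def)
  ultimately show ?case by simp
qed

text \<open>\<open>frechet_derivative\<close> is a choice operator; this rule lets a derivative
  known by a formula be used in its place.\<close>

lemma Ck_on_SucI:
  assumes "open U" "\<And>x. x \<in> U \<Longrightarrow> (f has_derivative f' x) (at x)"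
    and "\<And>v. Ck_on n (\<lambda>x. f' x v) U"
  shows "Ck_on (Suc n) f U"
proof -
  have "f' x = frechet_derivative f (at x)" if "x \<in> U" for x
    by (rule frechet_derivative_at[OF assms(2)[OF that]])
  then have "Ck_on n (\<lambda>x. frechet_derivative f (at x) v) U" for v
    using Ck_on_cong[OF assms(1) _ assms(3)[of v], of "\<lambda>x. frechet_derivative f (at x) v"] by simp
  moreover have "\<forall>x\<in>U. f differentiable at x"
    using assms(2) by (auto simp: differentiable_def)
  ultimately show ?thesis by simp
qed

lemma Ck_on_Suc_derivative:
  "Ck_on (Suc n) f U \<Longrightarrow> x \<in> U \<Longrightarrow> (f has_derivative frechet_derivative f (at x)) (at x)"
  by (simp add: frechet_derivative_works)

lemma Ck_on_SucD: "Ck_on (Suc n) f U \<Longrightarrow> Ck_on n f U"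
proof (induction n arbitrary: f)
  case 0
  then show ?case
    by (auto intro!: differentiable_imp_continuous_on differentiable_at_imp_differentiable_on)
next
  case (Suc n)
  then show ?case by (metis Ck_on.simps(2))
qed

lemma Ck_on_const: "open U \<Longrightarrow> Ck_on n (\<lambda>x. c) U"
proof (induction n arbitrary: c)
  case (Suc n)
  show ?case by (rule Ck_on_SucI[where f'="\<lambda>x v. 0"]) (use Suc in auto)
qed simp

lemma Ck_on_bounded_linear:
  assumes "bounded_linear L" "open U"
  shows "Ck_on n L U"
proof (cases n)
  case 0
  then show ?thesis by (simp add: assms linear_continuous_on)
next
  case (Suc m)
  show ?thesis unfolding Suc
    by (rule Ck_on_SucI[where f'="\<lambda>x. L"])
      (use assms in \<open>auto intro: Ck_on_const bounded_linear_imp_has_derivative\<close>)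
qed

lemma Ck_on_linear_comp:
  assumes "bounded_linear L" "open U" "Ck_on n f U"
  shows "Ck_on n (\<lambda>x. L (f x)) U"
  using assms(3)
proof (induction n arbitrary: f)
  case 0
  then show ?case
    using bounded_linear.continuous_on[OF assms(1), of U f] by simp
next
  case (Suc n)
  show ?case
    by (rule Ck_on_SucI[where f'="\<lambda>x v. L (frechet_derivative f (at x) v)"])
      (use Suc assms in \<open>auto intro: bounded_linear.has_derivative[OF assms(1)] simp: frechet_derivative_works\<close>)
qed

lemma Ck_on_add:
  assumes "open U" "Ck_on n f U" "Ck_on n g U"
  shows "Ck_on n (\<lambda>x. f x + g x) U"
  using assms(2,3)
proof (induction n arbitrary: f g)
  case 0
  then show ?case by (simp add: continuous_on_add)
next
  case (Suc n)
  show ?case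
    by (rule Ck_on_SucI[where f'="\<lambda>x v. frechet_derivative f (at x) v + frechet_derivative g (at x) v"])
      (use Suc assms in \<open>auto intro!: has_derivative_add simp: frechet_derivative_works\<close>)
qed

lemma Ck_on_mult:
  fixes f g :: "'a::euclidean_space \<Rightarrow> real"
  assumes "open U" "Ck_on n f U" "Ck_on n g U"
  shows "Ck_on n (\<lambda>x. f x * g x) U"
  using assms(2,3)
proof (induction n arbitrary: f g)
  case 0
  then show ?case by (simp add: continuous_on_mult)
next
  case (Suc n)
  show ?case
  proof (rule Ck_on_SucI[OF assms(1)])
    fix x assume "x \<in> U"
    then show "((\<lambda>x. f x * g x) has_derivative
        (\<lambda>v. f x * frechet_derivative g (at x) v + frechet_derivative f (at x) v * g x)) (at x)"
      using Suc.prems by (intro has_derivative_mult Ck_on_Suc_derivative)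
  next
    fix v
    show "Ck_on n (\<lambda>x. f x * frechet_derivative g (at x) v + frechet_derivative f (at x) v * g x) U"
      using Suc.prems Ck_on_SucD[OF Suc.prems(1)] Ck_on_SucD[OF Suc.prems(2)]
      by (intro Ck_on_add[OF assms(1)] Suc.IH) auto
  qed
qed

text \<open>The derivative of 1/f is built from 1/f and derivatives of f, so the order
  \<open>n\<close> of 1/f that is needed for order \<open>Suc n\<close> is the induction hypothesis.
  The square root and the exponential close up in the same way.\<close>

lemma Ck_on_inverse:
  fixes f :: "'a::euclidean_space \<Rightarrow> real"
  assumes "open U" "Ck_on n f U" "\<And>x. x \<in> U \<Longrightarrow> f x \<noteq> 0"
  shows "Ck_on n (\<lambda>x. inverse (f x)) U"
  using assms(2)
proof (induction n)
  case 0
  then show ?case using assms(3) by (simp add: continuous_on_inverse)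
next
  case (Suc n)
  show ?case
  proof (rule Ck_on_SucI[OF assms(1)])
    fix x assume "x \<in> U"
    then show "((\<lambda>x. inverse (f x)) has_derivative
        (\<lambda>v. - (inverse (f x) * frechet_derivative f (at x) v * inverse (f x)))) (at x)"
      using Suc.prems assms(3) by (intro Deriv.has_derivative_inverse Ck_on_Suc_derivative) auto
  next
    fix v
    have "Ck_on n (\<lambda>x. (- 1) * (inverse (f x) * frechet_derivative f (at x) v * inverse (f x))) U"
      using Suc.prems Suc.IH[OF Ck_on_SucD[OF Suc.prems]]
      by (intro Ck_on_mult[OF assms(1)] Ck_on_const[OF assms(1)]) auto
    then show "Ck_on n (\<lambda>x. - (inverse (f x) * frechet_derivative f (at x) v * inverse (f x))) U"
      by simp
  qed
qed

lemma Ck_on_sqrt: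
  fixes f :: "'a::euclidean_space \<Rightarrow> real"
  assumes "open U" "Ck_on n f U" "\<And>x. x \<in> U \<Longrightarrow> f x > 0"
  shows "Ck_on n (\<lambda>x. sqrt (f x)) U"
  using assms(2)
proof (induction n)
  case 0
  then show ?case by (simp add: continuous_on_real_sqrt)
next
  case (Suc n)
  show ?case
  proof (rule Ck_on_SucI[OF assms(1)])
    fix x assume x: "x \<in> U"
    have "(sqrt has_real_derivative inverse (sqrt (f x)) / 2) (at (f x))"
      using assms(3)[OF x] by (rule DERIV_real_sqrt)
    from DERIV_compose_FDERIV[OF this Ck_on_Suc_derivative[OF Suc.prems x]]
    show "((\<lambda>x. sqrt (f x)) has_derivative
        (\<lambda>v. frechet_derivative f (at x) v * (inverse (sqrt (f x)) / 2))) (at x)" .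
  next
    fix v
    have "Ck_on n (\<lambda>x. frechet_derivative f (at x) v * (inverse (sqrt (f x)) * (1/2))) U"
      using Suc.prems Suc.IH[OF Ck_on_SucD[OF Suc.prems]] less_imp_neq[OF assms(3)]
      by (intro Ck_on_mult[OF assms(1)] Ck_on_const[OF assms(1)] Ck_on_inverse[OF assms(1)]) auto
    then show "Ck_on n (\<lambda>x. frechet_derivative f (at x) v * (inverse (sqrt (f x)) / 2)) U"
      by simp
  qed
qed

text \<open>A case distinction suffices here, because the derivative of the logarithm involves only
  a reciprocal.\<close>

lemma Ck_on_ln:
  fixes f :: "'a::euclidean_space \<Rightarrow> real"
  assumes "open U" "Ck_on n f U" "\<And>x. x \<in> U \<Longrightarrow> f x > 0"
  shows "Ck_on n (\<lambda>x. ln (f x)) U"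
proof (cases n)
  case 0
  then show ?thesis using assms less_imp_neq[OF assms(3)] by (auto intro!: continuous_on_ln)
next
  case (Suc m)
  show ?thesis unfolding Suc
  proof (rule Ck_on_SucI[OF assms(1)])
    fix x assume x: "x \<in> U"
    show "((\<lambda>x. ln (f x)) has_derivative
        (\<lambda>v. frechet_derivative f (at x) v * inverse (f x))) (at x)"
      using DERIV_compose_FDERIV[OF DERIV_ln[OF assms(3)[OF x]] Ck_on_Suc_derivative[of m f U x]]
        assms(2) x Suc by blast
  next
    fix v
    show "Ck_on m (\<lambda>x. frechet_derivative f (at x) v * inverse (f x)) U"
      using assms(2) Ck_on_SucD[of m f U] less_imp_neq[OF assms(3)] unfolding Suc
      by (intro Ck_on_mult[OF assms(1)] Ck_on_inverse[OF assms(1)]) auto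
  qed
qed

lemma Ck_on_exp:
  fixes f :: "'a::euclidean_space \<Rightarrow> real"
  assumes "open U" "Ck_on n f U"
  shows "Ck_on n (\<lambda>x. exp (f x)) U"
  using assms(2)
proof (induction n)
  case 0
  then show ?case by (simp add: continuous_on_exp)
next
  case (Suc n)
  show ?case
  proof (rule Ck_on_SucI[OF assms(1)])
    fix x assume x: "x \<in> U"
    from DERIV_compose_FDERIV[OF DERIV_exp Ck_on_Suc_derivative[OF Suc.prems x]]
    show "((\<lambda>x. exp (f x)) has_derivative (\<lambda>v. frechet_derivative f (at x) v * exp (f x))) (at x)" .
  next
    fix v
    show "Ck_on n (\<lambda>x. frechet_derivative f (at x) v * exp (f x)) U"
      using Suc.prems Suc.IH[OF Ck_on_SucD[OF Suc.prems]]
      by (intro Ck_on_mult[OF assms(1)]) auto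
  qed
qed

lemma smooth_on_bounded_linear: "bounded_linear L \<Longrightarrow> open U \<Longrightarrow> smooth_on L U"
  by (simp add: smooth_on_def Ck_on_bounded_linear)

lemma smooth_on_linear_comp:
  "bounded_linear L \<Longrightarrow> open U \<Longrightarrow> smooth_on f U \<Longrightarrow> smooth_on (\<lambda>x. L (f x)) U"
  by (simp add: smooth_on_def Ck_on_linear_comp)

lemma smooth_on_const: "open U \<Longrightarrow> smooth_on (\<lambda>x. c) U"
  by (simp add: smooth_on_def Ck_on_const)

lemma smooth_on_add: "open U \<Longrightarrow> smooth_on f U \<Longrightarrow> smooth_on g U \<Longrightarrow> smooth_on (\<lambda>x. f x + g x) U"
  by (simp add: smooth_on_def Ck_on_add)

lemma smooth_on_id: "open U \<Longrightarrow> smooth_on (\<lambda>x. x) U"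
  by (simp add: smooth_on_bounded_linear bounded_linear_ident)

lemma smooth_on_vec_nth: "open U \<Longrightarrow> smooth_on (\<lambda>x::real^'n. x $ i) U"
  by (simp add: smooth_on_bounded_linear bounded_linear_vec_nth)

lemma smooth_on_fst: "open U \<Longrightarrow> smooth_on f U \<Longrightarrow> smooth_on (\<lambda>x. fst (f x)) U"
  by (rule smooth_on_linear_comp[OF bounded_linear_fst])

lemma smooth_on_snd: "open U \<Longrightarrow> smooth_on f U \<Longrightarrow> smooth_on (\<lambda>x. snd (f x)) U"
  by (rule smooth_on_linear_comp[OF bounded_linear_snd])

lemma smooth_on_Pair:
  assumes "open U" "smooth_on f U" "smooth_on g U"
  shows "smooth_on (\<lambda>x. (f x, g x)) U"
proof -
  have "bounded_linear (\<lambda>x. (x, 0))" "bounded_linear (\<lambda>x. (0, x))"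
    by (auto intro: bounded_linear_Pair bounded_linear_ident bounded_linear_zero)
  then have "smooth_on (\<lambda>x. (f x, 0) + (0, g x)) U"
    using assms by (intro smooth_on_add smooth_on_linear_comp[of "\<lambda>x. (x, 0)" U f]
        smooth_on_linear_comp[of "\<lambda>x. (0, x)" U g])
  then show ?thesis by simp
qed

context
  fixes U :: "'a::euclidean_space set" and f g :: "'a \<Rightarrow> real"
  assumes U: "open U" and f: "smooth_on f U"
begin

lemma smooth_on_mult: "smooth_on g U \<Longrightarrow> smooth_on (\<lambda>x. f x * g x) U"
  using U f by (simp add: smooth_on_def Ck_on_mult)

lemma smooth_on_minus: "smooth_on (\<lambda>x. - f x) U"
  using smooth_on_linear_comp[OF bounded_linear_minus[OF bounded_linear_ident] U f] .

lemma smooth_on_inverse: "(\<And>x. x \<in> U \<Longrightarrow> f x \<noteq> 0) \<Longrightarrow> smooth_on (\<lambda>x. inverse (f x)) U"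
  using U f by (simp add: smooth_on_def Ck_on_inverse)

lemma smooth_on_sqrt: "(\<And>x. x \<in> U \<Longrightarrow> f x > 0) \<Longrightarrow> smooth_on (\<lambda>x. sqrt (f x)) U"
  using U f by (simp add: smooth_on_def Ck_on_sqrt)

lemma smooth_on_ln: "(\<And>x. x \<in> U \<Longrightarrow> f x > 0) \<Longrightarrow> smooth_on (\<lambda>x. ln (f x)) U"
  using U f by (simp add: smooth_on_def Ck_on_ln)

lemma smooth_on_exp: "smooth_on (\<lambda>x. exp (f x)) U"
  using U f by (simp add: smooth_on_def Ck_on_exp)

lemma smooth_on_power: "smooth_on (\<lambda>x. f x ^ n) U"
proof (induction n)
  case 0
  then show ?case by (simp add: smooth_on_const[OF U])
next
  case (Suc n)
  then show ?case using U f by (simp add: smooth_on_def Ck_on_mult)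
qed

end

lemma smooth_on_diff:
  fixes f g :: "'a::euclidean_space \<Rightarrow> real"
  assumes "open U" "smooth_on f U" "smooth_on g U"
  shows "smooth_on (\<lambda>x. f x - g x) U"
  using smooth_on_add[OF assms(1,2) smooth_on_minus[OF assms(1,3)]] by simp

lemma smooth_on_divide:
  fixes f g :: "'a::euclidean_space \<Rightarrow> real"
  assumes "open U" "smooth_on f U" "smooth_on g U" "\<And>x. x \<in> U \<Longrightarrow> g x \<noteq> 0"
  shows "smooth_on (\<lambda>x. f x / g x) U"
  unfolding divide_inverse using assms by (intro smooth_on_mult smooth_on_inverse)

lemma vector_4:
  "vector [x, y, z, w] $ (1::4) = x" "vector [x, y, z, w] $ (2::4) = y"
  "vector [x, y, z, w] $ (3::4) = z" "vector [x, y, z, w] $ (4::4) = w"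
  by (simp_all add: vector_def)

lemma smooth_on_vector_4:
  fixes f1 f2 f3 f4 :: "'a::euclidean_space \<Rightarrow> real"
  assumes "open U" "smooth_on f1 U" "smooth_on f2 U" "smooth_on f3 U" "smooth_on f4 U"
  shows "smooth_on (\<lambda>x. vector [f1 x, f2 x, f3 x, f4 x] :: real^4) U"
proof -
  have "smooth_on (\<lambda>x. f1 x *\<^sub>R axis 1 1 + f2 x *\<^sub>R axis 2 1 + f3 x *\<^sub>R axis 3 1
      + f4 x *\<^sub>R (axis 4 1 :: real^4)) U"
    using assms by (intro smooth_on_add smooth_on_linear_comp[OF bounded_linear_scaleR_left])
  moreover have "f1 x *\<^sub>R axis 1 1 + f2 x *\<^sub>R axis 2 1 + f3 x *\<^sub>R axis 3 1
      + f4 x *\<^sub>R (axis 4 1 :: real^4) = vector [f1 x, f2 x, f3 x, f4 x]" for x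
    by (simp add: vec_eq_iff forall_4 vector_4 axis_def)
  ultimately show ?thesis by simp
qed

lemmas smooth_on_intros = smooth_on_const smooth_on_id smooth_on_vec_nth smooth_on_fst
  smooth_on_snd smooth_on_Pair smooth_on_add smooth_on_mult smooth_on_minus smooth_on_diff
  smooth_on_inverse smooth_on_divide smooth_on_sqrt smooth_on_ln smooth_on_exp smooth_on_power
  smooth_on_vector_4

lemma smooth_map_onI:
  assumes "open U" "smooth_on f U" "A \<subseteq> U"
  shows "smooth_map_on f A"
  unfolding smooth_map_on_def using assms by (intro ballI exI[of _ U] exI[of _ f]) auto

lemma diffeomorphicI:
  assumes "open U" "smooth_on f U" "A \<subseteq> U" "open V" "smooth_on g V" "B \<subseteq> V"
    and "\<And>x. x \<in> A \<Longrightarrow> f x \<in> B \<and> g (f x) = x" "\<And>y. y \<in> B \<Longrightarrow> g y \<in> A \<and> f (g y) = y"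
  shows "diffeomorphic A B"
  unfolding diffeomorphic_def
proof (intro exI conjI)
  show "smooth_map_on f A"
    by (rule smooth_map_onI[OF assms(1-3)])
  show "smooth_map_on g B"
    by (rule smooth_map_onI[OF assms(4-6)])
  show "f ` A = B"
    using assms(7,8) by (metis image_subsetI image_iff subsetI subset_antisym)
  show "g ` B = A"
    using assms(7,8) by (metis image_subsetI image_iff subsetI subset_antisym)
qed (use assms(7,8) in auto)

section \<open>Linear algebra and the shape operator\<close>

text \<open>Eigenvalues of the basis may repeat. Pairing \<open>S x = k *\<^sub>R x\<close> with the
  basis vector \<open>v j\<close> gives k (x . v j) = (ev j) (x . v j), which kills every
  coefficient with \<open>ev j \<noteq> k\<close>; hence multiplicities are counted by
  indices.\<close>

lemma eigenspace_orthogonal_basis: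
  fixes S :: "'a::euclidean_space \<Rightarrow> 'a" and v :: "nat \<Rightarrow> 'a" and ev :: "nat \<Rightarrow> real"
  assumes S: "linear S" "\<And>x y. S x \<bullet> y = x \<bullet> S y"
    and v: "\<And>i. i < DIM('a) \<Longrightarrow> v i \<noteq> 0" "\<And>i. i < DIM('a) \<Longrightarrow> S (v i) = ev i *\<^sub>R v i"
    and orth: "\<And>i j. i < DIM('a) \<Longrightarrow> j < DIM('a) \<Longrightarrow> i \<noteq> j \<Longrightarrow> v i \<bullet> v j = 0"
  shows "{x. S x = k *\<^sub>R x} = span (v ` {i. i < DIM('a) \<and> ev i = k})"
    and "dim {x. S x = k *\<^sub>R x} = card {i. i < DIM('a) \<and> ev i = k}"
proof -
  define n where "n = DIM('a)"
  define J where "J = {i. i < n \<and> ev i = k}"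
  have inj: "inj_on v {..<n}"
  proof (rule inj_onI, rule ccontr)
    fix i j assume ij: "i \<in> {..<n}" "j \<in> {..<n}" "v i = v j" "i \<noteq> j"
    then have "v i \<bullet> v i = 0" using orth[of i j] by (simp add: n_def)
    then show False using v(1)[of i] ij by (simp add: n_def)
  qed
  have indep: "independent (v ` I)" if "I \<subseteq> {..<n}" for I
  proof (rule pairwise_orthogonal_independent)
    show "pairwise orthogonal (v ` I)"
    proof (rule pairwise_imageI)
      fix i j assume "i \<in> I" "j \<in> I" "i \<noteq> j"
      then show "orthogonal (v i) (v j)"
        using that orth[of i j] by (auto simp: orthogonal_def n_def subset_iff)
    qed
    show "0 \<notin> v ` I" using that v(1) by (force simp: n_def)
  qed
  have "card (v ` {..<n}) = DIM('a)"
    using card_image[OF inj] by (simp add: n_def)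
  then have sp: "span (v ` {..<n}) = UNIV"
    using card_eq_dim[of "v ` {..<n}" UNIV] indep[of "{..<n}"] by auto
  show eq: "{x. S x = k *\<^sub>R x} = span (v ` J)"
  proof (intro subset_antisym subsetI)
    fix x assume "x \<in> span (v ` J)"
    moreover have "subspace {x. S x = k *\<^sub>R x}"
      using S(1) by (auto simp: subspace_def linear_0 linear_add linear_scale scaleR_right_distrib)
    moreover have "v ` J \<subseteq> {x. S x = k *\<^sub>R x}" using v(2) by (auto simp: J_def n_def)
    ultimately show "x \<in> {x. S x = k *\<^sub>R x}" using span_minimal by blast
  next
    fix x assume x: "x \<in> {x. S x = k *\<^sub>R x}"
    have "x \<in> span (v ` {..<n})" using sp by simp
    then obtain u where u: "x = (\<Sum>w\<in>v ` {..<n}. u w *\<^sub>R w)"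
      using span_finite[of "v ` {..<n}"] by auto
    then have u2: "x = (\<Sum>i<n. u (v i) *\<^sub>R v i)"
      by (simp add: sum.reindex[OF inj])
    have "u (v j) = 0" if "j < n" "ev j \<noteq> k" for j
    proof -
      have "k * (x \<bullet> v j) = S x \<bullet> v j" using x by simp
      also have "\<dots> = ev j * (x \<bullet> v j)" using S(2) v(2)[of j] that by (simp add: n_def)
      finally have "x \<bullet> v j = 0" using that by simp
      moreover have "x \<bullet> v j = (\<Sum>i<n. u (v i) * (v i \<bullet> v j))"
        by (subst u2) (simp add: inner_sum_left)
      moreover have "\<dots> = (\<Sum>i<n. if i = j then u (v j) * (v j \<bullet> v j) else 0)"
        by (rule sum.cong) (use that orth in \<open>auto simp: n_def\<close>)
      ultimately show ?thesis using that v(1)[of j] by (simp add: n_def)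
    qed
    then have "x = (\<Sum>i\<in>J. u (v i) *\<^sub>R v i)"
      by (subst u2, intro sum.mono_neutral_right) (auto simp: J_def)
    also have "\<dots> \<in> span (v ` J)"
      by (intro span_sum span_scale span_base) auto
    finally show "x \<in> span (v ` J)" .
  qed
  have "J \<subseteq> {..<n}" by (auto simp: J_def)
  then show "dim {x. S x = k *\<^sub>R x} = card J"
    unfolding eq dim_span by (subst dim_eq_card_independent[OF indep])
      (auto intro!: card_image inj_on_subset[OF inj])
qed

text \<open>Gives the uniqueness that the definite description in
  \<open>principal_curvatures\<close> requires.\<close>

lemma sorted_count_list_unique:
  fixes xs ys :: "'a::linorder list"
  assumes "sorted xs" "sorted ys" "\<And>k. count_list xs k = count_list ys k"
  shows "xs = ys"
proof -
  have "mset xs = mset ys"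
    by (rule multiset_eqI) (use assms(3) in \<open>simp add: count_mset count_list_eq_length_filter\<close>)
  then have "sort ys = xs" "sort ys = ys"
    using assms(1,2) by (auto intro!: properties_for_sort)
  then show ?thesis by simp
qed

text \<open>Differentiating a normalization means projecting off the direction of \<open>u\<close>
  and rescaling; composed with \<open>Am\<close> this is the derivative of the unit normal.\<close>

lemma has_derivative_sgn:
  fixes u :: "'a::real_inner"
  assumes "u \<noteq> 0"
  shows "(sgn has_derivative (\<lambda>v. (1 / norm u) *\<^sub>R (v - ((u \<bullet> v) / (norm u)\<^sup>2) *\<^sub>R u))) (at u)"
proof -
  have "((\<lambda>x. inverse (norm x) *\<^sub>R x) has_derivative
      (\<lambda>v. inverse (norm u) *\<^sub>R v + (- (inverse (norm u) * (sgn u \<bullet> v) * inverse (norm u))) *\<^sub>R u)) (at u)"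
    using assms has_derivative_norm[OF assms]
    by (intro has_derivative_scaleR has_derivative_ident Deriv.has_derivative_inverse)
      (auto simp: inner_commute)
  moreover have "inverse (norm u) *\<^sub>R v + (- (inverse (norm u) * (sgn u \<bullet> v) * inverse (norm u))) *\<^sub>R u
    = (1 / norm u) *\<^sub>R (v - ((u \<bullet> v) / (norm u)\<^sup>2) *\<^sub>R u)" for v
    using assms by (simp add: sgn_div_norm scaleR_diff_right power2_eq_square divide_simps)
  ultimately show ?thesis
    by (simp add: sgn_div_norm[abs_def] divide_inverse_commute fun_eq_iff)
qed

lemma inner_4: "x \<bullet> y = x $ 1 * y $ 1 + x $ 2 * y $ 2 + x $ 3 * y $ 3 + x $ 4 * y $ 4"
  for x y :: "real^4"
  by (simp add: inner_vec_def sum_4)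

lemma vec_eq_4: "x = y \<longleftrightarrow> x $ 1 = y $ 1 \<and> x $ 2 = y $ 2 \<and> x $ 3 = y $ 3 \<and> x $ 4 = y $ 4"
  for x y :: "'a^4"
  by (simp add: vec_eq_iff forall_4)

section \<open>The quadric, its tangent spaces and its shape operator\<close>

locale quadric =
  fixes A B C D :: real
  assumes AB: "B < A" "0 < B" and CD: "D < C" "0 < D"
begin

lemma pos: "0 < A" "0 < B" "0 < C" "0 < D" "A \<noteq> 0" "B \<noteq> 0" "C \<noteq> 0" "D \<noteq> 0"
  using AB CD by auto

definition Dm :: "real^4 \<Rightarrow> real^4" where
  "Dm v = vector [A * v $ 1, B * v $ 2, - C * v $ 3, - D * v $ 4]"

definition Am :: "real^4 \<Rightarrow> real^4" where
  "Am v = vector [v $ 1 / A, v $ 2 / B, - v $ 3 / C, - v $ 4 / D]"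

definition M :: "(real^4) set" where
  "M = {p. Am p \<bullet> p = 1}"

definition N :: "real^4 \<Rightarrow> real^4" where
  "N p = sgn (Am p)"

text \<open>Unlike the shape operator, \<open>S p\<close> acts on the whole space; the normal \<open>Am p\<close> is an eigenvector for \<open>0\<close>.\<close>

definition S :: "real^4 \<Rightarrow> real^4 \<Rightarrow> real^4" where
  "S p v = Dm v - (v \<bullet> p) *\<^sub>R p"

lemma Dm_nth: "Dm v $ 1 = A * v $ 1" "Dm v $ 2 = B * v $ 2" "Dm v $ 3 = - C * v $ 3"
  "Dm v $ 4 = - D * v $ 4"
  by (simp_all add: Dm_def vector_4)

lemma Am_nth: "Am v $ 1 = v $ 1 / A" "Am v $ 2 = v $ 2 / B" "Am v $ 3 = - v $ 3 / C"
  "Am v $ 4 = - v $ 4 / D"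
  by (simp_all add: Am_def vector_4)

lemma linear_Dm: "linear Dm"
  by (intro linearI) (simp_all add: vec_eq_4 Dm_nth algebra_simps)

lemma linear_Am: "linear Am"
  by (intro linearI) (simp_all add: vec_eq_4 Am_nth divide_simps add_divide_distrib)

lemma Am_Dm: "Am (Dm v) = v" and Dm_Am: "Dm (Am v) = v"
  using pos by (simp_all add: vec_eq_4 Am_nth Dm_nth)

lemma Dm_sym: "Dm v \<bullet> w = v \<bullet> Dm w" and Am_sym: "Am v \<bullet> w = v \<bullet> Am w"
  using pos by (simp_all add: inner_4 Am_nth Dm_nth divide_simps)

lemma linear_S: "linear (S p)"
  using linear_Dm by (intro linearI)
    (simp_all add: S_def linear_add linear_scale inner_add_left scaleR_diff_right algebra_simps)

lemma S_sym: "S p v \<bullet> w = v \<bullet> S p w"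
  using Dm_sym[of v w] by (simp add: S_def inner_diff_left inner_diff_right inner_commute)

lemma mem_M: "p \<in> M \<longleftrightarrow> (p $ 1)\<^sup>2 / A + (p $ 2)\<^sup>2 / B - (p $ 3)\<^sup>2 / C - (p $ 4)\<^sup>2 / D = 1"
  by (simp add: M_def inner_4 Am_nth power2_eq_square)

lemma Am_nz: "p \<in> M \<Longrightarrow> Am p \<noteq> 0"
  by (auto simp: M_def)

lemma tangent_space_M:
  assumes p: "p \<in> M"
  shows "tangent_space M p = {v. v \<bullet> Am p = 0}"
proof (intro subset_antisym subsetI)
  fix v assume "v \<in> tangent_space M p"
  then obtain \<gamma> \<epsilon> where g: "\<epsilon> > 0" "\<gamma> 0 = p" "\<forall>s\<in>{-\<epsilon><..<\<epsilon>}. \<gamma> s \<in> M"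
      "(\<gamma> has_vector_derivative v) (at (0::real))"
    by (auto simp: tangent_space_def)
  have "((\<lambda>s. Am (\<gamma> s) \<bullet> \<gamma> s) has_vector_derivative Am (\<gamma> 0) \<bullet> v + Am v \<bullet> \<gamma> 0) (at 0)"
    by (intro bounded_bilinear.has_vector_derivative[OF bounded_bilinear_inner] g
        bounded_linear.has_vector_derivative[OF linear_conv_bounded_linear[THEN iffD1, OF linear_Am]])
  moreover have "((\<lambda>s. Am (\<gamma> s) \<bullet> \<gamma> s) has_vector_derivative 0) (at 0)"
    by (rule has_vector_derivative_transform_within_open[of "\<lambda>s. 1" _ _ "{-\<epsilon><..<\<epsilon>}"])
      (use g in \<open>auto simp: M_def\<close>)
  ultimately have "Am (\<gamma> 0) \<bullet> v + Am v \<bullet> \<gamma> 0 = 0"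
    using vector_derivative_unique_at by blast
  then show "v \<in> {v. v \<bullet> Am p = 0}"
    using g(2) Am_sym[of v p] by (simp add: inner_commute)
next
  fix v assume v: "v \<in> {v. v \<bullet> Am p = 0}"
  \<comment> \<open>On p + s v the quadratic form equals 1 + s^2 q, since the mixed term vanishes
    for \<open>v\<close> orthogonal to \<open>Am p\<close>; dividing by the square root brings the
    line back onto the quadric.\<close>
  define q where "q = Am v \<bullet> v"
  define \<gamma> where "\<gamma> s = (1 / sqrt (1 + s\<^sup>2 * q)) *\<^sub>R (p + s *\<^sub>R v)" for s
  \<comment> \<open>Ensures |s| < 1 and |s| |q| < 1, so that 1 + s^2 q stays positive.\<close>
  define \<epsilon> where "\<epsilon> = 1 / (1 + \<bar>q\<bar>)"
  have e: "\<epsilon> > 0" by (simp add: \<epsilon>_def)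
  have "\<gamma> s \<in> M" if s: "s \<in> {-\<epsilon><..<\<epsilon>}" for s
  proof -
    have s1: "\<bar>s\<bar> * (1 + \<bar>q\<bar>) < 1" using s unfolding \<epsilon>_def by (subst pos_less_divide_eq[symmetric]) (auto simp: abs_less_iff)
    have "\<bar>s\<bar> * 1 \<le> \<bar>s\<bar> * (1 + \<bar>q\<bar>)" by (intro mult_left_mono) auto
    then have s2: "\<bar>s\<bar> < 1" using s1 by simp
    have "\<bar>s\<^sup>2 * q\<bar> = \<bar>s\<bar> * (\<bar>s\<bar> * \<bar>q\<bar>)" by (simp add: abs_mult power2_eq_square)
    also have "\<dots> \<le> 1 * (\<bar>s\<bar> * \<bar>q\<bar>)" using s2 by (intro mult_right_mono) auto
    also have "\<dots> < 1" using s1 by (simp add: algebra_simps)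
    finally have pos: "1 + s\<^sup>2 * q > 0" by linarith
    have "Am (p + s *\<^sub>R v) \<bullet> (p + s *\<^sub>R v) = 1 + s\<^sup>2 * q"
      using p v Am_sym[of v p] linear_Am unfolding M_def
      by (simp add: linear_add linear_scale inner_add_left inner_add_right q_def power2_eq_square inner_commute)
    then show ?thesis using pos linear_Am
      by (simp add: M_def \<gamma>_def linear_scale)
  qed
  moreover have "(\<gamma> has_vector_derivative v) (at 0)"
  proof -
    have "((\<lambda>s. 1 / sqrt (1 + s\<^sup>2 * q)) has_real_derivative 0) (at 0)"
      by (auto intro!: derivative_eq_intros)
    moreover have "((\<lambda>s. p + s *\<^sub>R v) has_vector_derivative v) (at 0)"
      by (auto intro!: derivative_eq_intros)
    ultimately have "(\<gamma> has_vector_derivative (1 / sqrt (1 + 0\<^sup>2 * q)) *\<^sub>R v + 0 *\<^sub>R (p + 0 *\<^sub>R v)) (at 0)"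
      unfolding \<gamma>_def by (rule has_vector_derivative_scaleR)
    then show ?thesis by simp
  qed
  moreover have "\<gamma> 0 = p" by (simp add: \<gamma>_def)
  ultimately show "v \<in> tangent_space M p"
    unfolding tangent_space_def using e by blast
qed

text \<open>The derivative within \<open>M\<close> is an arbitrary choice among the linear maps that
  fit, but along a curve in \<open>M\<close> with velocity \<open>v\<close> the chain rule forces
  its value at \<open>v\<close>. It can therefore be compared with the derivative of the normal on
  the ambient space.\<close>

lemma shape_operator_M:
  assumes p: "p \<in> M" and v: "v \<in> tangent_space M p"
  shows "shape_operator M N p v =
    - ((1 / norm (Am p)) *\<^sub>R (Am v - ((Am p \<bullet> Am v) / (norm (Am p))\<^sup>2) *\<^sub>R Am p))"
proof -
  let ?f = "\<lambda>q. - N q"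
  let ?D = "\<lambda>v. - ((1 / norm (Am p)) *\<^sub>R (Am v - ((Am p \<bullet> Am v) / (norm (Am p))\<^sup>2) *\<^sub>R Am p))"
  obtain \<gamma> \<epsilon> where g: "\<epsilon> > 0" "\<gamma> 0 = p" "\<forall>s\<in>{-\<epsilon><..<\<epsilon>}. \<gamma> s \<in> M"
      "(\<gamma> has_vector_derivative v) (at (0::real))"
    using v by (auto simp: tangent_space_def)
  have "(Am has_derivative Am) (at p)" by (rule linear_imp_has_derivative[OF linear_Am])
  from has_derivative_minus[OF has_derivative_compose[OF this has_derivative_sgn[OF Am_nz[OF p]]]]
  have "(?f has_derivative ?D) (at p)" by (simp add: N_def)
  then have 1: "(?f has_derivative ?D) (at p within M)" by (rule has_derivative_at_withinI)
  then have 2: "(?f has_derivative frechet_derivative ?f (at p within M)) (at p within M)"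
    using frechet_derivative_works differentiable_def by blast
  have sub: "\<gamma> ` {-\<epsilon><..<\<epsilon>} \<subseteq> M" using g(3) by auto
  have chain: "((\<lambda>s. ?f (\<gamma> s)) has_vector_derivative f' v) (at 0)"
    if f': "(?f has_derivative f') (at p within M)" for f'
  proof -
    have "(?f has_derivative f') (at (\<gamma> 0) within \<gamma> ` {-\<epsilon><..<\<epsilon>})"
      using has_derivative_subset[OF f' sub] g(2) by simp
    from vector_derivative_diff_chain_within[OF has_vector_derivative_at_within[OF g(4)] this]
    have "((\<lambda>s. ?f (\<gamma> s)) has_vector_derivative f' v) (at 0 within {-\<epsilon><..<\<epsilon>})"
      by (simp add: o_def)
    then show ?thesis using g(1) by (subst (asm) at_within_open) auto
  qed
  show ?thesis unfolding shape_operator_def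
    by (rule vector_derivative_unique_at[OF chain[OF 2] chain[OF 1]])
qed

text \<open>For tangent \<open>v\<close> the equation reads Am v - m Am p = v / \<nu>, with m the
  coefficient of the projection. Applying \<open>Dm\<close> turns it into Dm v = \<nu> v - \<nu> m
  p, and pairing with \<open>Am p\<close> identifies - \<nu> m with v . p.\<close>

lemma eigenspace_M:
  assumes p: "p \<in> M" and \<nu>: "\<nu> \<noteq> 0"
  shows "eigenspace M N p (- 1 / (norm (Am p) * \<nu>)) = {v. S p v = \<nu> *\<^sub>R v}"
proof -
  define G where "G = norm (Am p)"
  have G: "G > 0" using Am_nz[OF p] by (simp add: G_def)
  have GG: "Am p \<bullet> Am p = G\<^sup>2" by (simp add: G_def power2_norm_eq_inner)
  have pp: "p \<bullet> Am p = 1" using p by (simp add: M_def inner_commute)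
  have *: "v \<in> eigenspace M N p \<kappa> \<longleftrightarrow> v \<bullet> Am p = 0 \<and>
      - ((1 / G) *\<^sub>R (Am v - ((Am p \<bullet> Am v) / G\<^sup>2) *\<^sub>R Am p)) = \<kappa> *\<^sub>R v" for v \<kappa>
    using shape_operator_M[OF p, of v] tangent_space_M[OF p]
    by (auto simp: eigenspace_def G_def)
  have "v \<in> eigenspace M N p (- 1 / (G * \<nu>)) \<longleftrightarrow> S p v = \<nu> *\<^sub>R v" for v
  proof
    assume "v \<in> eigenspace M N p (- 1 / (G * \<nu>))"
    then have t: "v \<bullet> Am p = 0"
      and e: "- ((1 / G) *\<^sub>R (Am v - ((Am p \<bullet> Am v) / G\<^sup>2) *\<^sub>R Am p)) = (- 1 / (G * \<nu>)) *\<^sub>R v"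
      using * by auto
    define m where "m = (Am p \<bullet> Am v) / G\<^sup>2"
    from e have "(- G * \<nu>) *\<^sub>R (- ((1 / G) *\<^sub>R (Am v - m *\<^sub>R Am p))) = (- G * \<nu>) *\<^sub>R ((- 1 / (G * \<nu>)) *\<^sub>R v)"
      by (simp add: m_def)
    then have "\<nu> *\<^sub>R (Am v - m *\<^sub>R Am p) = v" using G \<nu> by simp
    then have "Dm (\<nu> *\<^sub>R (Am v - m *\<^sub>R Am p)) = Dm v" by simp
    then have 1: "\<nu> *\<^sub>R v - (\<nu> * m) *\<^sub>R p = Dm v"
      using linear_Dm by (simp add: linear_scale linear_diff Dm_Am scaleR_diff_right)
    then have "(\<nu> *\<^sub>R v - (\<nu> * m) *\<^sub>R p) \<bullet> Am p = Dm v \<bullet> Am p" by simp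
    then have "- (\<nu> * m) = v \<bullet> p" using t pp by (simp add: inner_diff_left Dm_sym Dm_Am)
    then have "(v \<bullet> p) *\<^sub>R p = - ((\<nu> * m) *\<^sub>R p)" by (simp flip: scaleR_minus_left)
    then show "S p v = \<nu> *\<^sub>R v" using 1 by (simp add: S_def algebra_simps)
  next
    assume "S p v = \<nu> *\<^sub>R v"
    then have e: "Dm v - (v \<bullet> p) *\<^sub>R p = \<nu> *\<^sub>R v" by (simp add: S_def)
    then have "(Dm v - (v \<bullet> p) *\<^sub>R p) \<bullet> Am p = (\<nu> *\<^sub>R v) \<bullet> Am p" by simp
    then have t: "v \<bullet> Am p = 0" using pp \<nu> by (simp add: inner_diff_left Dm_sym Dm_Am)
    from e have "Am (Dm v - (v \<bullet> p) *\<^sub>R p) = Am (\<nu> *\<^sub>R v)" by simp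
    then have e2: "v - (v \<bullet> p) *\<^sub>R Am p = \<nu> *\<^sub>R Am v"
      using linear_Am by (simp add: linear_scale linear_diff Am_Dm)
    then have "(v - (v \<bullet> p) *\<^sub>R Am p) \<bullet> Am p = (\<nu> *\<^sub>R Am v) \<bullet> Am p" by simp
    then have vp: "v \<bullet> p = - \<nu> * ((Am p \<bullet> Am v) / G\<^sup>2)"
      using t G GG by (simp add: inner_diff_left inner_diff_right inner_commute field_simps)
    define w where "w = Am v - ((Am p \<bullet> Am v) / G\<^sup>2) *\<^sub>R Am p"
    have "v = \<nu> *\<^sub>R Am v + (v \<bullet> p) *\<^sub>R Am p" using e2 by (simp add: algebra_simps)
    also have "\<dots> = \<nu> *\<^sub>R w" unfolding vp w_def by (simp add: algebra_simps)
    finally have "(- 1 / (G * \<nu>)) *\<^sub>R v = (- 1 / (G * \<nu>)) *\<^sub>R (\<nu> *\<^sub>R w)" by simp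
    then have "- ((1 / G) *\<^sub>R w) = (- 1 / (G * \<nu>)) *\<^sub>R v" using \<nu> by simp
    then show "v \<in> eigenspace M N p (- 1 / (G * \<nu>))" using * t by (simp add: w_def)
  qed
  then show ?thesis unfolding G_def by blast
qed

text \<open>The value 0 is not of the form treated in \<open>eigenspace_M\<close>. For a vector in
  the kernel, \<open>Am v\<close> is parallel to \<open>Am p\<close>, so \<open>v\<close> is a
  multiple of \<open>p\<close>; but \<open>p\<close> is not tangent, as its product with
  \<open>Am p\<close> is 1.\<close>

lemma eigenspace_M_0:
  assumes p: "p \<in> M"
  shows "eigenspace M N p 0 = {0}"
proof -
  have "v = 0" if "v \<in> eigenspace M N p 0" for v
  proof -
    have v: "v \<bullet> Am p = 0" "- ((1 / norm (Am p)) *\<^sub>R (Am v - ((Am p \<bullet> Am v) / (norm (Am p))\<^sup>2) *\<^sub>R Am p)) = 0"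
      using that shape_operator_M[OF p, of v] tangent_space_M[OF p] by (auto simp: eigenspace_def)
    then have "Am v = ((Am p \<bullet> Am v) / (norm (Am p))\<^sup>2) *\<^sub>R Am p"
      using Am_nz[OF p] by simp
    then obtain m where "Am v = m *\<^sub>R Am p" by blast
    then have "Dm (Am v) = Dm (m *\<^sub>R Am p)" by simp
    then have vm: "v = m *\<^sub>R p" using linear_Dm by (simp add: Dm_Am linear_scale)
    then have "m = 0" using v(1) p by (simp add: M_def inner_commute)
    then show ?thesis using vm by simp
  qed
  moreover have "0 \<in> eigenspace M N p 0"
    using shape_operator_M[OF p, of 0] tangent_space_M[OF p] linear_0[OF linear_Am]
    by (simp add: eigenspace_def)
  ultimately show ?thesis by blast
qed

end

section \<open>Ellipsoidal coordinates and principal curvatures\<close>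

text \<open>Successive divided differences at the four nodes: each division by a difference of nodes
  lowers the degree, until \<open>c3 = 0\<close> is left.\<close>

lemma cubic_zero:
  fixes c0 c1 c2 c3 :: real
  assumes "c0 + c1 * x + c2 * x^2 + c3 * x^3 = 0" "c0 + c1 * y + c2 * y^2 + c3 * y^3 = 0"
    "c0 + c1 * z + c2 * z^2 + c3 * z^3 = 0" "c0 + c1 * t + c2 * t^2 + c3 * t^3 = 0"
    and d: "x \<noteq> y" "x \<noteq> z" "x \<noteq> t" "y \<noteq> z" "y \<noteq> t" "z \<noteq> t"
  shows "c0 + c1 * s + c2 * s^2 + c3 * s^3 = 0"
proof -
  have "(x - y) * (c1 + c2 * (x + y) + c3 * (x^2 + x * y + y^2)) = 0"
    using assms(1,2) by algebra
  then have 1: "c1 + c2 * (x + y) + c3 * (x^2 + x * y + y^2) = 0" using d by simp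
  have "(x - z) * (c1 + c2 * (x + z) + c3 * (x^2 + x * z + z^2)) = 0"
    using assms(1,3) by algebra
  then have 2: "c1 + c2 * (x + z) + c3 * (x^2 + x * z + z^2) = 0" using d by simp
  have "(x - t) * (c1 + c2 * (x + t) + c3 * (x^2 + x * t + t^2)) = 0"
    using assms(1,4) by algebra
  then have 3: "c1 + c2 * (x + t) + c3 * (x^2 + x * t + t^2) = 0" using d by simp
  have "(y - z) * (c2 + c3 * (x + y + z)) = 0" using 1 2 by algebra
  then have 4: "c2 + c3 * (x + y + z) = 0" using d by simp
  have "(y - t) * (c2 + c3 * (x + y + t)) = 0" using 1 3 by algebra
  then have 5: "c2 + c3 * (x + y + t) = 0" using d by simp
  have "c3 * (z - t) = 0" using 4 5 by algebra
  then have "c3 = 0" using d by simp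
  then show ?thesis using 4 1 assms(1) by simp
qed

lemma eq_mult_divideI: "x * k = c * y \<Longrightarrow> k \<noteq> 0 \<Longrightarrow> x = c / k * y" for x k c y :: real
  by (simp add: field_simps)

context quadric
begin

text \<open>The equation \<open>\<Sum>\<^sub>k p\<^sub>k\<^sup>2 / (A\<^sub>k - \<nu>) = 1\<close> of the confocal family with cleared denominators.\<close>

definition \<Phi> :: "real^4 \<Rightarrow> real \<Rightarrow> real" where
  "\<Phi> p \<nu> = (A - \<nu>) * (B - \<nu>) * (- C - \<nu>) * (- D - \<nu>)
    - (p $ 1)\<^sup>2 * ((B - \<nu>) * (- C - \<nu>) * (- D - \<nu>))
    - (p $ 2)\<^sup>2 * ((A - \<nu>) * (- C - \<nu>) * (- D - \<nu>))
    - (p $ 3)\<^sup>2 * ((A - \<nu>) * (B - \<nu>) * (- D - \<nu>))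
    - (p $ 4)\<^sup>2 * ((A - \<nu>) * (B - \<nu>) * (- C - \<nu>))"

text \<open>Weights from evaluating \<open>\<Phi>\<close> at its nodes: at \<nu> = A only the term
  of the first entry survives, and comparison with \<nu> (\<nu> - n1) (\<nu> - n2) (\<nu> - n3)
  yields p1^2 = XX (A - n1) (A - n2) (A - n3). The nodes B, - C and - D give the other
  three.\<close>

definition XX :: real where "XX = A / ((A - B) * (A + C) * (A + D))"
definition YY :: real where "YY = B / ((A - B) * (B + C) * (B + D))"
definition ZZ :: real where "ZZ = C / ((A + C) * (B + C) * (C - D))"
definition TT :: real where "TT = D / ((A + D) * (B + D) * (C - D))"

lemma coeff_pos: "0 < XX" "0 < YY" "0 < ZZ" "0 < TT"
  using AB CD by (simp_all add: XX_def YY_def ZZ_def TT_def)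

text \<open>A relation instead of functions, so that existence and uniqueness can be stated
  separately. Only squares occur, because ellipsoidal coordinates fix a point up to reflections in
  the coordinate hyperplanes; the factors are arranged so that each is nonnegative on the stated
  ranges.\<close>

definition ellipsoidal :: "real^4 \<Rightarrow> real \<Rightarrow> real \<Rightarrow> real \<Rightarrow> bool" where
  "ellipsoidal p n1 n2 n3 \<longleftrightarrow> B \<le> n1 \<and> n1 \<le> A \<and> n2 \<le> - C \<and> - C \<le> n3 \<and> n3 \<le> - D \<and>
     (p $ 1)\<^sup>2 = XX * ((A - n1) * (A - n2) * (A - n3)) \<and>
     (p $ 2)\<^sup>2 = YY * ((n1 - B) * (B - n2) * (B - n3)) \<and>
     (p $ 3)\<^sup>2 = ZZ * ((C + n1) * (- C - n2) * (C + n3)) \<and>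
     (p $ 4)\<^sup>2 = TT * ((D + n1) * (- D - n2) * (- D - n3))"

text \<open>Both sides are monic quartics in \<nu>, so their difference is a cubic, and the four
  coordinate formulas make it vanish at A, B, - C and - D.\<close>

lemma ellipsoidal_Phi:
  assumes "ellipsoidal p n1 n2 n3"
  shows "\<Phi> p \<nu> = \<nu> * (\<nu> - n1) * (\<nu> - n2) * (\<nu> - n3)"
proof -
  define x y z t where "x = (p $ 1)\<^sup>2" and "y = (p $ 2)\<^sup>2" and "z = (p $ 3)\<^sup>2" and "t = (p $ 4)\<^sup>2"
  define f where "f \<nu> = \<Phi> p \<nu> - \<nu> * (\<nu> - n1) * (\<nu> - n2) * (\<nu> - n3)" for \<nu>
  have "x * ((A - B) * (A + C) * (A + D)) = A * (A - n1) * (A - n2) * (A - n3)"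
    "y * ((A - B) * (B + C) * (B + D)) = B * (n1 - B) * (B - n2) * (B - n3)"
    "z * ((A + C) * (B + C) * (C - D)) = C * (C + n1) * (- C - n2) * (C + n3)"
    "t * ((A + D) * (B + D) * (C - D)) = D * (D + n1) * (- D - n2) * (- D - n3)"
    using assms AB CD
    by (simp_all add: ellipsoidal_def XX_def YY_def ZZ_def TT_def x_def y_def z_def t_def)
  then have r: "f A = 0" "f B = 0" "f (-C) = 0" "f (-D) = 0"
    unfolding f_def \<Phi>_def x_def[symmetric] y_def[symmetric] z_def[symmetric] t_def[symmetric]
    by algebra+
  define c0 c1 c2 c3 where
    "c0 = A*B*C*D - x*B*C*D - y*A*C*D + z*A*B*D + t*A*B*C" and
    "c1 = A*B*(C+D) - (A+B)*C*D - x*(B*(C+D) - C*D) - y*(A*(C+D) - C*D) + z*(A*B-(A+B)*D)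
       + t*(A*B-(A+B)*C) + n1*n2*n3" and
    "c2 = A*B + C*D - (A+B)*(C+D) - x*(B-C-D) - y*(A-C-D)-z*(A+B-D) - t*(A+B-C) - (n1*n2+n1*n3+n2*n3)" and
    "c3 = C + D - A - B + x + y + z + t + (n1 + n2 + n3)"
  have f: "f s = c0 + c1 * s + c2 * s^2 + c3 * s^3" for s
    unfolding f_def \<Phi>_def x_def[symmetric] y_def[symmetric] z_def[symmetric] t_def[symmetric]
      c0_def c1_def c2_def c3_def by algebra
  have "c0 + c1 * \<nu> + c2 * \<nu>^2 + c3 * \<nu>^3 = 0"
    by (rule cubic_zero[OF r[unfolded f]]) (use AB CD in auto)
  then show ?thesis using f[of \<nu>] by (simp add: f_def)
qed

lemma mem_M_Phi: "p \<in> M \<longleftrightarrow> \<Phi> p 0 = 0"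
  using pos by (auto simp: mem_M \<Phi>_def field_simps)

lemma ellipsoidal_M: "ellipsoidal p n1 n2 n3 \<Longrightarrow> p \<in> M"
  by (simp add: mem_M_Phi ellipsoidal_Phi)

text \<open>The signs of \<open>\<Phi>\<close> at B and A yield \<open>n1\<close>, and
  \<open>p \<in> M\<close> yields the root 0. What remains is a quadratic whose signs at - C and - D
  locate the other two roots. They come from the quadratic formula, since they may coincide at - C,
  where the intermediate value theorem would not reveal the multiplicity.\<close>

lemma ellipsoidal_exists:
  assumes p: "p \<in> M"
  obtains n1 n2 n3 where "ellipsoidal p n1 n2 n3"
proof -
  define x y z t where "x = (p $ 1)\<^sup>2" and "y = (p $ 2)\<^sup>2" and "z = (p $ 3)\<^sup>2" and "t = (p $ 4)\<^sup>2"
  note xs = x_def[symmetric] y_def[symmetric] z_def[symmetric] t_def[symmetric]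
  have nn: "x \<ge> 0" "y \<ge> 0" "z \<ge> 0" "t \<ge> 0" by (simp_all add: x_def y_def z_def t_def)
  have PA: "\<Phi> p A = x * ((A - B) * (A + C) * (A + D))"
    and PB: "\<Phi> p B = - (y * ((A - B) * (B + C) * (B + D)))"
    and PC: "\<Phi> p (-C) = - (z * ((A + C) * (B + C) * (C - D)))"
    and PD: "\<Phi> p (-D) = t * ((A + D) * (B + D) * (C - D))"
    unfolding \<Phi>_def xs by algebra+
  have "continuous_on {B..A} (\<Phi> p)"
    unfolding \<Phi>_def by (intro continuous_intros)
  then obtain n1 where n1: "B \<le> n1" "n1 \<le> A" "\<Phi> p n1 = 0"
    using IVT'[of "\<Phi> p" B 0 A] PA PB nn AB CD by auto
  define e0 e1 e2 where
    "e0 = A*B*(C+D) - (A+B)*C*D - x*(B*(C+D) - C*D) - y*(A*(C+D) - C*D) + z*(A*B-(A+B)*D)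
       + t*(A*B-(A+B)*C)" and
    "e1 = A*B + C*D - (A+B)*(C+D) - x*(B-C-D) - y*(A-C-D)-z*(A+B-D) - t*(A+B-C)" and
    "e2 = C + D - A - B + x + y + z + t"
  have Pc: "\<Phi> p s = (A*B*C*D - x*B*C*D - y*A*C*D + z*A*B*D + t*A*B*C) + e0 * s + e1 * s^2 + e2 * s^3 + s^4" for s
    unfolding \<Phi>_def xs e0_def e1_def e2_def by algebra
  have Ps: "\<Phi> p s = e0 * s + e1 * s^2 + e2 * s^3 + s^4" for s
    using p Pc[of 0] Pc[of s] by (simp add: mem_M_Phi)
  \<comment> \<open>Coefficients of the quotient by s - n1, from Horner's scheme.\<close>
  define \<beta> \<gamma> where "\<beta> = e2 + n1" and "\<gamma> = e1 + n1 * \<beta>"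
  have "n1 * (e0 + n1 * \<gamma>) = 0"
    using n1(3) unfolding Ps \<beta>_def \<gamma>_def by algebra
  then have "e0 + n1 * \<gamma> = 0" using n1 AB by simp
  then have Pq: "\<Phi> p s = s * (s - n1) * (s^2 + \<beta> * s + \<gamma>)" for s
    unfolding Ps \<beta>_def \<gamma>_def by algebra
  define q where "q s = s^2 + \<beta> * s + \<gamma>" for s
  have "C * (C + n1) * q (-C) \<le> 0"
  proof -
    have "\<Phi> p (-C) = C * (C + n1) * q (-C)" unfolding Pq q_def by algebra
    moreover have "\<Phi> p (-C) \<le> 0" unfolding PC using nn AB CD by simp
    ultimately show ?thesis by simp
  qed
  moreover have "0 < C * (C + n1)" using n1 AB CD by simp
  ultimately have qC: "q (-C) \<le> 0" by (metis mult_le_0_iff not_le)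
  have "D * (D + n1) * q (-D) \<ge> 0"
  proof -
    have "\<Phi> p (-D) = D * (D + n1) * q (-D)" unfolding Pq q_def by algebra
    moreover have "\<Phi> p (-D) \<ge> 0" unfolding PD using nn AB CD by simp
    ultimately show ?thesis by simp
  qed
  moreover have "0 < D * (D + n1)" using n1 AB CD by simp
  ultimately have qD: "q (-D) \<ge> 0" by (metis zero_le_mult_iff not_le)
  \<comment> \<open>The discriminant is nonnegative because the quadratic is nonpositive somewhere,
    namely at - C.\<close>
  have disc: "\<beta>^2 - 4 * \<gamma> = (\<beta> - 2 * C)^2 - 4 * q (-C)"
    unfolding q_def by algebra
  then have disc0: "\<beta>^2 - 4 * \<gamma> \<ge> 0" using qC by (smt (verit) zero_le_power2)
  define w where "w = sqrt (\<beta>^2 - 4 * \<gamma>)"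
  have w: "w \<ge> 0" "w^2 = \<beta>^2 - 4 * \<gamma>" using disc0 by (simp_all add: w_def)
  define n2 n3 where "n2 = (- \<beta> - w) / 2" and "n3 = (- \<beta> + w) / 2"
  have qf: "q s = (s - n2) * (s - n3)" for s
    using w(2) unfolding q_def n2_def n3_def by (simp add: field_simps power2_eq_square)
  have "n2 \<le> n3" using w by (simp add: n2_def n3_def)
  then have n23: "n2 \<le> -C" "-C \<le> n3"
    using qC unfolding qf mult_le_0_iff by auto
  have n3D: "n3 \<le> -D"
    using qD n23 CD unfolding qf zero_le_mult_iff by auto
  have P: "\<Phi> p s = s * (s - n1) * (s - n2) * (s - n3)" for s
    using Pq qf by (simp add: q_def)
  have "ellipsoidal p n1 n2 n3"
    unfolding ellipsoidal_def xs
  proof (intro conjI n1 n23 n3D)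
    show "x = XX * ((A - n1) * (A - n2) * (A - n3))"
      unfolding XX_def
    proof (rule eq_mult_divideI)
      show "x * ((A - B) * (A + C) * (A + D)) = A * ((A - n1) * (A - n2) * (A - n3))"
        using PA P[of A] by algebra
    qed (use AB CD in simp)
    show "y = YY * ((n1 - B) * (B - n2) * (B - n3))"
      unfolding YY_def
    proof (rule eq_mult_divideI)
      show "y * ((A - B) * (B + C) * (B + D)) = B * ((n1 - B) * (B - n2) * (B - n3))"
        using PB P[of B] by algebra
    qed (use AB CD in simp)
    show "z = ZZ * ((C + n1) * (- C - n2) * (C + n3))"
      unfolding ZZ_def
    proof (rule eq_mult_divideI)
      show "z * ((A + C) * (B + C) * (C - D)) = C * ((C + n1) * (- C - n2) * (C + n3))"
        using PC P[of "-C"] by algebra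
    qed (use AB CD in simp)
    show "t = TT * ((D + n1) * (- D - n2) * (- D - n3))"
      unfolding TT_def
    proof (rule eq_mult_divideI)
      show "t * ((A + D) * (B + D) * (C - D)) = D * ((D + n1) * (- D - n2) * (- D - n3))"
        using PD P[of "-D"] by algebra
    qed (use AB CD in simp)
  qed
  then show thesis by (rule that)
qed

text \<open>Both triples consist of the nonzero roots of the same polynomial, hence agree as sets.
  The sign singles out the first entry and - C separates the second from the third, so
  multiplicities need not be counted.\<close>

lemma ellipsoidal_unique:
  assumes "ellipsoidal p n1 n2 n3" "ellipsoidal p m1 m2 m3"
  shows "n1 = m1" "n2 = m2" "n3 = m3"
proof -
  have r: "\<nu> = m1 \<or> \<nu> = m2 \<or> \<nu> = m3" if "\<Phi> p \<nu> = 0" "\<nu> \<noteq> 0" for \<nu>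
    using that unfolding ellipsoidal_Phi[OF assms(2)] by auto
  have r': "\<nu> = n1 \<or> \<nu> = n2 \<or> \<nu> = n3" if "\<Phi> p \<nu> = 0" "\<nu> \<noteq> 0" for \<nu>
    using that unfolding ellipsoidal_Phi[OF assms(1)] by auto
  have "\<Phi> p n1 = 0" "\<Phi> p n2 = 0" "\<Phi> p n3 = 0"
    by (simp_all add: ellipsoidal_Phi[OF assms(1)])
  moreover have "\<Phi> p m1 = 0" "\<Phi> p m2 = 0" "\<Phi> p m3 = 0"
    by (simp_all add: ellipsoidal_Phi[OF assms(2)])
  moreover have rg: "n1 > 0" "n2 < 0" "n3 < 0" "n2 \<le> -C" "-C \<le> n3"
    "m1 > 0" "m2 < 0" "m3 < 0" "m2 \<le> -C" "-C \<le> m3"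
    using assms AB CD by (auto simp: ellipsoidal_def)
  ultimately have "n1 = m1" "n2 = m2 \<or> n2 = m3" "n3 = m2 \<or> n3 = m3" "m2 = n2 \<or> m2 = n3" "m3 = n2 \<or> m3 = n3"
    using r[of n1] r[of n2] r[of n3] r'[of m2] r'[of m3] by auto
  then show "n1 = m1" "n2 = m2" "n3 = m3" using rg(4,5,9,10) by linarith+
qed

section \<open>Eigenvectors of the symmetric map, principal curvatures and umbilic points\<close>

lemma S_nth: "S p v $ 1 = A * v $ 1 - (v \<bullet> p) * p $ 1" "S p v $ 2 = B * v $ 2 - (v \<bullet> p) * p $ 2"
  "S p v $ 3 = - C * v $ 3 - (v \<bullet> p) * p $ 3" "S p v $ 4 = - D * v $ 4 - (v \<bullet> p) * p $ 4"
  by (simp_all add: S_def Dm_nth)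

lemma S_Am: "p \<in> M \<Longrightarrow> S p (Am p) = 0"
  by (simp add: S_def M_def Dm_Am)

text \<open>If \<nu> is none of the nodes, the eigenvector is the resolvent vector (Dm - \<nu>)^(-1)
  p: \<open>\<Phi> p \<nu> = 0\<close> says that its product with \<open>p\<close> is 1, which is
  the eigenvalue condition. At a node, \<open>\<Phi> p \<nu> = 0\<close> makes the corresponding
  entry of \<open>p\<close> vanish, and an axis vector serves.\<close>

lemma S_eigenvector:
  assumes "\<Phi> p \<nu> = 0"
  obtains v where "v \<noteq> 0" "S p v = \<nu> *\<^sub>R v"
proof -
  consider "\<nu> = A" | "\<nu> = B" | "\<nu> = - C" | "\<nu> = - D" |
    "\<nu> \<noteq> A" "\<nu> \<noteq> B" "\<nu> \<noteq> - C" "\<nu> \<noteq> - D" by blast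
  then show thesis
  proof cases
    case 1
    then have "p $ 1 = 0" using assms AB CD by (simp add: \<Phi>_def)
    then show thesis using 1
      by (intro that[of "axis 1 1"]) (auto simp: vec_eq_4 S_nth axis_def inner_4)
  next
    case 2
    then have "p $ 2 = 0" using assms AB CD by (simp add: \<Phi>_def)
    then show thesis using 2
      by (intro that[of "axis 2 1"]) (auto simp: vec_eq_4 S_nth axis_def inner_4)
  next
    case 3
    then have "p $ 3 = 0" using assms AB CD by (simp add: \<Phi>_def)
    then show thesis using 3
      by (intro that[of "axis 3 1"]) (auto simp: vec_eq_4 S_nth axis_def inner_4)
  next
    case 4
    then have "p $ 4 = 0" using assms AB CD by (simp add: \<Phi>_def)
    then show thesis using 4
      by (intro that[of "axis 4 1"]) (auto simp: vec_eq_4 S_nth axis_def inner_4)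
  next
    case 5
    define v :: "real^4" where
      "v = vector [p $ 1 / (A - \<nu>), p $ 2 / (B - \<nu>), p $ 3 / (- C - \<nu>), p $ 4 / (- D - \<nu>)]"
    have nz: "A - \<nu> \<noteq> 0" "B - \<nu> \<noteq> 0" "- C - \<nu> \<noteq> 0" "- D - \<nu> \<noteq> 0" using 5 by auto
    have "a * b * c * d - x\<^sup>2 * (b * c * d) - y\<^sup>2 * (a * c * d) - z\<^sup>2 * (a * b * d) - t\<^sup>2 * (a * b * c)
        = a * b * c * d * (1 - (x / a * x + y / b * y + z / c * z + t / d * t))"
      if "a \<noteq> 0" "b \<noteq> 0" "c \<noteq> 0" "d \<noteq> 0" for a b c d x y z t :: real
      using that by (simp add: field_simps power2_eq_square)
    from this[OF nz]
    have "\<Phi> p \<nu> = (A - \<nu>) * (B - \<nu>) * (- C - \<nu>) * (- D - \<nu>) * (1 - v \<bullet> p)"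
      unfolding \<Phi>_def v_def inner_4 vector_4 by blast
    then have vp: "v \<bullet> p = 1" using assms nz by simp
    then have "v \<noteq> 0" by auto
    moreover have "a * (x / (a - \<nu>)) - 1 * x = \<nu> * (x / (a - \<nu>))" if "a - \<nu> \<noteq> 0" for a x
      using that by (simp add: field_simps)
    from this[OF nz(1)] this[OF nz(2)] this[OF nz(3)] this[OF nz(4)]
    have "S p v = \<nu> *\<^sub>R v"
      unfolding vec_eq_4 S_nth vp vector_scaleR_component real_scaleR_def
      unfolding v_def vector_4 by blast
    ultimately show thesis by (rule that)
  qed
qed

text \<open>The third axis vector is one eigenvector at - C. The resolvent vector with third entry
  set to 0 supplies a second direction; its normalization \<open>w \<bullet> p = 1\<close> is used
  again for the cubic form in \<open>type_D1_P\<close>.\<close>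

lemma double_eigenvector:
  assumes e: "ellipsoidal p n1 (- C) (- C)"
  obtains w where "w \<noteq> 0" "S p w = (- C) *\<^sub>R w" "w $ 3 = 0" "w \<bullet> p = 1"
proof -
  have p3: "p $ 3 = 0" using e by (simp add: ellipsoidal_def)
  define w :: "real^4" where
    "w = vector [p $ 1 / (A + C), p $ 2 / (B + C), 0, p $ 4 / (C - D)]"
  have "w \<bullet> p = (p $ 1)\<^sup>2 / (A + C) + (p $ 2)\<^sup>2 / (B + C) + (p $ 4)\<^sup>2 / (C - D)"
    by (simp add: w_def inner_4 vector_4 power2_eq_square)
  also have "\<dots> = A * (A - n1) / ((A - B) * (A + D)) + B * (n1 - B) / ((A - B) * (B + D))
      + D * (D + n1) / ((A + D) * (B + D))"
    using e AB CD by (simp add: ellipsoidal_def XX_def YY_def TT_def)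
  \<comment> \<open>The expression is affine in \<open>n1\<close> with slope 0.\<close>
  also have "\<dots> = 1"
    using AB CD by (simp add: divide_simps) algebra
  finally have wp: "w \<bullet> p = 1" .
  then have "w \<noteq> 0" by auto
  moreover have "S p w = (- C) *\<^sub>R w"
    using AB CD by (simp add: vec_eq_4 S_nth wp p3) (simp add: w_def vector_4 divide_simps algebra_simps)
  moreover have "w $ 3 = 0" by (simp add: w_def vector_4)
  ultimately show thesis using wp by (rule that)
qed

text \<open>Eigenvectors for distinct eigenvalues are orthogonal because \<open>S p\<close> is
  symmetric, so only the coincidence of \<open>n2\<close> and \<open>n3\<close> needs an explicit
  pair. The fourth vector is the normal \<open>Am p\<close> with eigenvalue 0.\<close>

lemma S_eigenbasis:
  assumes e: "ellipsoidal p n1 n2 n3"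
  obtains v where "\<And>i. i < 4 \<Longrightarrow> v i \<noteq> 0"
    "\<And>i. i < 4 \<Longrightarrow> S p (v i) = ([n1, n2, n3, 0] ! i) *\<^sub>R v i"
    "\<And>i j. i < 4 \<Longrightarrow> j < 4 \<Longrightarrow> i \<noteq> j \<Longrightarrow> v i \<bullet> v j = 0"
proof -
  have p: "p \<in> M" by (rule ellipsoidal_M[OF e])
  have orth: "v \<bullet> w = 0" if "S p v = k *\<^sub>R v" "S p w = l *\<^sub>R w" "k \<noteq> l" for v w k l
    using S_sym[of p v w] that by simp
  have P: "\<Phi> p n1 = 0" "\<Phi> p n2 = 0" "\<Phi> p n3 = 0" by (simp_all add: ellipsoidal_Phi[OF e])
  have rg: "n1 > 0" "n2 < 0" "n3 < 0" using e AB CD by (auto simp: ellipsoidal_def)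
  obtain v1 where v1: "v1 \<noteq> 0" "S p v1 = n1 *\<^sub>R v1" using S_eigenvector[OF P(1)] .
  have v0: "Am p \<noteq> 0" "S p (Am p) = 0 *\<^sub>R Am p" using Am_nz[OF p] S_Am[OF p] by auto
  have "\<exists>v2 v3. v2 \<noteq> 0 \<and> v3 \<noteq> 0 \<and> S p v2 = n2 *\<^sub>R v2 \<and> S p v3 = n3 *\<^sub>R v3 \<and> v2 \<bullet> v3 = 0"
  proof (cases "n2 = n3")
    case False
    obtain v2 where v2: "v2 \<noteq> 0" "S p v2 = n2 *\<^sub>R v2" using S_eigenvector[OF P(2)] .
    obtain v3 where v3: "v3 \<noteq> 0" "S p v3 = n3 *\<^sub>R v3" using S_eigenvector[OF P(3)] .
    show ?thesis using v2 v3 orth[OF v2(2) v3(2) False] by blast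
  next
    case True
    then have n: "n2 = - C" "n3 = - C" using e by (auto simp: ellipsoidal_def)
    have p3: "p $ 3 = 0" using e n by (simp add: ellipsoidal_def)
    obtain w where "w \<noteq> 0" "S p w = n3 *\<^sub>R w" and w3: "w $ 3 = 0"
      using double_eigenvector e n by metis
    moreover have "S p (axis 3 1) = n2 *\<^sub>R axis 3 1"
      using p3 by (simp add: vec_eq_4 S_nth axis_def inner_4 n)
    moreover have "axis 3 1 \<bullet> w = 0" "axis 3 1 \<noteq> (0 :: real^4)"
      by (simp_all add: inner_4 w3 axis_def vec_eq_4)
    ultimately show ?thesis by blast
  qed
  then obtain v2 v3 where v23: "v2 \<noteq> 0" "v3 \<noteq> 0" "S p v2 = n2 *\<^sub>R v2" "S p v3 = n3 *\<^sub>R v3" "v2 \<bullet> v3 = 0"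
    by blast
  have o: "v1 \<bullet> v2 = 0" "v1 \<bullet> v3 = 0" "v1 \<bullet> Am p = 0" "v2 \<bullet> Am p = 0" "v3 \<bullet> Am p = 0"
    using orth[OF v1(2) v23(3)] orth[OF v1(2) v23(4)] orth[OF v1(2) v0(2)] orth[OF v23(3) v0(2)]
      orth[OF v23(4) v0(2)] rg by auto
  then have o': "v2 \<bullet> v1 = 0" "v3 \<bullet> v1 = 0" "Am p \<bullet> v1 = 0" "Am p \<bullet> v2 = 0" "Am p \<bullet> v3 = 0" "v3 \<bullet> v2 = 0"
    using v23(5) by (simp_all add: inner_commute)
  define v where "v i = [v1, v2, v3, Am p] ! i" for i
  have vs: "v 0 = v1" "v (Suc 0) = v2" "v 2 = v3" "v 3 = Am p"
    by (simp_all add: v_def numeral_2_eq_2 numeral_3_eq_3)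
  have four: "i = 0 \<or> i = 1 \<or> i = 2 \<or> i = 3" if "i < 4" for i :: nat using that by arith
  show thesis
  proof (rule that)
    fix i :: nat assume i: "i < 4"
    show "v i \<noteq> 0"
      using four[OF i] v1(1) v0(1) v23(1,2) by (elim disjE) (simp_all add: vs)
    show "S p (v i) = ([n1, n2, n3, 0] ! i) *\<^sub>R v i"
      using four[OF i] v1(2) v0(2) v23(3,4) by (elim disjE) (simp_all add: vs)
    fix j :: nat assume j: "j < 4" "i \<noteq> j"
    show "v i \<bullet> v j = 0"
      using four[OF i] four[OF j(1)] j(2) o o' v23(5)
      by (elim disjE) (simp_all add: vs)
  qed
qed

lemma S_eigenspace_dim:
  assumes e: "ellipsoidal p n1 n2 n3"
  shows "dim {w. S p w = k *\<^sub>R w} = card {i. i < 4 \<and> [n1, n2, n3, 0] ! i = k}"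
proof -
  obtain v where v: "\<And>i. i < 4 \<Longrightarrow> v i \<noteq> 0"
    "\<And>i. i < 4 \<Longrightarrow> S p (v i) = ([n1, n2, n3, 0] ! i) *\<^sub>R v i"
    "\<And>i j. i < 4 \<Longrightarrow> j < 4 \<Longrightarrow> i \<noteq> j \<Longrightarrow> v i \<bullet> v j = 0"
    using S_eigenbasis[OF e] by blast
  show ?thesis
    using eigenspace_orthogonal_basis(2)[of "S p" v "\<lambda>i. [n1, n2, n3, 0] ! i" k, OF linear_S S_sym] v
    by simp
qed

definition ks :: "real^4 \<Rightarrow> real \<Rightarrow> real \<Rightarrow> real \<Rightarrow> real list" where
  "ks p n1 n2 n3 = map (\<lambda>\<nu>. - 1 / (norm (Am p) * \<nu>)) [n1, n2, n3]"

text \<open>As \<open>n1\<close> is positive and \<open>n2 \<le> n3\<close> are negative, the values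
  -1 / (norm (Am p) \<nu>) come out in increasing order: a negative one first, then two positive
  ones. Their multiplicities are those of the eigenvalues of \<open>S p\<close>.\<close>

lemma principal_curvatures_M:
  assumes e: "ellipsoidal p n1 n2 n3"
  shows "principal_curvatures M N p = ks p n1 n2 n3"
proof -
  have p: "p \<in> M" by (rule ellipsoidal_M[OF e])
  have G: "norm (Am p) > 0" using Am_nz[OF p] by simp
  have rg: "n1 > 0" "n2 < 0" "n3 < 0" "n2 \<le> n3" using e AB CD by (auto simp: ellipsoidal_def)
  have "- 1 / (norm (Am p) * n1) \<le> 0" "0 \<le> - 1 / (norm (Am p) * n2)"
    "0 \<le> - 1 / (norm (Am p) * n3)"
    using G rg by (simp_all add: divide_nonneg_neg divide_nonpos_neg mult_nonneg_nonpos)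
  then have "- 1 / (norm (Am p) * n1) \<le> - 1 / (norm (Am p) * n2)" by linarith
  moreover have "- 1 / (norm (Am p) * n2) \<le> - 1 / (norm (Am p) * n3)"
    using G rg by (simp add: divide_simps mult_less_0_iff zero_less_mult_iff)
  moreover have "sorted [x, y, z]" if "x \<le> y" "y \<le> z" for x y z :: real using that by simp
  ultimately have sorted: "sorted (ks p n1 n2 n3)" unfolding ks_def list.map by blast
  note dim = S_eigenspace_dim[OF e]
  have count: "count_list (ks p n1 n2 n3) \<kappa> = dim (eigenspace M N p \<kappa>)" for \<kappa>
  proof (cases "\<kappa> = 0")
    case True
    then show ?thesis using eigenspace_M_0[OF p] G rg by (simp add: ks_def count_list_0_iff)
  next
    case False
    define \<nu> where "\<nu> = - 1 / (norm (Am p) * \<kappa>)"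
    have \<nu>: "\<nu> \<noteq> 0" "\<kappa> = - 1 / (norm (Am p) * \<nu>)" using False G by (auto simp: \<nu>_def)
    have k: "- 1 / (norm (Am p) * n) = \<kappa> \<longleftrightarrow> n = \<nu>" if "n \<noteq> 0" for n
      using \<nu> G that by (auto simp: field_simps)
    have ks: "\<kappa> = ks p n1 n2 n3 ! i \<longleftrightarrow> [n1, n2, n3, 0] ! i = \<nu>" if "i < 3" for i
    proof -
      have "i = 0 \<or> i = 1 \<or> i = 2" using that by arith
      then show ?thesis
        using k[of n1] k[of n2] k[of n3] rg by (auto simp: ks_def)
    qed
    \<comment> \<open>Index 3 belongs to the normal, whose eigenvalue 0 is never \<nu>; only the
      three tangential indices count.\<close>
    have "[n1, n2, n3, 0] ! 3 \<noteq> \<nu>" using \<nu>(1) by simp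
    then have "i < 4 \<and> [n1, n2, n3, 0] ! i = \<nu> \<longleftrightarrow> i < 3 \<and> [n1, n2, n3, 0] ! i = \<nu>" for i
      by (cases "i = 3") auto
    moreover have len: "length (ks p n1 n2 n3) = 3" by (simp add: ks_def)
    ultimately have "{i. i < 4 \<and> [n1, n2, n3, 0] ! i = \<nu>} = {i. i < length (ks p n1 n2 n3) \<and> \<kappa> = ks p n1 n2 n3 ! i}"
      using ks unfolding len by blast
    then show ?thesis
      using dim[of \<nu>] eigenspace_M[OF p \<nu>(1)] \<nu>(2)
      by (simp add: count_list_eq_length_filter length_filter_conv_card)
  qed
  show ?thesis unfolding principal_curvatures_def
    by (rule the_equality) (use sorted count in \<open>auto intro!: sorted_count_list_unique\<close>)
qed

lemma principal_curvature_M: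
  assumes e: "ellipsoidal p n1 n2 n3"
  shows "principal_curvature M N (Suc 0) p = - 1 / (norm (Am p) * n1)"
    "principal_curvature M N 2 p = - 1 / (norm (Am p) * n2)"
    "principal_curvature M N 3 p = - 1 / (norm (Am p) * n3)"
  by (simp_all add: principal_curvature_def principal_curvatures_M[OF e] ks_def numeral_eq_Suc)

lemma eigenline_M:
  assumes e: "ellipsoidal p n1 n2 n3"
  shows "eigenline M N (Suc 0) p = {v. S p v = n1 *\<^sub>R v}"
    "eigenline M N 2 p = {v. S p v = n2 *\<^sub>R v}"
    "eigenline M N 3 p = {v. S p v = n3 *\<^sub>R v}"
proof -
  have "n1 \<noteq> 0" "n2 \<noteq> 0" "n3 \<noteq> 0" using e AB CD by (auto simp: ellipsoidal_def)
  show "eigenline M N (Suc 0) p = {v. S p v = n1 *\<^sub>R v}"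
    unfolding eigenline_def principal_curvature_M[OF e] by (rule eigenspace_M[OF ellipsoidal_M[OF e]]) fact
  show "eigenline M N 2 p = {v. S p v = n2 *\<^sub>R v}"
    unfolding eigenline_def principal_curvature_M[OF e] by (rule eigenspace_M[OF ellipsoidal_M[OF e]]) fact
  show "eigenline M N 3 p = {v. S p v = n3 *\<^sub>R v}"
    unfolding eigenline_def principal_curvature_M[OF e] by (rule eigenspace_M[OF ellipsoidal_M[OF e]]) fact
qed

lemma umbilic_cases:
  assumes e: "ellipsoidal p n1 n2 n3"
  shows "p \<notin> umbilic_set M N" "p \<notin> part_umb_12 M N" "p \<in> part_umb_23 M N \<longleftrightarrow> n2 = n3"
proof -
  have p: "p \<in> M" by (rule ellipsoidal_M[OF e])
  have G: "norm (Am p) > 0" using Am_nz[OF p] by simp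
  have rg: "n1 > 0" "n2 < 0" "n3 < 0" using e AB CD by (auto simp: ellipsoidal_def)
  have 1: "- 1 / (norm (Am p) * n1) < - 1 / (norm (Am p) * n2)"
    using G rg by (smt (verit) divide_neg_neg divide_neg_pos mult_pos_neg mult_pos_pos)
  have 2: "- 1 / (norm (Am p) * n2) = - 1 / (norm (Am p) * n3) \<longleftrightarrow> n2 = n3"
    using G rg by (auto simp: field_simps)
  show "p \<notin> umbilic_set M N" "p \<notin> part_umb_12 M N" "p \<in> part_umb_23 M N \<longleftrightarrow> n2 = n3"
    unfolding umbilic_set_def part_umb_12_def part_umb_23_def One_nat_def principal_curvature_M[OF e] mem_Collect_eq
    using 1 2 p by auto
qed

lemma umbilic_set_empty: "umbilic_set M N = {}"
proof -
  have "p \<notin> umbilic_set M N" for p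
  proof
    assume "p \<in> umbilic_set M N"
    moreover from this have "p \<in> M" by (simp add: umbilic_set_def)
    ultimately show False using umbilic_cases(1) by (metis ellipsoidal_exists)
  qed
  then show ?thesis by blast
qed

lemma part_umb_12_empty: "part_umb_12 M N = {}"
proof -
  have "p \<notin> part_umb_12 M N" for p
  proof
    assume "p \<in> part_umb_12 M N"
    moreover from this have "p \<in> M" by (simp add: part_umb_12_def)
    ultimately show False using umbilic_cases(2) by (metis ellipsoidal_exists)
  qed
  then show ?thesis by blast
qed

lemma foliation_domain_M:
  "foliation_domain M N (Suc 0) = M" "foliation_domain M N 2 = M - part_umb_23 M N"
  "foliation_domain M N 3 = M - part_umb_23 M N"
  by (simp_all add: foliation_domain_def umbilic_set_empty part_umb_12_empty)

end

section \<open>First integrals of the principal lines\<close>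

text \<open>Gronwall's argument: the square of \<open>f\<close> times exp (- 2 K s) does not
  increase, and it starts at 0.\<close>

lemma linear_ode_zero_forward:
  fixes f f' :: "real \<Rightarrow> real"
  assumes "s0 \<le> s1" and f: "\<And>s. s \<in> {s0..s1} \<Longrightarrow> (f has_real_derivative f' s) (at s)"
    and K: "\<And>s. s \<in> {s0..s1} \<Longrightarrow> \<bar>f' s\<bar> \<le> K * \<bar>f s\<bar>" and "f s0 = 0"
  shows "f s1 = 0"
proof -
  define g where "g s = (f s)\<^sup>2 * exp (- 2 * K * s)" for s
  have "g s1 \<le> g s0"
  proof (rule DERIV_nonpos_imp_nonincreasing[OF assms(1)])
    fix s assume s: "s0 \<le> s" "s \<le> s1"
    have "(g has_real_derivative (2 * (f s * f' s) - 2 * (K * (f s)\<^sup>2)) * exp (- 2 * K * s)) (at s)"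
      unfolding g_def using f[of s] s
      by (auto intro!: derivative_eq_intros simp: algebra_simps power2_eq_square)
    moreover have "f s * f' s \<le> K * (f s)\<^sup>2"
    proof -
      have "f s * f' s \<le> \<bar>f s\<bar> * \<bar>f' s\<bar>" by (metis abs_ge_self abs_mult)
      also have "\<dots> \<le> \<bar>f s\<bar> * (K * \<bar>f s\<bar>)" using K[of s] s by (intro mult_left_mono) auto
      also have "\<dots> = K * \<bar>f s\<bar>\<^sup>2" by (simp add: power2_eq_square)
      finally show ?thesis by simp
    qed
    ultimately show "\<exists>y. (g has_real_derivative y) (at s) \<and> y \<le> 0"
      by (auto intro!: exI mult_nonpos_nonneg)
  qed
  then have "(f s1)\<^sup>2 * exp (- 2 * K * s1) \<le> 0" using \<open>f s0 = 0\<close> by (simp add: g_def)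
  then show ?thesis by (simp add: mult_le_0_iff)
qed

text \<open>The coefficient is bounded on the compact interval between the two points; if
  \<open>s1 < s0\<close>, time is reversed.\<close>

lemma linear_ode_zero:
  fixes f f' k :: "real \<Rightarrow> real"
  assumes f: "\<And>s. s \<in> {\<alpha><..<\<beta>} \<Longrightarrow> (f has_real_derivative f' s) (at s)"
    and k: "continuous_on {\<alpha><..<\<beta>} k" "\<And>s. s \<in> {\<alpha><..<\<beta>} \<Longrightarrow> \<bar>f' s\<bar> \<le> k s * \<bar>f s\<bar>"
    and s: "s0 \<in> {\<alpha><..<\<beta>}" "s1 \<in> {\<alpha><..<\<beta>}" and "f s0 = 0"
  shows "f s1 = 0"
proof -
  have bd: "\<exists>K. \<forall>s\<in>{a..b}. k s \<le> K" if "a \<in> {\<alpha><..<\<beta>}" "b \<in> {\<alpha><..<\<beta>}" for a b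
  proof -
    have "continuous_on {a..b} k" by (rule continuous_on_subset[OF k(1)]) (use that in auto)
    then have "bounded (k ` {a..b})" by (intro compact_imp_bounded compact_continuous_image) auto
    then show ?thesis by (auto simp: bounded_iff abs_le_iff)
  qed
  show ?thesis
  proof (cases "s0 \<le> s1")
    case True
    obtain K where "\<forall>s\<in>{s0..s1}. k s \<le> K" using bd s by blast
    then have "\<bar>f' u\<bar> \<le> K * \<bar>f u\<bar>" if "u \<in> {s0..s1}" for u
      using k(2)[of u] that s by (force intro: order_trans[OF _ mult_right_mono])
    then show ?thesis
      using linear_ode_zero_forward[OF True, of f f' K] f s \<open>f s0 = 0\<close> by auto
  next
    case False
    obtain K where K: "\<forall>s\<in>{s1..s0}. k s \<le> K" using bd s by blast
    have d: "((\<lambda>u. f (- u)) has_real_derivative - f' (- u)) (at u)" if "u \<in> {-s0..-s1}" for u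
      using f[of "- u"] that s unfolding DERIV_mirror[symmetric] by auto
    have "\<bar>- f' (- u)\<bar> \<le> K * \<bar>f (- u)\<bar>" if "u \<in> {-s0..-s1}" for u
      using k(2)[of "- u"] K that s by (force intro: order_trans[OF _ mult_right_mono])
    then have "f (- (- s1)) = 0"
      using linear_ode_zero_forward[of "- s0" "- s1" "\<lambda>u. f (- u)" "\<lambda>u. - f' (- u)" K] d False
        \<open>f s0 = 0\<close> by auto
    then show ?thesis by simp
  qed
qed

lemma has_vector_derivative_vector_4:
  fixes f1 f2 f3 f4 :: "real \<Rightarrow> real"
  assumes "(f1 has_real_derivative d1) (at s)" "(f2 has_real_derivative d2) (at s)"
    "(f3 has_real_derivative d3) (at s)" "(f4 has_real_derivative d4) (at s)"
  shows "((\<lambda>s. vector [f1 s, f2 s, f3 s, f4 s] :: real^4) has_vector_derivative vector [d1, d2, d3, d4]) (at s)"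
proof -
  have eq: "(vector [x, y, z, t] :: real^4) = x *\<^sub>R axis 1 1 + y *\<^sub>R axis 2 1 + z *\<^sub>R axis 3 1 + t *\<^sub>R axis 4 1"
    for x y z t :: real
    by (simp add: vec_eq_4 vector_4 axis_def)
  show ?thesis unfolding eq
    by (intro has_vector_derivative_add has_vector_derivative_scaleR[where g'=0, simplified] assms)
      auto
qed

lemma continuous_on_vector_4:
  fixes f1 f2 f3 f4 :: "'a::topological_space \<Rightarrow> real"
  assumes "continuous_on U f1" "continuous_on U f2" "continuous_on U f3" "continuous_on U f4"
  shows "continuous_on U (\<lambda>s. vector [f1 s, f2 s, f3 s, f4 s] :: real^4)"
proof -
  have eq: "(vector [x, y, z, t] :: real^4) = x *\<^sub>R axis 1 1 + y *\<^sub>R axis 2 1 + z *\<^sub>R axis 3 1 + t *\<^sub>R axis 4 1"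
    for x y z t :: real
    by (simp add: vec_eq_4 vector_4 axis_def)
  show ?thesis unfolding eq by (intro continuous_intros assms)
qed

lemma continuous_nonzero_same_sign:
  fixes f :: "real \<Rightarrow> real"
  assumes "continuous_on {\<alpha><..<\<beta>} f" "\<And>s. s \<in> {\<alpha><..<\<beta>} \<Longrightarrow> f s \<noteq> 0"
    "s0 \<in> {\<alpha><..<\<beta>}" "s1 \<in> {\<alpha><..<\<beta>}"
  shows "f s0 * f s1 > 0"
proof (rule ccontr)
  assume "\<not> f s0 * f s1 > 0"
  then have "f s0 * f s1 < 0" using assms(2)[OF assms(3)] assms(2)[OF assms(4)]
    by (metis linorder_neqE_linordered_idom mult_eq_0_iff)
  moreover have "connected (f ` {\<alpha><..<\<beta>})"
    by (intro connected_continuous_image assms) auto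
  ultimately have "0 \<in> f ` {\<alpha><..<\<beta>}"
    using connectedD_interval[of "f ` {\<alpha><..<\<beta>}" "f s0" "f s1" 0]
      connectedD_interval[of "f ` {\<alpha><..<\<beta>}" "f s1" "f s0" 0] assms(3,4)
    by (auto simp: mult_less_0_iff)
  then show False using assms(2) by force
qed

text \<open>The squares determine the ratio of \<open>y\<close> to \<open>x\<close> up to sign, and
  the last hypothesis fixes the sign; for \<open>x = 0\<close> the common factor \<open>c\<close> is
  0 and both sides vanish.\<close>

lemma component_eq:
  fixes x y c G H :: real
  assumes "x\<^sup>2 = c * G" "y\<^sup>2 = c * H" "G > 0" "H > 0" "x \<noteq> 0 \<Longrightarrow> x * y > 0"
  shows "y = x / sqrt G * sqrt H"
proof (cases "x = 0")
  case True
  then have "c = 0" using assms by simp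
  then show ?thesis using True assms by simp
next
  case False
  have "y\<^sup>2 = (x / sqrt G * sqrt H)\<^sup>2"
    using assms by (simp add: power_mult_distrib power_divide)
  then have "y = x / sqrt G * sqrt H \<or> y = - (x / sqrt G * sqrt H)" by (simp add: power2_eq_iff)
  moreover have "y \<noteq> - (x / sqrt G * sqrt H)"
  proof
    assume y: "y = - (x / sqrt G * sqrt H)"
    have "x * y = - (x * x * (sqrt H / sqrt G))" unfolding y by (simp add: field_simps)
    moreover have "x * x * (sqrt H / sqrt G) > 0"
    proof (rule mult_pos_pos)
      show "x * x > 0" using False zero_less_power2[of x] by (simp only: power2_eq_square) simp
    qed (use assms(3,4) in simp)
    ultimately show False using assms(5)[OF False] by linarith
  qed
  ultimately show ?thesis by blast
qed

section \<open>Conservation of ellipsoidal coordinates along principal lines\<close>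

context quadric
begin

definition nu1 :: "real^4 \<Rightarrow> real" where "nu1 p = (SOME n1. \<exists>n2 n3. ellipsoidal p n1 n2 n3)"
definition nu2 :: "real^4 \<Rightarrow> real" where "nu2 p = (SOME n2. \<exists>n1 n3. ellipsoidal p n1 n2 n3)"
definition nu3 :: "real^4 \<Rightarrow> real" where "nu3 p = (SOME n3. \<exists>n1 n2. ellipsoidal p n1 n2 n3)"

definition nu :: "nat \<Rightarrow> real^4 \<Rightarrow> real" where
  "nu i = (if i = 1 then nu1 else if i = 2 then nu2 else nu3)"

lemma nu_eqI:
  assumes "ellipsoidal p n1 n2 n3"
  shows "nu1 p = n1" "nu2 p = n2" "nu3 p = n3"
proof -
  have "\<exists>n2 n3. ellipsoidal p (nu1 p) n2 n3"
    unfolding nu1_def by (rule someI[where P="\<lambda>n1. \<exists>n2 n3. ellipsoidal p n1 n2 n3"]) (use assms in blast)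
  moreover have "\<exists>n1 n3. ellipsoidal p n1 (nu2 p) n3"
    unfolding nu2_def by (rule someI[where P="\<lambda>n2. \<exists>n1 n3. ellipsoidal p n1 n2 n3"]) (use assms in blast)
  moreover have "\<exists>n1 n2. ellipsoidal p n1 n2 (nu3 p)"
    unfolding nu3_def by (rule someI[where P="\<lambda>n3. \<exists>n1 n2. ellipsoidal p n1 n2 n3"]) (use assms in blast)
  ultimately show "nu1 p = n1" "nu2 p = n2" "nu3 p = n3"
    using ellipsoidal_unique[OF _ assms] by blast+
qed

lemma ellipsoidal_nu: "p \<in> M \<Longrightarrow> ellipsoidal p (nu1 p) (nu2 p) (nu3 p)"
  using nu_eqI by (metis ellipsoidal_exists)

lemma nu_range:
  assumes "p \<in> M"
  shows "B \<le> nu1 p" "nu1 p \<le> A" "nu2 p \<le> - C" "- C \<le> nu3 p" "nu3 p \<le> - D"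
    "0 < nu1 p" "nu2 p < 0" "nu3 p < 0"
  using ellipsoidal_nu[OF assms] AB CD by (auto simp: ellipsoidal_def)

lemma nu_coords:
  assumes "p \<in> M"
  shows "(p $ 1)\<^sup>2 = XX * ((A - nu1 p) * (A - nu2 p) * (A - nu3 p))"
    "(p $ 2)\<^sup>2 = YY * ((nu1 p - B) * (B - nu2 p) * (B - nu3 p))"
    "(p $ 3)\<^sup>2 = ZZ * ((C + nu1 p) * (- C - nu2 p) * (C + nu3 p))"
    "(p $ 4)\<^sup>2 = TT * ((D + nu1 p) * (- D - nu2 p) * (- D - nu3 p))"
  using ellipsoidal_nu[OF assms] by (auto simp: ellipsoidal_def)

lemma Phi_zero_iff: "p \<in> M \<Longrightarrow> \<nu> \<noteq> 0 \<Longrightarrow> \<Phi> p \<nu> = 0 \<longleftrightarrow> \<nu> = nu1 p \<or> \<nu> = nu2 p \<or> \<nu> = nu3 p"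
  by (simp add: ellipsoidal_Phi[OF ellipsoidal_nu])

definition dom :: "nat \<Rightarrow> (real^4) set" where
  "dom i = {p \<in> M. i = 1 \<or> nu2 p < nu3 p}"

lemma foliation_domain_dom: "i \<in> {1, 2, 3} \<Longrightarrow> foliation_domain M N i = dom i"
  using umbilic_cases(3)[OF ellipsoidal_nu] nu_range
  by (fastforce simp: dom_def foliation_domain_M)

lemma integral_curve_M:
  assumes "i \<in> {1, 2, 3}"
  shows "integral_curve M N i \<gamma> \<alpha> \<beta> \<longleftrightarrow> \<alpha> < \<beta> \<and>
     (\<exists>\<gamma>'. continuous_on {\<alpha><..<\<beta>} \<gamma>' \<and>
       (\<forall>s\<in>{\<alpha><..<\<beta>}. (\<gamma> has_vector_derivative \<gamma>' s) (at s) \<and> \<gamma>' s \<noteq> 0 \<and>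
          \<gamma> s \<in> dom i \<and> S (\<gamma> s) (\<gamma>' s) = nu i (\<gamma> s) *\<^sub>R \<gamma>' s))"
proof -
  have "v \<in> eigenline M N i p \<longleftrightarrow> S p v = nu i p *\<^sub>R v" if "p \<in> dom i" for p v
    using assms eigenline_M[OF ellipsoidal_nu] that by (auto simp: dom_def nu_def)
  then show ?thesis
    unfolding integral_curve_def foliation_domain_dom[OF assms] by blast
qed

text \<open>Multiply the k-th component of the eigenvalue equation by the k-th entry of the point
  and by the product of the other three factors of the leading term of \<open>\<Phi>\<close>, then
  sum. The terms linear in the velocity add up to the full product times v . p, and the remaining
  ones complete this to (v . p) \<Phi>. The factor n - \<nu> stays on the left, since \<nu> may
  equal n.\<close>

lemma Phi_along_curve:
  assumes g: "(\<gamma> has_vector_derivative v) (at s)" and Sv: "S (\<gamma> s) v = n *\<^sub>R v"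
  obtains f' where "((\<lambda>s. \<Phi> (\<gamma> s) \<nu>) has_real_derivative f') (at s)"
    "(n - \<nu>) * f' = - 2 * (v \<bullet> \<gamma> s) * \<Phi> (\<gamma> s) \<nu>"
proof -
  have c: "((\<lambda>s. \<gamma> s $ k) has_real_derivative v $ k) (at s)" for k
    using bounded_linear.has_vector_derivative[OF bounded_linear_vec_nth g]
    by (simp add: has_real_derivative_iff_has_vector_derivative)
  have sq: "((\<lambda>s. (\<gamma> s $ k)\<^sup>2 * K) has_real_derivative 2 * (\<gamma> s $ k * v $ k) * K) (at s)" for k K
    using c[of k] by (auto intro!: derivative_eq_intros)
  define f' where "f' = 0 - 2 * (\<gamma> s $ 1 * v $ 1) * ((B - \<nu>) * (- C - \<nu>) * (- D - \<nu>))
    - 2 * (\<gamma> s $ 2 * v $ 2) * ((A - \<nu>) * (- C - \<nu>) * (- D - \<nu>))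
    - 2 * (\<gamma> s $ 3 * v $ 3) * ((A - \<nu>) * (B - \<nu>) * (- D - \<nu>))
    - 2 * (\<gamma> s $ 4 * v $ 4) * ((A - \<nu>) * (B - \<nu>) * (- C - \<nu>))"
  have d: "((\<lambda>s. \<Phi> (\<gamma> s) \<nu>) has_real_derivative f') (at s)"
    unfolding \<Phi>_def f'_def by (intro DERIV_diff DERIV_const sq)
  define l where "l = v \<bullet> \<gamma> s"
  define p1 p2 p3 p4 where "p1 = \<gamma> s $ 1" and "p2 = \<gamma> s $ 2" and "p3 = \<gamma> s $ 3" and "p4 = \<gamma> s $ 4"
  define v1 v2 v3 v4 where "v1 = v $ 1" and "v2 = v $ 2" and "v3 = v $ 3" and "v4 = v $ 4"
  note fold = p1_def[symmetric] p2_def[symmetric] p3_def[symmetric] p4_def[symmetric]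
    v1_def[symmetric] v2_def[symmetric] v3_def[symmetric] v4_def[symmetric]
  have e: "A * v1 - l * p1 = n * v1" "B * v2 - l * p2 = n * v2"
    "- C * v3 - l * p3 = n * v3" "- D * v4 - l * p4 = n * v4"
    using Sv unfolding vec_eq_4 S_nth l_def[symmetric] by (simp_all add: fold)
  have l: "l = v1 * p1 + v2 * p2 + v3 * p3 + v4 * p4" by (simp add: l_def inner_4 fold)
  have "(n - \<nu>) * (p1 * v1) = (A - \<nu>) * (p1 * v1) - l * p1\<^sup>2" using e(1) by algebra
  moreover have "(n - \<nu>) * (p2 * v2) = (B - \<nu>) * (p2 * v2) - l * p2\<^sup>2" using e(2) by algebra
  moreover have "(n - \<nu>) * (p3 * v3) = (- C - \<nu>) * (p3 * v3) - l * p3\<^sup>2" using e(3) by algebra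
  moreover have "(n - \<nu>) * (p4 * v4) = (- D - \<nu>) * (p4 * v4) - l * p4\<^sup>2" using e(4) by algebra
  ultimately have "(n - \<nu>) * f' = - 2 * l * \<Phi> (\<gamma> s) \<nu>"
    unfolding f'_def \<Phi>_def fold using l by algebra
  then show thesis using that[OF d] by (simp add: l_def)
qed

text \<open>By the previous lemma, \<open>\<Phi>\<close> at a fixed \<open>\<nu>\<close> solves a linear differential equation along the curve
  as long as the moving coordinate stays away from \<open>\<nu>\<close>, so that roots are conserved.\<close>

lemma root_persists:
  assumes i: "i \<in> {1, 2, 3}" and g: "integral_curve M N i \<gamma> \<alpha> \<beta>"
    and s: "s0 \<in> {\<alpha><..<\<beta>}" "s1 \<in> {\<alpha><..<\<beta>}" and r: "\<Phi> (\<gamma> s0) \<nu> = 0"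
    and \<delta>: "\<delta> > 0" "\<And>s. s \<in> {\<alpha><..<\<beta>} \<Longrightarrow> \<bar>nu i (\<gamma> s) - \<nu>\<bar> \<ge> \<delta>"
  shows "\<Phi> (\<gamma> s1) \<nu> = 0"
proof -
  obtain \<gamma>' where g': "continuous_on {\<alpha><..<\<beta>} \<gamma>'"
    and G: "\<And>s. s \<in> {\<alpha><..<\<beta>} \<Longrightarrow> (\<gamma> has_vector_derivative \<gamma>' s) (at s) \<and>
      S (\<gamma> s) (\<gamma>' s) = nu i (\<gamma> s) *\<^sub>R \<gamma>' s"
    using g unfolding integral_curve_M[OF i] by blast
  have "\<exists>f'. ((\<lambda>s. \<Phi> (\<gamma> s) \<nu>) has_real_derivative f') (at s) \<and>
      (nu i (\<gamma> s) - \<nu>) * f' = - 2 * (\<gamma>' s \<bullet> \<gamma> s) * \<Phi> (\<gamma> s) \<nu>" if "s \<in> {\<alpha><..<\<beta>}" for s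
    using Phi_along_curve[of \<gamma> "\<gamma>' s" s "nu i (\<gamma> s)" \<nu>] G[OF that] by metis
  then obtain f' where f': "\<And>s. s \<in> {\<alpha><..<\<beta>} \<Longrightarrow>
      ((\<lambda>s. \<Phi> (\<gamma> s) \<nu>) has_real_derivative f' s) (at s) \<and>
      (nu i (\<gamma> s) - \<nu>) * f' s = - 2 * (\<gamma>' s \<bullet> \<gamma> s) * \<Phi> (\<gamma> s) \<nu>"
    by metis
  have cg: "continuous_on {\<alpha><..<\<beta>} \<gamma>"
    using G by (meson continuous_at_imp_continuous_on has_vector_derivative_continuous)
  show ?thesis
  proof (rule linear_ode_zero[where f="\<lambda>s. \<Phi> (\<gamma> s) \<nu>" and f'=f', OF _ _ _ s r])
    show "continuous_on {\<alpha><..<\<beta>} (\<lambda>s. (2 / \<delta>) * \<bar>\<gamma>' s \<bullet> \<gamma> s\<bar>)"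
      by (intro continuous_intros g' cg)
    fix u assume u: "u \<in> {\<alpha><..<\<beta>}"
    show "((\<lambda>s. \<Phi> (\<gamma> s) \<nu>) has_real_derivative f' u) (at u)" using f'[OF u] by blast
    have "\<delta> * \<bar>f' u\<bar> \<le> \<bar>nu i (\<gamma> u) - \<nu>\<bar> * \<bar>f' u\<bar>" using \<delta>(2)[OF u] by (intro mult_right_mono) auto
    also have "\<dots> = \<bar>- 2 * (\<gamma>' u \<bullet> \<gamma> u) * \<Phi> (\<gamma> u) \<nu>\<bar>" using f'[OF u] by (metis abs_mult)
    also have "\<dots> = 2 * \<bar>\<gamma>' u \<bullet> \<gamma> u\<bar> * \<bar>\<Phi> (\<gamma> u) \<nu>\<bar>" by (simp add: abs_mult)
    finally show "\<bar>f' u\<bar> \<le> 2 / \<delta> * \<bar>\<gamma>' u \<bullet> \<gamma> u\<bar> * \<bar>\<Phi> (\<gamma> u) \<nu>\<bar>"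
      using \<delta>(1) by (simp add: field_simps)
  qed
qed

text \<open>A root persists while the moving coordinate keeps a distance from it. For
  \<open>nu1\<close> this distance is at least B. For \<open>nu2\<close> and \<open>nu3\<close> a
  gap exists only when the value differs from - C; if both ends have the value - C there is nothing
  to show, and otherwise the argument starts from an end where it differs.\<close>

lemma nu_conserved:
  assumes i: "i \<in> {1, 2, 3}" and g: "integral_curve M N i \<gamma> \<alpha> \<beta>"
    and s: "s0 \<in> {\<alpha><..<\<beta>}" "s1 \<in> {\<alpha><..<\<beta>}"
  shows "i \<noteq> 1 \<Longrightarrow> nu1 (\<gamma> s1) = nu1 (\<gamma> s0)" "i \<noteq> 2 \<Longrightarrow> nu2 (\<gamma> s1) = nu2 (\<gamma> s0)"
    "i \<noteq> 3 \<Longrightarrow> nu3 (\<gamma> s1) = nu3 (\<gamma> s0)"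
proof -
  have M: "\<gamma> s \<in> M" if "s \<in> {\<alpha><..<\<beta>}" for s
    using g that unfolding integral_curve_M[OF i] dom_def by blast
  show "nu1 (\<gamma> s1) = nu1 (\<gamma> s0)" if "i \<noteq> 1"
  proof -
    have "\<Phi> (\<gamma> s1) (nu1 (\<gamma> s0)) = 0"
    proof (rule root_persists[OF i g s _ AB(2)])
      show "\<Phi> (\<gamma> s0) (nu1 (\<gamma> s0)) = 0"
        by (simp add: ellipsoidal_Phi[OF ellipsoidal_nu[OF M[OF s(1)]]])
      show "B \<le> \<bar>nu i (\<gamma> u) - nu1 (\<gamma> s0)\<bar>" if "u \<in> {\<alpha><..<\<beta>}" for u
        using nu_range[OF M[OF that]] nu_range[OF M[OF s(1)]] \<open>i \<noteq> 1\<close> i by (auto simp: nu_def)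
    qed
    then have "nu1 (\<gamma> s0) = nu1 (\<gamma> s1) \<or> nu1 (\<gamma> s0) = nu2 (\<gamma> s1) \<or> nu1 (\<gamma> s0) = nu3 (\<gamma> s1)"
      using Phi_zero_iff[OF M[OF s(2)], of "nu1 (\<gamma> s0)"] nu_range(6)[OF M[OF s(1)]] by simp
    then show ?thesis
      using nu_range[OF M[OF s(1)]] nu_range[OF M[OF s(2)]] by linarith
  qed
  have 2: "nu2 (\<gamma> t1) = nu2 (\<gamma> t0)"
    if "i \<noteq> 2" "nu2 (\<gamma> t0) < - C" and t: "t0 \<in> {\<alpha><..<\<beta>}" "t1 \<in> {\<alpha><..<\<beta>}" for t0 t1
  proof -
    have "\<Phi> (\<gamma> t1) (nu2 (\<gamma> t0)) = 0"
    proof (rule root_persists[OF i g t])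
      show "0 < - C - nu2 (\<gamma> t0)" using that by simp
      show "\<Phi> (\<gamma> t0) (nu2 (\<gamma> t0)) = 0"
        by (simp add: ellipsoidal_Phi[OF ellipsoidal_nu[OF M[OF t(1)]]])
      show "- C - nu2 (\<gamma> t0) \<le> \<bar>nu i (\<gamma> u) - nu2 (\<gamma> t0)\<bar>" if "u \<in> {\<alpha><..<\<beta>}" for u
        using nu_range[OF M[OF that]] nu_range[OF M[OF t(1)]] \<open>i \<noteq> 2\<close> i CD by (auto simp: nu_def)
    qed
    then have "nu2 (\<gamma> t0) = nu1 (\<gamma> t1) \<or> nu2 (\<gamma> t0) = nu2 (\<gamma> t1) \<or> nu2 (\<gamma> t0) = nu3 (\<gamma> t1)"
      using Phi_zero_iff[OF M[OF t(2)], of "nu2 (\<gamma> t0)"] nu_range(7)[OF M[OF t(1)]] by simp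
    then show ?thesis
      using nu_range[OF M[OF t(1)]] nu_range[OF M[OF t(2)]]
        \<open>nu2 (\<gamma> t0) < - C\<close> by linarith
  qed
  show "nu2 (\<gamma> s1) = nu2 (\<gamma> s0)" if "i \<noteq> 2"
  proof (cases "nu2 (\<gamma> s0) < - C \<or> nu2 (\<gamma> s1) < - C")
    case True
    then show ?thesis using 2[OF that _ s] 2[OF that _ s(2,1)] by metis
  next
    case False
    then show ?thesis using nu_range(3)[OF M[OF s(1)]] nu_range(3)[OF M[OF s(2)]] by linarith
  qed
  have 3: "nu3 (\<gamma> t1) = nu3 (\<gamma> t0)"
    if "i \<noteq> 3" "- C < nu3 (\<gamma> t0)" and t: "t0 \<in> {\<alpha><..<\<beta>}" "t1 \<in> {\<alpha><..<\<beta>}" for t0 t1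
  proof -
    have "\<Phi> (\<gamma> t1) (nu3 (\<gamma> t0)) = 0"
    proof (rule root_persists[OF i g t])
      \<comment> \<open>The first entry bounds the distance from \<open>nu1\<close>, the second the
        distance from \<open>nu2\<close>.\<close>
      show "0 < min B (nu3 (\<gamma> t0) + C)" using that AB by simp
      show "\<Phi> (\<gamma> t0) (nu3 (\<gamma> t0)) = 0"
        by (simp add: ellipsoidal_Phi[OF ellipsoidal_nu[OF M[OF t(1)]]])
      show "min B (nu3 (\<gamma> t0) + C) \<le> \<bar>nu i (\<gamma> u) - nu3 (\<gamma> t0)\<bar>" if "u \<in> {\<alpha><..<\<beta>}" for u
        using nu_range[OF M[OF that]] nu_range[OF M[OF t(1)]] \<open>i \<noteq> 3\<close> i CD by (auto simp: nu_def)
    qed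
    then have "nu3 (\<gamma> t0) = nu1 (\<gamma> t1) \<or> nu3 (\<gamma> t0) = nu2 (\<gamma> t1) \<or> nu3 (\<gamma> t0) = nu3 (\<gamma> t1)"
      using Phi_zero_iff[OF M[OF t(2)], of "nu3 (\<gamma> t0)"] nu_range(8)[OF M[OF t(1)]] by simp
    then show ?thesis
      using nu_range[OF M[OF t(1)]] nu_range[OF M[OF t(2)]]
        \<open>- C < nu3 (\<gamma> t0)\<close> by linarith
  qed
  show "nu3 (\<gamma> s1) = nu3 (\<gamma> s0)" if "i \<noteq> 3"
  proof (cases "- C < nu3 (\<gamma> s0) \<or> - C < nu3 (\<gamma> s1)")
    case True
    then show ?thesis using 3[OF that _ s] 3[OF that _ s(2,1)] by metis
  next
    case False
    then show ?thesis using nu_range(4)[OF M[OF s(1)]] nu_range(4)[OF M[OF s(2)]] by linarith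
  qed
qed

lemma sign_conserved:
  assumes i: "i \<in> {1, 2, 3}" and g: "integral_curve M N i \<gamma> \<alpha> \<beta>"
    and s: "s0 \<in> {\<alpha><..<\<beta>}" "s1 \<in> {\<alpha><..<\<beta>}"
    and nz: "\<And>s. s \<in> {\<alpha><..<\<beta>} \<Longrightarrow> \<gamma> s $ k \<noteq> 0"
  shows "\<gamma> s0 $ k * \<gamma> s1 $ k > 0"
proof -
  have "continuous_on {\<alpha><..<\<beta>} \<gamma>"
    using g unfolding integral_curve_M[OF i]
    by (meson continuous_at_imp_continuous_on has_vector_derivative_continuous)
  then show ?thesis
    by (intro continuous_nonzero_same_sign[where f="\<lambda>s. \<gamma> s $ k", OF _ nz s] continuous_intros)
qed

lemma curve_tangent:
  assumes "open J" "s \<in> J" "\<And>u. u \<in> J \<Longrightarrow> \<gamma> u \<in> M" "(\<gamma> has_vector_derivative v) (at s)"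
  shows "v \<bullet> Am (\<gamma> s) = 0"
proof -
  have "((\<lambda>s. Am (\<gamma> s) \<bullet> \<gamma> s) has_vector_derivative Am (\<gamma> s) \<bullet> v + Am v \<bullet> \<gamma> s) (at s)"
    by (intro bounded_bilinear.has_vector_derivative[OF bounded_bilinear_inner] assms
        bounded_linear.has_vector_derivative[OF linear_conv_bounded_linear[THEN iffD1, OF linear_Am]])
  moreover have "((\<lambda>s. Am (\<gamma> s) \<bullet> \<gamma> s) has_vector_derivative 0) (at s)"
    by (rule has_vector_derivative_transform_within_open[of "\<lambda>s. 1" _ _ J])
      (use assms in \<open>auto simp: M_def\<close>)
  ultimately have "Am (\<gamma> s) \<bullet> v + Am v \<bullet> \<gamma> s = 0"
    using vector_derivative_unique_at by blast
  then show ?thesis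
    using Am_sym[of v "\<gamma> s"] by (simp add: inner_commute)
qed

text \<open>Spares the computation of v . p along explicit curves: the four equations say Dm v - n v
  = l p, and pairing with \<open>Am p\<close> gives l = v . p by tangency.\<close>

lemma S_eigenvectorI:
  assumes "p \<in> M" "v \<bullet> Am p = 0"
    "(A - n) * v $ 1 = l * p $ 1" "(B - n) * v $ 2 = l * p $ 2"
    "(- C - n) * v $ 3 = l * p $ 3" "(- D - n) * v $ 4 = l * p $ 4"
  shows "S p v = n *\<^sub>R v"
proof -
  have D: "Dm v - n *\<^sub>R v = l *\<^sub>R p"
    using assms(3-6) by (simp add: vec_eq_4 Dm_nth algebra_simps)
  then have "(Dm v - n *\<^sub>R v) \<bullet> Am p = (l *\<^sub>R p) \<bullet> Am p" by simp
  then have "v \<bullet> p = l"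
    using assms(1,2) by (simp add: inner_diff_left inner_diff_right Dm_sym Dm_Am M_def) (simp add: inner_commute)
  then show ?thesis using D by (simp add: S_def algebra_simps)
qed

lemma leaf_throughI:
  assumes i: "i \<in> {1, 2, 3}" and J: "open J" "is_interval J"
    and c: "\<And>s. s \<in> J \<Longrightarrow> (c has_vector_derivative c' s) (at s)" "continuous_on J c'"
      "\<And>s. s \<in> J \<Longrightarrow> c' s \<noteq> 0" "\<And>s. s \<in> J \<Longrightarrow> c s \<in> dom i"
      "\<And>s. s \<in> J \<Longrightarrow> (A - nu i (c s)) * c' s $ 1 = l s * c s $ 1 \<and>
        (B - nu i (c s)) * c' s $ 2 = l s * c s $ 2 \<and>
        (- C - nu i (c s)) * c' s $ 3 = l s * c s $ 3 \<and>
        (- D - nu i (c s)) * c' s $ 4 = l s * c s $ 4"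
    and q: "s0 \<in> J" "s1 \<in> J"
  shows "\<And>\<alpha> \<beta>. \<alpha> < \<beta> \<Longrightarrow> {\<alpha><..<\<beta>} \<subseteq> J \<Longrightarrow> integral_curve M N i c \<alpha> \<beta>"
    and "c s1 \<in> leaf_through M N i (c s0)"
proof -
  have cM: "c s \<in> M" if "s \<in> J" for s using c(4)[OF that] by (simp add: dom_def)
  show ic: "integral_curve M N i c \<alpha> \<beta>" if "\<alpha> < \<beta>" "{\<alpha><..<\<beta>} \<subseteq> J" for \<alpha> \<beta>
    unfolding integral_curve_M[OF i]
  proof (intro conjI that exI[of _ c'] ballI)
    show "continuous_on {\<alpha><..<\<beta>} c'" by (rule continuous_on_subset[OF c(2) that(2)])
    fix s assume "s \<in> {\<alpha><..<\<beta>}"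
    then have s: "s \<in> J" using that by auto
    show "(c has_vector_derivative c' s) (at s)" "c' s \<noteq> 0" "c s \<in> dom i" using c s by auto
    show "S (c s) (c' s) = nu i (c s) *\<^sub>R c' s"
      using S_eigenvectorI[OF cM[OF s] curve_tangent[OF J(1) s cM c(1)[OF s]]] c(5)[OF s] by blast
  qed
  \<comment> \<open>\<open>leaf_through\<close> asks for an open parameter interval that contains
    both parameters, so the segment between them is enlarged inside \<open>J\<close>.\<close>
  obtain e where e: "e > 0" "ball (min s0 s1) e \<subseteq> J"
    using J(1) q open_contains_ball by (metis min_def)
  obtain e' where e': "e' > 0" "ball (max s0 s1) e' \<subseteq> J"
    using J(1) q open_contains_ball by (metis max_def)
  define \<alpha> \<beta> where "\<alpha> = min s0 s1 - e / 2" and "\<beta> = max s0 s1 + e' / 2"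
  have "\<alpha> \<in> J" "\<beta> \<in> J" using e e' by (auto simp: \<alpha>_def \<beta>_def dist_real_def subset_iff)
  then have "{\<alpha><..<\<beta>} \<subseteq> J" using J(2) unfolding is_interval_1
    by (meson greaterThanLessThan_iff less_imp_le subsetI)
  moreover have "\<alpha> < \<beta>" "s0 \<in> {\<alpha><..<\<beta>}" "s1 \<in> {\<alpha><..<\<beta>}" using e e' by (auto simp: \<alpha>_def \<beta>_def)
  ultimately show "c s1 \<in> leaf_through M N i (c s0)"
    unfolding leaf_through_def using ic by blast
qed

end

section \<open>Parametrization of the leaves\<close>

context quadric
begin

lemma leaf_throughD:
  assumes "q \<in> leaf_through M N i p"
  obtains \<gamma> \<alpha> \<beta> s0 s1 where "integral_curve M N i \<gamma> \<alpha> \<beta>" "s0 \<in> {\<alpha><..<\<beta>}" "s1 \<in> {\<alpha><..<\<beta>}"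
    "\<gamma> s0 = p" "\<gamma> s1 = q"
  using assms unfolding leaf_through_def by blast

lemma integral_curve_dom:
  assumes "i \<in> {1, 2, 3}" "integral_curve M N i \<gamma> \<alpha> \<beta>" "s \<in> {\<alpha><..<\<beta>}"
  shows "\<gamma> s \<in> dom i" "\<gamma> s \<in> M"
  using assms unfolding integral_curve_M[OF assms(1)] by (auto simp: dom_def)

text \<open>An entry whose square is a constant times a positive function vanishes identically or
  never; in the second case its sign is constant, and the square determines the rest.\<close>

lemma component_along:
  assumes i: "i \<in> {1, 2, 3}" and g: "integral_curve M N i \<gamma> \<alpha> \<beta>"
    and s: "s0 \<in> {\<alpha><..<\<beta>}" "s1 \<in> {\<alpha><..<\<beta>}"
    and H: "\<And>s. s \<in> {\<alpha><..<\<beta>} \<Longrightarrow> (\<gamma> s $ k)\<^sup>2 = K * H s" "\<And>s. s \<in> {\<alpha><..<\<beta>} \<Longrightarrow> 0 < H s"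
  shows "\<gamma> s1 $ k = \<gamma> s0 $ k / sqrt (H s0) * sqrt (H s1)"
proof (rule component_eq[where c=K])
  show "(\<gamma> s0 $ k)\<^sup>2 = K * H s0" "(\<gamma> s1 $ k)\<^sup>2 = K * H s1" "0 < H s0" "0 < H s1"
    using H s by auto
  assume nz: "\<gamma> s0 $ k \<noteq> 0"
  then have "K \<noteq> 0" using H(1)[OF s(1)] by auto
  then have "\<gamma> s $ k \<noteq> 0" if "s \<in> {\<alpha><..<\<beta>}" for s
    using H(1)[OF that] H(2)[OF that] by auto
  then show "0 < \<gamma> s0 $ k * \<gamma> s1 $ k" by (rule sign_conserved[OF i g s])
qed

text \<open>The moving coordinate is chosen so that the factors that can reach 0 become constants
  times squares: A - w1 and w1 - B are multiples of cos^2 and sin^2, - C - w2 is s^2, and C + w3 and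
  - D - w3 are again multiples of cos^2 and sin^2. The curves then cross the coordinate hyperplanes
  smoothly.\<close>

definition w1 :: "real \<Rightarrow> real" where "w1 s = B + (A - B) * (sin s)\<^sup>2"
definition w2 :: "real \<Rightarrow> real" where "w2 s = - C - s\<^sup>2"
definition w3 :: "real \<Rightarrow> real" where "w3 s = - D - (C - D) * (sin s)\<^sup>2"

text \<open>The coordinate formulas of \<open>ellipsoidal\<close> with one coordinate moving;
  \<open>m1\<close> to \<open>m4\<close> collect the constant factors together with the
  signs.\<close>

definition c1 :: "real \<Rightarrow> real \<Rightarrow> real \<Rightarrow> real \<Rightarrow> real \<Rightarrow> real^4" where
  "c1 m1 m2 m3 m4 s = vector [m1 * cos s, m2 * sin s, m3 * sqrt (C + w1 s), m4 * sqrt (D + w1 s)]"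
definition c2 :: "real \<Rightarrow> real \<Rightarrow> real \<Rightarrow> real \<Rightarrow> real \<Rightarrow> real^4" where
  "c2 m1 m2 m3 m4 s = vector [m1 * sqrt (A - w2 s), m2 * sqrt (B - w2 s), m3 * s, m4 * sqrt (- D - w2 s)]"
definition c3 :: "real \<Rightarrow> real \<Rightarrow> real \<Rightarrow> real \<Rightarrow> real \<Rightarrow> real^4" where
  "c3 m1 m2 m3 m4 s = vector [m1 * sqrt (A - w3 s), m2 * sqrt (B - w3 s), m3 * cos s, m4 * sin s]"

text \<open>These are minus one half of the derivatives of \<open>w1\<close> and \<open>w3\<close>;
  for \<open>w2\<close> the same quantity is s. It becomes the factor \<open>l\<close> of
  \<open>S_eigenvectorI\<close>, the product of velocity and position.\<close>

definition l1 :: "real \<Rightarrow> real" where "l1 s = - (A - B) * sin s * cos s"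
definition l3 :: "real \<Rightarrow> real" where "l3 s = (C - D) * sin s * cos s"

definition d1 :: "real \<Rightarrow> real \<Rightarrow> real \<Rightarrow> real \<Rightarrow> real \<Rightarrow> real^4" where
  "d1 m1 m2 m3 m4 s =
    vector [- m1 * sin s, m2 * cos s, - m3 * l1 s / sqrt (C + w1 s), - m4 * l1 s / sqrt (D + w1 s)]"
definition d2 :: "real \<Rightarrow> real \<Rightarrow> real \<Rightarrow> real \<Rightarrow> real \<Rightarrow> real^4" where
  "d2 m1 m2 m3 m4 s =
    vector [m1 * s / sqrt (A - w2 s), m2 * s / sqrt (B - w2 s), m3, m4 * s / sqrt (- D - w2 s)]"
definition d3 :: "real \<Rightarrow> real \<Rightarrow> real \<Rightarrow> real \<Rightarrow> real \<Rightarrow> real^4" where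
  "d3 m1 m2 m3 m4 s =
    vector [m1 * l3 s / sqrt (A - w3 s), m2 * l3 s / sqrt (B - w3 s), - m3 * sin s, m4 * cos s]"

lemma w1_eq: "A - w1 s = (A - B) * (cos s)\<^sup>2" "w1 s - B = (A - B) * (sin s)\<^sup>2"
  by (simp_all add: w1_def cos_squared_eq algebra_simps)

lemma w1_range: "B \<le> w1 s" "w1 s \<le> A" "0 < C + w1 s" "0 < D + w1 s"
proof -
  show 1: "B \<le> w1 s" using AB by (simp add: w1_def)
  have "A - w1 s \<ge> 0" unfolding w1_eq using AB by simp
  then show "w1 s \<le> A" by simp
  show "0 < C + w1 s" "0 < D + w1 s" using 1 AB CD by auto
qed

lemma w2_range: "w2 s \<le> - C" "0 < A - w2 s" "0 < B - w2 s" "0 < - D - w2 s"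
proof -
  show 1: "w2 s \<le> - C" by (simp add: w2_def)
  show "0 < A - w2 s" "0 < B - w2 s" "0 < - D - w2 s" using 1 AB CD by auto
qed

lemma w3_eq: "C + w3 s = (C - D) * (cos s)\<^sup>2" "- D - w3 s = (C - D) * (sin s)\<^sup>2"
  by (simp_all add: w3_def cos_squared_eq algebra_simps)

lemma w3_range: "- C \<le> w3 s" "w3 s \<le> - D" "0 < A - w3 s" "0 < B - w3 s"
proof -
  show 1: "w3 s \<le> - D" using CD by (simp add: w3_def)
  have "C + w3 s \<ge> 0" unfolding w3_eq using CD by simp
  then show "- C \<le> w3 s" by simp
  show "0 < A - w3 s" "0 < B - w3 s" using 1 AB CD by auto
qed

text \<open>The four scalar equations are the componentwise hypotheses of
  \<open>S_eigenvectorI\<close>. Each holds for its own component, whatever the constants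
  \<open>m1\<close> to \<open>m4\<close> are.\<close>

lemma c1_deriv:
  shows "(c1 m1 m2 m3 m4 has_vector_derivative d1 m1 m2 m3 m4 s) (at s)" "continuous_on U (d1 m1 m2 m3 m4)"
    "(A - w1 s) * d1 m1 m2 m3 m4 s $ 1 = l1 s * c1 m1 m2 m3 m4 s $ 1"
    "(B - w1 s) * d1 m1 m2 m3 m4 s $ 2 = l1 s * c1 m1 m2 m3 m4 s $ 2"
    "(- C - w1 s) * d1 m1 m2 m3 m4 s $ 3 = l1 s * c1 m1 m2 m3 m4 s $ 3"
    "(- D - w1 s) * d1 m1 m2 m3 m4 s $ 4 = l1 s * c1 m1 m2 m3 m4 s $ 4"
proof -
  have w: "(w1 has_real_derivative - 2 * l1 s) (at s)" for s
    unfolding w1_def l1_def by (auto intro!: derivative_eq_intros simp: algebra_simps)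
  have sq: "((\<lambda>s. m * sqrt (K + w1 s)) has_real_derivative - m * l1 s / sqrt (K + w1 s)) (at s)"
    if "K + w1 s > 0" for K m s
    using w[of s] that by (auto intro!: derivative_eq_intros simp: field_simps)
  show "(c1 m1 m2 m3 m4 has_vector_derivative d1 m1 m2 m3 m4 s) (at s)"
    unfolding c1_def d1_def
    by (intro has_vector_derivative_vector_4 sq w1_range) (auto intro!: derivative_eq_intros)
  have nz: "sqrt (C + w1 s) \<noteq> 0" "sqrt (D + w1 s) \<noteq> 0" for s using w1_range[of s] by auto
  have cw: "continuous_on U w1" unfolding w1_def by (intro continuous_intros)
  show "continuous_on U (d1 m1 m2 m3 m4)" unfolding d1_def l1_def
    by (intro continuous_on_vector_4 continuous_intros cw) (use nz in auto)
  show "(A - w1 s) * d1 m1 m2 m3 m4 s $ 1 = l1 s * c1 m1 m2 m3 m4 s $ 1"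
    unfolding d1_def c1_def vector_4 l1_def w1_eq by algebra
  have "(w1 s - B) * d1 m1 m2 m3 m4 s $ 2 = - l1 s * c1 m1 m2 m3 m4 s $ 2"
    unfolding d1_def c1_def vector_4 l1_def w1_eq by algebra
  then show "(B - w1 s) * d1 m1 m2 m3 m4 s $ 2 = l1 s * c1 m1 m2 m3 m4 s $ 2" by (simp add: algebra_simps)
  have K: "(- K - w1 s) * (- m * l1 s / sqrt (K + w1 s)) = l1 s * (m * sqrt (K + w1 s))"
    if "K + w1 s > 0" for K m
  proof -
    have "(- K - w1 s) * (- m * l1 s / sqrt (K + w1 s)) = m * l1 s * ((K + w1 s) / sqrt (K + w1 s))"
    proof -
      have "- K - w1 s = - (K + w1 s)" by simp
      then show ?thesis by (simp only: minus_mult_minus minus_divide_left mult_minus_left) simp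
    qed
    then show ?thesis using that by (simp add: real_div_sqrt)
  qed
  show "(- C - w1 s) * d1 m1 m2 m3 m4 s $ 3 = l1 s * c1 m1 m2 m3 m4 s $ 3"
    "(- D - w1 s) * d1 m1 m2 m3 m4 s $ 4 = l1 s * c1 m1 m2 m3 m4 s $ 4"
    unfolding d1_def c1_def vector_4 by (rule K; rule w1_range)+
qed

lemma c2_deriv:
  shows "(c2 m1 m2 m3 m4 has_vector_derivative d2 m1 m2 m3 m4 s) (at s)" "continuous_on U (d2 m1 m2 m3 m4)"
    "(A - w2 s) * d2 m1 m2 m3 m4 s $ 1 = s * c2 m1 m2 m3 m4 s $ 1"
    "(B - w2 s) * d2 m1 m2 m3 m4 s $ 2 = s * c2 m1 m2 m3 m4 s $ 2"
    "(- C - w2 s) * d2 m1 m2 m3 m4 s $ 3 = s * c2 m1 m2 m3 m4 s $ 3"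
    "(- D - w2 s) * d2 m1 m2 m3 m4 s $ 4 = s * c2 m1 m2 m3 m4 s $ 4"
proof -
  have w: "(w2 has_real_derivative - 2 * s) (at s)" for s
    unfolding w2_def by (auto intro!: derivative_eq_intros)
  have sq: "((\<lambda>s. m * sqrt (K - w2 s)) has_real_derivative m * s / sqrt (K - w2 s)) (at s)"
    if "K - w2 s > 0" for K m s
    using w[of s] that by (auto intro!: derivative_eq_intros simp: field_simps)
  show "(c2 m1 m2 m3 m4 has_vector_derivative d2 m1 m2 m3 m4 s) (at s)"
    unfolding c2_def d2_def
    by (intro has_vector_derivative_vector_4 sq w2_range) (auto intro!: derivative_eq_intros)
  have nz: "sqrt (A - w2 s) \<noteq> 0" "sqrt (B - w2 s) \<noteq> 0" "sqrt (- D - w2 s) \<noteq> 0" for s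
    using w2_range[of s] by auto
  have cw: "continuous_on U w2" unfolding w2_def by (intro continuous_intros)
  show "continuous_on U (d2 m1 m2 m3 m4)" unfolding d2_def
    by (intro continuous_on_vector_4 continuous_intros cw) (use nz in auto)
  have K: "(K - w2 s) * (m * s / sqrt (K - w2 s)) = s * (m * sqrt (K - w2 s))"
    if "K - w2 s > 0" for K m
  proof -
    have "(K - w2 s) * (m * s / sqrt (K - w2 s)) = m * s * ((K - w2 s) / sqrt (K - w2 s))"
      by (simp add: field_simps)
    then show ?thesis using that by (simp add: real_div_sqrt)
  qed
  show "(A - w2 s) * d2 m1 m2 m3 m4 s $ 1 = s * c2 m1 m2 m3 m4 s $ 1"
    "(B - w2 s) * d2 m1 m2 m3 m4 s $ 2 = s * c2 m1 m2 m3 m4 s $ 2"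
    "(- D - w2 s) * d2 m1 m2 m3 m4 s $ 4 = s * c2 m1 m2 m3 m4 s $ 4"
    unfolding d2_def c2_def vector_4 by (rule K; rule w2_range)+
  show "(- C - w2 s) * d2 m1 m2 m3 m4 s $ 3 = s * c2 m1 m2 m3 m4 s $ 3"
    unfolding d2_def c2_def vector_4 w2_def by algebra
qed

lemma c3_deriv:
  shows "(c3 m1 m2 m3 m4 has_vector_derivative d3 m1 m2 m3 m4 s) (at s)" "continuous_on U (d3 m1 m2 m3 m4)"
    "(A - w3 s) * d3 m1 m2 m3 m4 s $ 1 = l3 s * c3 m1 m2 m3 m4 s $ 1"
    "(B - w3 s) * d3 m1 m2 m3 m4 s $ 2 = l3 s * c3 m1 m2 m3 m4 s $ 2"
    "(- C - w3 s) * d3 m1 m2 m3 m4 s $ 3 = l3 s * c3 m1 m2 m3 m4 s $ 3"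
    "(- D - w3 s) * d3 m1 m2 m3 m4 s $ 4 = l3 s * c3 m1 m2 m3 m4 s $ 4"
proof -
  have w: "(w3 has_real_derivative - 2 * l3 s) (at s)" for s
    unfolding w3_def l3_def by (auto intro!: derivative_eq_intros)
  have sq: "((\<lambda>s. m * sqrt (K - w3 s)) has_real_derivative m * l3 s / sqrt (K - w3 s)) (at s)"
    if "K - w3 s > 0" for K m s
    using w[of s] that by (auto intro!: derivative_eq_intros simp: field_simps)
  show "(c3 m1 m2 m3 m4 has_vector_derivative d3 m1 m2 m3 m4 s) (at s)"
    unfolding c3_def d3_def
    by (intro has_vector_derivative_vector_4 sq w3_range) (auto intro!: derivative_eq_intros)
  have nz: "sqrt (A - w3 s) \<noteq> 0" "sqrt (B - w3 s) \<noteq> 0" for s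
    using w3_range[of s] by auto
  have cw: "continuous_on U w3" unfolding w3_def by (intro continuous_intros)
  show "continuous_on U (d3 m1 m2 m3 m4)" unfolding d3_def l3_def
    by (intro continuous_on_vector_4 continuous_intros cw) (use nz in auto)
  have K: "(K - w3 s) * (m * l3 s / sqrt (K - w3 s)) = l3 s * (m * sqrt (K - w3 s))"
    if "K - w3 s > 0" for K m
  proof -
    have "(K - w3 s) * (m * l3 s / sqrt (K - w3 s)) = m * l3 s * ((K - w3 s) / sqrt (K - w3 s))"
      by (simp add: field_simps)
    then show ?thesis using that by (simp add: real_div_sqrt)
  qed
  show "(A - w3 s) * d3 m1 m2 m3 m4 s $ 1 = l3 s * c3 m1 m2 m3 m4 s $ 1"
    "(B - w3 s) * d3 m1 m2 m3 m4 s $ 2 = l3 s * c3 m1 m2 m3 m4 s $ 2"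
    unfolding d3_def c3_def vector_4 by (rule K; rule w3_range)+
  have "(C + w3 s) * d3 m1 m2 m3 m4 s $ 3 = - l3 s * c3 m1 m2 m3 m4 s $ 3"
    unfolding d3_def c3_def vector_4 l3_def w3_eq by algebra
  then show "(- C - w3 s) * d3 m1 m2 m3 m4 s $ 3 = l3 s * c3 m1 m2 m3 m4 s $ 3" by (simp add: algebra_simps)
  show "(- D - w3 s) * d3 m1 m2 m3 m4 s $ 4 = l3 s * c3 m1 m2 m3 m4 s $ 4"
    unfolding d3_def c3_def vector_4 l3_def w3_eq by algebra
qed

end

lemma on_circle:
  fixes x y m n :: real
  assumes "m > 0" "n > 0" "x\<^sup>2 = m\<^sup>2 * u" "y\<^sup>2 = n\<^sup>2 * v" "u + v = 1"
  obtains s where "x = m * cos s" "y = n * sin s"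
proof -
  have "(x / m)\<^sup>2 + (y / n)\<^sup>2 = 1" using assms by (simp add: power_divide)
  then obtain s where "x / m = cos s" "y / n = sin s" using sincos_total_2pi by metis
  then show thesis using assms by (intro that[of s]) (auto simp: field_simps)
qed

section \<open>Leaves as images of explicit curves\<close>

context quadric
begin

text \<open>The extra factor A - B in the first two constants comes from \<open>w1_eq\<close>. For
  \<open>c2\<close> there is no such factor, and for \<open>c3\<close> the last two constants carry
  C - D.\<close>

lemma ellipsoidal_c1:
  assumes "n2 \<le> - C" "- C \<le> n3" "n3 \<le> - D"
    and "m1\<^sup>2 = XX * ((A - n2) * (A - n3)) * (A - B)" "m2\<^sup>2 = YY * ((B - n2) * (B - n3)) * (A - B)"
    "m3\<^sup>2 = ZZ * ((- C - n2) * (C + n3))" "m4\<^sup>2 = TT * ((- D - n2) * (- D - n3))"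
  shows "ellipsoidal (c1 m1 m2 m3 m4 s) (w1 s) n2 n3"
  unfolding ellipsoidal_def c1_def vector_4 w1_eq power_mult_distrib assms(4-7)
  using assms(1-3) w1_range[of s] by (simp add: algebra_simps)

lemma ellipsoidal_c2:
  assumes "B \<le> n1" "n1 \<le> A" "- C \<le> n3" "n3 \<le> - D"
    and "m1\<^sup>2 = XX * ((A - n1) * (A - n3))" "m2\<^sup>2 = YY * ((n1 - B) * (B - n3))"
    "m3\<^sup>2 = ZZ * ((C + n1) * (C + n3))" "m4\<^sup>2 = TT * ((D + n1) * (- D - n3))"
  shows "ellipsoidal (c2 m1 m2 m3 m4 s) n1 (w2 s) n3"
proof -
  have s2: "s\<^sup>2 = - C - w2 s" by (simp add: w2_def)
  show ?thesis
    unfolding s2 ellipsoidal_def c2_def vector_4 power_mult_distrib assms(5-8)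
    using assms(1-4) w2_range[of s] by (simp add: algebra_simps)
qed

lemma ellipsoidal_c3:
  assumes "B \<le> n1" "n1 \<le> A" "n2 \<le> - C"
    and "m1\<^sup>2 = XX * ((A - n1) * (A - n2))" "m2\<^sup>2 = YY * ((n1 - B) * (B - n2))"
    "m3\<^sup>2 = ZZ * ((C + n1) * (- C - n2)) * (C - D)" "m4\<^sup>2 = TT * ((D + n1) * (- D - n2)) * (C - D)"
  shows "ellipsoidal (c3 m1 m2 m3 m4 s) n1 n2 (w3 s)"
  unfolding ellipsoidal_def c3_def vector_4 w3_eq power_mult_distrib assms(4-7)
  using assms(1-3) w3_range[of s] by (simp add: algebra_simps)

text \<open>By the fact \<open>hit\<close>, the conserved coordinates together with the constants
  \<open>m3\<close> and \<open>m4\<close> force a point onto the curve; with conservation this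
  bounds the leaf from above. Conversely the curve is itself an integral curve through
  \<open>p\<close>.\<close>

lemma leaf_1:
  assumes p: "p \<in> M"
  obtains m1 m2 m3 m4 where "leaf_through M N 1 p = range (c1 m1 m2 m3 m4)"
proof -
  define n2 n3 where "n2 = nu2 p" and "n3 = nu3 p"
  have rg: "n2 \<le> - C" "- C \<le> n3" "n3 \<le> - D" using nu_range[OF p] by (auto simp: n2_def n3_def)
  have pos': "A - n2 > 0" "A - n3 > 0" "B - n2 > 0" "B - n3 > 0" using rg AB CD by auto
  \<comment> \<open>\<open>m1\<close> and \<open>m2\<close> can be taken positive, since cosine and
    sine supply both signs; \<open>m3\<close> and \<open>m4\<close> have to carry the signs of
    \<open>p\<close>, because the square roots next to them stay positive.\<close>
  define m1 m2 m3 m4 where "m1 = sqrt (XX * ((A - n2) * (A - n3)) * (A - B))"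
    and "m2 = sqrt (YY * ((B - n2) * (B - n3)) * (A - B))"
    and "m3 = p $ 3 / sqrt (C + nu1 p)" and "m4 = p $ 4 / sqrt (D + nu1 p)"
  have cpos: "C + nu1 q > 0" "D + nu1 q > 0" if "q \<in> M" for q
    using nu_range[OF that] CD by auto
  have m: "m1\<^sup>2 = XX * ((A - n2) * (A - n3)) * (A - B)" "m2\<^sup>2 = YY * ((B - n2) * (B - n3)) * (A - B)"
    "m3\<^sup>2 = ZZ * ((- C - n2) * (C + n3))" "m4\<^sup>2 = TT * ((- D - n2) * (- D - n3))"
    and mp: "m1 > 0" "m2 > 0"
    using coeff_pos pos' AB cpos[OF p] nu_coords[OF p]
    by (auto simp: m1_def m2_def m3_def m4_def n2_def n3_def power_divide)
  let ?c = "c1 m1 m2 m3 m4"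
  have ell: "ellipsoidal (?c s) (w1 s) n2 n3" for s by (rule ellipsoidal_c1[OF rg m])
  have hit: "q \<in> range ?c" if q: "q \<in> M" "nu2 q = n2" "nu3 q = n3"
    and q34: "q $ 3 = m3 * sqrt (C + nu1 q)" "q $ 4 = m4 * sqrt (D + nu1 q)" for q
  proof -
    have q12: "(q $ 1)\<^sup>2 = m1\<^sup>2 * ((A - nu1 q) / (A - B))" "(q $ 2)\<^sup>2 = m2\<^sup>2 * ((nu1 q - B) / (A - B))"
      using nu_coords[OF q(1)] AB unfolding q m by simp_all
    obtain s where s: "q $ 1 = m1 * cos s" "q $ 2 = m2 * sin s"
      by (rule on_circle[OF mp q12]) (use AB in \<open>simp add: add_divide_distrib[symmetric]\<close>)
    have "(sin s)\<^sup>2 = (nu1 q - B) / (A - B)"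
    proof -
      have "m2\<^sup>2 * (sin s)\<^sup>2 = m2\<^sup>2 * ((nu1 q - B) / (A - B))"
        using q12(2) unfolding s power_mult_distrib .
      then show ?thesis using mp by (simp only: mult_cancel_left) simp
    qed
    then have "nu1 q = w1 s" using AB by (simp add: w1_def field_simps)
    then have "q = ?c s" using s q34 by (simp add: vec_eq_4 c1_def vector_4)
    then show ?thesis by simp
  qed
  have "p \<in> range ?c"
    by (rule hit[OF p]) (use cpos[OF p] in \<open>auto simp: n2_def n3_def m3_def m4_def\<close>)
  then obtain s0 where s0: "p = ?c s0" by blast
  have "leaf_through M N 1 p = range ?c"
  proof (intro subset_antisym subsetI)
    fix q assume "q \<in> leaf_through M N 1 p"
    then obtain \<gamma> \<alpha> \<beta> t0 t1 where g: "integral_curve M N 1 \<gamma> \<alpha> \<beta>"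
      and t: "t0 \<in> {\<alpha><..<\<beta>}" "t1 \<in> {\<alpha><..<\<beta>}" and pq: "\<gamma> t0 = p" "\<gamma> t1 = q"
      by (rule leaf_throughD)
    have i: "(1 :: nat) \<in> {1, 2, 3}" by simp
    have gM: "\<gamma> u \<in> M" if "u \<in> {\<alpha><..<\<beta>}" for u using integral_curve_dom[OF i g that] by blast
    have n: "nu2 (\<gamma> u) = n2" "nu3 (\<gamma> u) = n3" if "u \<in> {\<alpha><..<\<beta>}" for u
      using nu_conserved(2,3)[OF i g t(1) that] pq by (auto simp: n2_def n3_def)
    have "\<gamma> t1 $ 3 = \<gamma> t0 $ 3 / sqrt (C + nu1 (\<gamma> t0)) * sqrt (C + nu1 (\<gamma> t1))"
      by (rule component_along[OF i g t, where K="ZZ * ((- C - n2) * (C + n3))"])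
        (use nu_coords(3)[OF gM] n cpos[OF gM] in auto)
    moreover have "\<gamma> t1 $ 4 = \<gamma> t0 $ 4 / sqrt (D + nu1 (\<gamma> t0)) * sqrt (D + nu1 (\<gamma> t1))"
      by (rule component_along[OF i g t, where K="TT * ((- D - n2) * (- D - n3))"])
        (use nu_coords(4)[OF gM] n cpos[OF gM] in auto)
    ultimately show "q \<in> range ?c"
      using gM[OF t(2)] n[OF t(2)] unfolding pq by (intro hit) (auto simp: m3_def m4_def)
  next
    fix q assume "q \<in> range ?c"
    then obtain s1 where s1: "q = ?c s1" by blast
    show "q \<in> leaf_through M N 1 p" unfolding s0 s1
    proof (rule leaf_throughI(2)[OF _ open_UNIV is_interval_univ c1_deriv(1)])
      fix s :: real
      show "?c s \<in> dom 1" using ellipsoidal_M[OF ell[of s]] by (simp add: dom_def)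
      have "m1 * sin s \<noteq> 0 \<or> m2 * cos s \<noteq> 0" using mp sin_zero_norm_cos_one[of s] by auto
      then show "d1 m1 m2 m3 m4 s \<noteq> 0"
        by (auto simp: vec_eq_4 vector_4 d1_def)
      have nu: "nu 1 (?c s) = w1 s" using nu_eqI[OF ell[of s]] by (simp add: nu_def)
      show "(A - nu 1 (?c s)) * d1 m1 m2 m3 m4 s $ 1 = l1 s * ?c s $ 1 \<and>
        (B - nu 1 (?c s)) * d1 m1 m2 m3 m4 s $ 2 = l1 s * ?c s $ 2 \<and>
        (- C - nu 1 (?c s)) * d1 m1 m2 m3 m4 s $ 3 = l1 s * ?c s $ 3 \<and>
        (- D - nu 1 (?c s)) * d1 m1 m2 m3 m4 s $ 4 = l1 s * ?c s $ 4"
        unfolding nu by (intro conjI c1_deriv(3-6))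
    qed (auto intro: c1_deriv)
  qed
  then show thesis by (rule that)
qed

text \<open>If \<open>nu3 p > - C\<close>, the third entry is a nonzero multiple of s and s runs
  over the line. If \<open>nu3 p = - C\<close>, then \<open>m3 = 0\<close> and the curve is even in
  s; at \<open>s = 0\<close> the coordinate \<open>w2\<close> reaches - C and the point is partially
  umbilic, so the leaf is the image of a half-line.\<close>

lemma leaf_2:
  assumes p: "p \<in> dom 2"
  obtains m1 m2 m3 m4 J where "leaf_through M N 2 p = c2 m1 m2 m3 m4 ` J"
    "m3 \<noteq> 0 \<and> J = UNIV \<or> m3 = 0 \<and> m4 \<noteq> 0 \<and> J = {0<..}"
proof -
  have pM: "p \<in> M" and p23: "nu2 p < nu3 p" using p by (auto simp: dom_def)
  define n1 n3 where "n1 = nu1 p" and "n3 = nu3 p"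
  have rg: "B \<le> n1" "n1 \<le> A" "- C \<le> n3" "n3 \<le> - D" using nu_range[OF pM] by (auto simp: n1_def n3_def)
  have cpos: "A - nu2 q > 0" "B - nu2 q > 0" "- D - nu2 q > 0" if "q \<in> M" for q
    using nu_range[OF that] AB CD by auto
  define m1 m2 m3 m4 where "m1 = p $ 1 / sqrt (A - nu2 p)"
    and "m2 = p $ 2 / sqrt (B - nu2 p)"
    and "m3 = sqrt (ZZ * ((C + n1) * (C + n3)))" and "m4 = p $ 4 / sqrt (- D - nu2 p)"
  have m: "m1\<^sup>2 = XX * ((A - n1) * (A - n3))" "m2\<^sup>2 = YY * ((n1 - B) * (B - n3))"
    "m3\<^sup>2 = ZZ * ((C + n1) * (C + n3))" "m4\<^sup>2 = TT * ((D + n1) * (- D - n3))"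
    using coeff_pos AB CD rg cpos[OF pM] nu_coords[OF pM]
    by (auto simp: m1_def m2_def m3_def m4_def n1_def n3_def power_divide)
  define J where "J = (if n3 = - C then {0<..} else (UNIV :: real set))"
  have m3: "m3 = 0 \<longleftrightarrow> n3 = - C" "m3 \<ge> 0"
    using coeff_pos rg AB CD by (auto simp: m3_def)
  have m4: "m4 \<noteq> 0" if "n3 = - C"
  proof -
    have "m4\<^sup>2 > 0" unfolding m using coeff_pos rg AB CD that by simp
    then show ?thesis by auto
  qed
  let ?c = "c2 m1 m2 m3 m4" and ?d = "d2 m1 m2 m3 m4"
  have ell: "ellipsoidal (?c s) n1 (w2 s) n3" for s by (rule ellipsoidal_c2[OF rg m])
  have hit: "q \<in> ?c ` J" if q: "q \<in> dom 2" "nu1 q = n1" "nu3 q = n3"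
    and q124: "q $ 1 = m1 * sqrt (A - nu2 q)" "q $ 2 = m2 * sqrt (B - nu2 q)"
      "q $ 4 = m4 * sqrt (- D - nu2 q)" for q
  proof -
    have qM: "q \<in> M" and q23: "nu2 q < n3" using q by (auto simp: dom_def)
    have q3: "(q $ 3)\<^sup>2 = m3\<^sup>2 * (- C - nu2 q)" using nu_coords(3)[OF qM] unfolding q m by simp
    \<comment> \<open>With \<open>m3 = 0\<close> the third entry carries no information, and s is
      recovered from \<open>nu2 q\<close> as the positive root.\<close>
    define s where "s = (if n3 = - C then sqrt (- C - nu2 q) else q $ 3 / m3)"
    have s2: "s\<^sup>2 = - C - nu2 q"
      using nu_range(3)[OF qM] q3 m3 by (auto simp: s_def power_divide)
    then have "nu2 q = w2 s" by (simp add: w2_def)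
    moreover have "q $ 3 = m3 * s" using m3 q3 by (auto simp: s_def)
    ultimately have "q = ?c s" using q124 by (simp add: vec_eq_4 c2_def vector_4)
    moreover have "s \<in> J" using q23 by (auto simp: J_def s_def)
    ultimately show ?thesis by blast
  qed
  have "p \<in> ?c ` J"
    by (rule hit[OF p]) (use cpos[OF pM] in \<open>auto simp: n1_def n3_def m1_def m2_def m4_def\<close>)
  then obtain s0 where s0: "p = ?c s0" "s0 \<in> J" by blast
  have J: "open J" "is_interval J" by (auto simp: J_def is_interval_univ is_interval_io)
  have "leaf_through M N 2 p = ?c ` J"
  proof (intro subset_antisym subsetI)
    fix q assume "q \<in> leaf_through M N 2 p"
    then obtain \<gamma> \<alpha> \<beta> t0 t1 where g: "integral_curve M N 2 \<gamma> \<alpha> \<beta>"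
      and t: "t0 \<in> {\<alpha><..<\<beta>}" "t1 \<in> {\<alpha><..<\<beta>}" and pq: "\<gamma> t0 = p" "\<gamma> t1 = q"
      by (rule leaf_throughD)
    have i: "(2 :: nat) \<in> {1, 2, 3}" by simp
    have gM: "\<gamma> u \<in> M" "\<gamma> u \<in> dom 2" if "u \<in> {\<alpha><..<\<beta>}" for u
      using integral_curve_dom[OF i g that] by blast+
    have n: "nu1 (\<gamma> u) = n1" "nu3 (\<gamma> u) = n3" if "u \<in> {\<alpha><..<\<beta>}" for u
      using nu_conserved(1,3)[OF i g t(1) that] pq by (auto simp: n1_def n3_def)
    have "\<gamma> t1 $ 1 = \<gamma> t0 $ 1 / sqrt (A - nu2 (\<gamma> t0)) * sqrt (A - nu2 (\<gamma> t1))"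
      by (rule component_along[OF i g t, where K="XX * ((A - n1) * (A - n3))"])
        (use nu_coords(1)[OF gM(1)] n cpos[OF gM(1)] in auto)
    moreover have "\<gamma> t1 $ 2 = \<gamma> t0 $ 2 / sqrt (B - nu2 (\<gamma> t0)) * sqrt (B - nu2 (\<gamma> t1))"
      by (rule component_along[OF i g t, where K="YY * ((n1 - B) * (B - n3))"])
        (use nu_coords(2)[OF gM(1)] n cpos[OF gM(1)] in auto)
    moreover have "\<gamma> t1 $ 4 = \<gamma> t0 $ 4 / sqrt (- D - nu2 (\<gamma> t0)) * sqrt (- D - nu2 (\<gamma> t1))"
      by (rule component_along[OF i g t, where K="TT * ((D + n1) * (- D - n3))"])
        (use nu_coords(4)[OF gM(1)] n cpos[OF gM(1)] in auto)
    ultimately show "q \<in> ?c ` J"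
      using gM(2)[OF t(2)] n[OF t(2)] unfolding pq by (intro hit) (auto simp: m1_def m2_def m4_def)
  next
    fix q assume "q \<in> ?c ` J"
    then obtain s1 where s1: "q = ?c s1" "s1 \<in> J" by blast
    show "q \<in> leaf_through M N 2 p" unfolding s0(1) s1(1)
    proof (rule leaf_throughI(2)[OF _ J c2_deriv(1)])
      fix s :: real assume s: "s \<in> J"
      have "w2 s < n3"
      proof (cases "n3 = - C")
        case True
        then have "0 < s\<^sup>2" using s by (simp add: J_def)
        then show ?thesis using True by (simp add: w2_def)
      next
        case False
        then show ?thesis using rg w2_range(1)[of s] by simp
      qed
      then show "?c s \<in> dom 2"
        using ellipsoidal_M[OF ell[of s]] nu_eqI[OF ell[of s]] by (simp add: dom_def)
      show "?d s \<noteq> 0"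
      proof (cases "n3 = - C")
        case True
        then have "m4 * s / sqrt (- D - w2 s) \<noteq> 0" using m4 s w2_range[of s] by (simp add: J_def)
        then show ?thesis by (simp add: d2_def vec_eq_4 vector_4)
      next
        case False
        then show ?thesis using m3 by (simp add: d2_def vec_eq_4 vector_4)
      qed
      have nu: "nu 2 (?c s) = w2 s" using nu_eqI[OF ell[of s]] by (simp add: nu_def)
      show "(A - nu 2 (?c s)) * ?d s $ 1 = s * ?c s $ 1 \<and> (B - nu 2 (?c s)) * ?d s $ 2 = s * ?c s $ 2 \<and>
        (- C - nu 2 (?c s)) * ?d s $ 3 = s * ?c s $ 3 \<and> (- D - nu 2 (?c s)) * ?d s $ 4 = s * ?c s $ 4"
        unfolding nu by (intro conjI c2_deriv(3-6))
    qed (auto intro: c2_deriv s0 s1)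
  qed
  then show thesis by (rule that) (use m3 m4 in \<open>auto simp: J_def\<close>)
qed

text \<open>If \<open>nu2 p = - C\<close>, then \<open>m3 = 0\<close> and \<open>w3\<close> reaches
  - C at - pi/2 and pi/2, where the curve meets partially umbilic points; the leaf is the open arc
  between them. Otherwise the curve closes up. The further conclusions serve to identify the
  endpoints of these arcs.\<close>

lemma leaf_3:
  assumes p: "p \<in> dom 3"
  obtains m1 m2 m3 m4 J where "leaf_through M N 3 p = c3 m1 m2 m3 m4 ` J"
    "\<And>\<alpha> \<beta>. \<alpha> < \<beta> \<Longrightarrow> {\<alpha><..<\<beta>} \<subseteq> J \<Longrightarrow> integral_curve M N 3 (c3 m1 m2 m3 m4) \<alpha> \<beta>"
    "\<And>s. ellipsoidal (c3 m1 m2 m3 m4 s) (nu1 p) (nu2 p) (w3 s)" "m4 > 0" "p \<in> c3 m1 m2 m3 m4 ` J"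
    "J = (if nu2 p = - C then {- (pi / 2)<..<pi / 2} else UNIV)"
proof -
  have pM: "p \<in> M" and p23: "nu2 p < nu3 p" using p by (auto simp: dom_def)
  define n1 n2 where "n1 = nu1 p" and "n2 = nu2 p"
  have rg: "B \<le> n1" "n1 \<le> A" "n2 \<le> - C" using nu_range[OF pM] by (auto simp: n1_def n2_def)
  have cpos: "A - nu3 q > 0" "B - nu3 q > 0" if "q \<in> M" for q
    using nu_range[OF that] AB CD by auto
  define m1 m2 m3 m4 where "m1 = p $ 1 / sqrt (A - nu3 p)" and "m2 = p $ 2 / sqrt (B - nu3 p)"
    and "m3 = sqrt (ZZ * ((C + n1) * (- C - n2)) * (C - D))"
    and "m4 = sqrt (TT * ((D + n1) * (- D - n2)) * (C - D))"
  have m: "m1\<^sup>2 = XX * ((A - n1) * (A - n2))" "m2\<^sup>2 = YY * ((n1 - B) * (B - n2))"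
    "m3\<^sup>2 = ZZ * ((C + n1) * (- C - n2)) * (C - D)" "m4\<^sup>2 = TT * ((D + n1) * (- D - n2)) * (C - D)"
    using coeff_pos AB CD rg cpos[OF pM] nu_coords[OF pM]
    by (auto simp: m1_def m2_def m3_def m4_def n1_def n2_def power_divide)
  define J where "J = (if n2 = - C then {- (pi / 2)<..<pi / 2} else UNIV)"
  have m3: "m3 = 0 \<longleftrightarrow> n2 = - C" "m3 \<ge> 0" and m4: "m4 > 0"
    using coeff_pos rg AB CD by (auto simp: m3_def m4_def)
  let ?c = "c3 m1 m2 m3 m4" and ?d = "d3 m1 m2 m3 m4"
  have ell: "ellipsoidal (?c s) n1 n2 (w3 s)" for s by (rule ellipsoidal_c3[OF rg m])
  have hit: "q \<in> ?c ` J" if q: "q \<in> dom 3" "nu1 q = n1" "nu2 q = n2"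
    and q12: "q $ 1 = m1 * sqrt (A - nu3 q)" "q $ 2 = m2 * sqrt (B - nu3 q)" for q
  proof -
    have qM: "q \<in> M" and q23: "n2 < nu3 q" using q by (auto simp: dom_def)
    have q34: "(q $ 3)\<^sup>2 = m3\<^sup>2 * ((C + nu3 q) / (C - D))" "(q $ 4)\<^sup>2 = m4\<^sup>2 * ((- D - nu3 q) / (C - D))"
      using nu_coords(3,4)[OF qM] CD unfolding q m by simp_all
    have "\<exists>s\<in>J. q $ 3 = m3 * cos s \<and> q $ 4 = m4 * sin s"
    proof (cases "n2 = - C")
      case True
      \<comment> \<open>With \<open>m3 = 0\<close> the parameter comes from the fourth entry alone;
        the strict inequality \<open>n2 < nu3 q\<close> keeps the arcsine away from the
        endpoints.\<close>
      have "(q $ 4 / m4)\<^sup>2 = (- D - nu3 q) / (C - D)" using q34(2) m4 by (simp add: power_divide)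
      also have "\<dots> < 1" using CD q23 True by simp
      finally have "\<bar>q $ 4 / m4\<bar> < 1" by (simp add: abs_square_less_1)
      then have "- 1 < q $ 4 / m4" "q $ 4 / m4 < 1" unfolding abs_less_iff by linarith+
      then have "arcsin (q $ 4 / m4) \<in> J" "sin (arcsin (q $ 4 / m4)) = q $ 4 / m4"
        using True arcsin_lt_bounded by (auto simp: J_def)
      moreover have "m3 = 0" "q $ 3 = 0" using True m3 q34(1) by auto
      ultimately show ?thesis using m4 by (intro bexI[of _ "arcsin (q $ 4 / m4)"]) auto
    next
      case False
      then have "m3 > 0" using m3 by auto
      from on_circle[OF this m4 q34] obtain s where "q $ 3 = m3 * cos s" "q $ 4 = m4 * sin s"
        using CD by (auto simp: add_divide_distrib[symmetric])
      then show ?thesis using False by (auto simp: J_def)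
    qed
    then obtain s where s: "s \<in> J" "q $ 3 = m3 * cos s" "q $ 4 = m4 * sin s" by blast
    have "(sin s)\<^sup>2 = (- D - nu3 q) / (C - D)"
    proof -
      have "m4\<^sup>2 * (sin s)\<^sup>2 = m4\<^sup>2 * ((- D - nu3 q) / (C - D))"
        using q34(2) unfolding s power_mult_distrib .
      then show ?thesis using m4 by (simp only: mult_cancel_left) simp
    qed
    then have "nu3 q = w3 s" using CD by (simp add: w3_def field_simps)
    then have "q = ?c s" using s q12 by (simp add: vec_eq_4 c3_def vector_4)
    then show ?thesis using s by blast
  qed
  have "p \<in> ?c ` J"
    by (rule hit[OF p]) (use cpos[OF pM] in \<open>auto simp: n1_def n2_def m1_def m2_def\<close>)
  then obtain s0 where s0: "p = ?c s0" "s0 \<in> J" by blast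
  have J: "open J" "is_interval J" by (auto simp: J_def is_interval_univ is_interval_oo)
  have cdom: "?c s \<in> dom 3" if s: "s \<in> J" for s
  proof -
    have "n2 < w3 s"
    proof (cases "n2 = - C")
      case True
      then have "cos s > 0" using s by (auto simp: J_def intro!: cos_gt_zero_pi)
      then have "C + w3 s > 0" unfolding w3_eq using CD by simp
      then show ?thesis using True by simp
    next
      case False
      then show ?thesis using rg w3_range[of s] by simp
    qed
    then show "?c s \<in> dom 3"
      using ellipsoidal_M[OF ell[of s]] nu_eqI[OF ell[of s]] by (simp add: dom_def)
  qed
  have dnz: "?d s \<noteq> 0" if s: "s \<in> J" for s
  proof (cases "n2 = - C")
    case True
    then have "cos s > 0" using s by (auto simp: J_def intro!: cos_gt_zero_pi)
    then show ?thesis using m4 by (simp add: d3_def vec_eq_4 vector_4)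
  next
    case False
    then have "m3 * sin s \<noteq> 0 \<or> m4 * cos s \<noteq> 0" using m3 m4 sin_zero_norm_cos_one[of s] by auto
    then show ?thesis by (auto simp: d3_def vec_eq_4 vector_4)
  qed
  have eig: "(A - nu 3 (?c s)) * ?d s $ 1 = l3 s * ?c s $ 1 \<and> (B - nu 3 (?c s)) * ?d s $ 2 = l3 s * ?c s $ 2 \<and>
        (- C - nu 3 (?c s)) * ?d s $ 3 = l3 s * ?c s $ 3 \<and> (- D - nu 3 (?c s)) * ?d s $ 4 = l3 s * ?c s $ 4" for s
  proof -
    have nu: "nu 3 (?c s) = w3 s" using nu_eqI[OF ell[of s]] by (simp add: nu_def)
    show ?thesis unfolding nu by (intro conjI c3_deriv(3-6))
  qed
  have i: "(3 :: nat) \<in> {1, 2, 3}" by simp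
  note L = leaf_throughI[OF i J c3_deriv(1) c3_deriv(2) dnz cdom eig]
  have "leaf_through M N 3 p = ?c ` J"
  proof (intro subset_antisym subsetI)
    fix q assume "q \<in> leaf_through M N 3 p"
    then obtain \<gamma> \<alpha> \<beta> t0 t1 where g: "integral_curve M N 3 \<gamma> \<alpha> \<beta>"
      and t: "t0 \<in> {\<alpha><..<\<beta>}" "t1 \<in> {\<alpha><..<\<beta>}" and pq: "\<gamma> t0 = p" "\<gamma> t1 = q"
      by (rule leaf_throughD)
    have gM: "\<gamma> u \<in> M" "\<gamma> u \<in> dom 3" if "u \<in> {\<alpha><..<\<beta>}" for u
      using integral_curve_dom[OF i g that] by blast+
    have n: "nu1 (\<gamma> u) = n1" "nu2 (\<gamma> u) = n2" if "u \<in> {\<alpha><..<\<beta>}" for u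
      using nu_conserved(1,2)[OF i g t(1) that] pq by (auto simp: n1_def n2_def)
    have "\<gamma> t1 $ 1 = \<gamma> t0 $ 1 / sqrt (A - nu3 (\<gamma> t0)) * sqrt (A - nu3 (\<gamma> t1))"
      by (rule component_along[OF i g t, where K="XX * ((A - n1) * (A - n2))"])
        (use nu_coords(1)[OF gM(1)] n cpos[OF gM(1)] in auto)
    moreover have "\<gamma> t1 $ 2 = \<gamma> t0 $ 2 / sqrt (B - nu3 (\<gamma> t0)) * sqrt (B - nu3 (\<gamma> t1))"
      by (rule component_along[OF i g t, where K="YY * ((n1 - B) * (B - n2))"])
        (use nu_coords(2)[OF gM(1)] n cpos[OF gM(1)] in auto)
    ultimately show "q \<in> ?c ` J"
      using gM(2)[OF t(2)] n[OF t(2)] unfolding pq by (intro hit) (auto simp: m1_def m2_def)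
  next
    fix q assume "q \<in> ?c ` J"
    then obtain s1 where s1: "q = ?c s1" "s1 \<in> J" by blast
    show "q \<in> leaf_through M N 3 p" unfolding s0(1) s1(1) by (rule L(2)[OF _ _ s0(2) s1(2)])
  qed
  then show thesis
    using L(1)[OF _ _ s0(2) s0(2)] ell m4 s0 by (intro that) (auto simp: J_def n1_def n2_def)
qed

end

section \<open>Leaves and separatrix surface\<close>

text \<open>Such a map factors through the circle, so one closed period already has the full
  image.\<close>

lemma compact_range_circle:
  fixes c :: "real \<Rightarrow> 'a::real_normed_vector"
  assumes "\<And>s. isCont c s" "\<And>s t. sin s = sin t \<Longrightarrow> cos s = cos t \<Longrightarrow> c s = c t"
  shows "compact (range c)"
proof -
  have "range c = c ` {0..2 * pi}"
  proof (intro subset_antisym subsetI)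
    fix x assume "x \<in> range c"
    then obtain s where s: "x = c s" by blast
    obtain t where "0 \<le> t" "t < 2 * pi" "cos s = cos t" "sin s = sin t"
      using sincos_total_2pi[of "cos s" "sin s"] by auto
    then show "x \<in> c ` {0..2 * pi}" unfolding s using assms(2)[of s t] by auto
  qed auto
  moreover have "compact (c ` {0..2 * pi})"
    by (intro compact_continuous_image continuous_at_imp_continuous_on) (auto intro: assms)
  ultimately show ?thesis by simp
qed

context quadric
begin

lemma leaves_dom: "i \<in> {1, 2, 3} \<Longrightarrow> leaves M N i = leaf_through M N i ` dom i"
  by (simp add: leaves_def foliation_domain_dom)

lemma compact_leaves_1:
  assumes "L \<in> leaves M N 1"
  shows "compact L"
proof -
  obtain p where p: "p \<in> dom 1" "L = leaf_through M N 1 p" using assms by (auto simp: leaves_dom)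
  then have "p \<in> M" by (simp add: dom_def)
  then obtain m1 m2 m3 m4 where L: "L = range (c1 m1 m2 m3 m4)" using leaf_1 p(2) by metis
  show ?thesis unfolding L
  proof (rule compact_range_circle)
    show "isCont (c1 m1 m2 m3 m4) s" for s
      by (rule has_vector_derivative_continuous[OF c1_deriv(1)])
  qed (simp add: c1_def w1_def)
qed

text \<open>With \<open>m3 \<noteq> 0\<close> the third entry is a global parameter of the leaf.
  With \<open>m3 = 0\<close> the parameter domain is a half-line, which s = exp r turns into the
  line.\<close>

lemma diffeomorphic_leaves_2:
  assumes "L \<in> leaves M N 2"
  shows "diffeomorphic L (UNIV :: real set)"
proof -
  obtain p where p: "p \<in> dom 2" "L = leaf_through M N 2 p" using assms by (auto simp: leaves_dom)
  obtain m1 m2 m3 m4 J where L: "L = c2 m1 m2 m3 m4 ` J"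
    and J: "m3 \<noteq> 0 \<and> J = UNIV \<or> m3 = 0 \<and> m4 \<noteq> 0 \<and> J = {0<..}"
    using leaf_2[OF p(1)] p(2) by metis
  have sw2: "smooth_on (\<lambda>r. w2 (f r)) UNIV" if "smooth_on f UNIV" for f :: "real \<Rightarrow> real"
    unfolding w2_def by (intro smooth_on_intros that open_UNIV)
  have sc2: "smooth_on (\<lambda>r. c2 m1 m2 m3 m4 (f r)) UNIV" if "smooth_on f UNIV" for f :: "real \<Rightarrow> real"
    unfolding c2_def by (intro smooth_on_intros that open_UNIV sw2 w2_range)
  show ?thesis
  proof (cases "m3 = 0")
    case False
    show ?thesis unfolding L
    proof (rule diffeomorphicI[where f="\<lambda>q. q $ 3 / m3" and g="c2 m1 m2 m3 m4" and U=UNIV and V=UNIV])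
      show "smooth_on (\<lambda>q::real^4. q $ 3 / m3) UNIV"
        by (intro smooth_on_intros open_UNIV) (use False in auto)
      show "smooth_on (c2 m1 m2 m3 m4) UNIV" by (rule sc2) (intro smooth_on_intros open_UNIV)
    qed (use False J in \<open>auto simp: c2_def vector_4\<close>)
  next
    case True
    then have J: "J = {0<..}" "m4 \<noteq> 0" using J by auto
    \<comment> \<open>On the curve the fourth entry is m4 sqrt (s^2 + C - D), so this polynomial
      recovers s^2, and half of its logarithm is ln s.\<close>
    let ?u = "\<lambda>q::real^4. (q $ 4 / m4)\<^sup>2 - (C - D)"
    let ?f = "\<lambda>q. ln (?u q) / 2" and ?g = "\<lambda>r. c2 m1 m2 m3 m4 (exp r)"
    have u: "?u (c2 m1 m2 m3 m4 s) = s\<^sup>2" for s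
    proof -
      have "(c2 m1 m2 m3 m4 s $ 4 / m4)\<^sup>2 = (sqrt (- D - w2 s))\<^sup>2" using J(2) by (simp add: c2_def vector_4)
      also have "\<dots> = - D - w2 s" using w2_range(4)[of s] by simp
      finally show ?thesis by (simp add: w2_def)
    qed
    have op: "open {q. ?u q > 0}"
      by (intro open_Collect_less continuous_intros) (use J in auto)
    have f: "?f (c2 m1 m2 m3 m4 s) = ln s" if "s > 0" for s
      unfolding u using that by (simp add: ln_realpow)
    show ?thesis unfolding L
    proof (rule diffeomorphicI[where f="?f" and g="?g" and U="{q. ?u q > 0}" and V=UNIV])
      show "smooth_on ?f {q. ?u q > 0}"
        by (intro smooth_on_intros op) (use J in auto)
      show "smooth_on ?g UNIV" by (rule sc2) (intro smooth_on_intros open_UNIV)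
      show "c2 m1 m2 m3 m4 ` J \<subseteq> {q. ?u q > 0}"
      proof
        fix q assume "q \<in> c2 m1 m2 m3 m4 ` J"
        then obtain s where s: "q = c2 m1 m2 m3 m4 s" "s > 0" by (auto simp: J)
        show "q \<in> {q. ?u q > 0}" unfolding mem_Collect_eq s(1) u using s(2) by simp
      qed
      fix q assume "q \<in> c2 m1 m2 m3 m4 ` J"
      then show "?f q \<in> UNIV \<and> ?g (?f q) = q" using f by (auto simp: J)
    next
      fix r :: real
      show "?g r \<in> c2 m1 m2 m3 m4 ` J \<and> ?f (?g r) = r" using f[of "exp r"] by (auto simp: J)
    qed (use op in auto)
  qed
qed

text \<open>In the parameters u = p1 / sqrt A and v = p2 / sqrt B this is the quadratic form in the
  equation of the partially umbilic set.\<close>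

definition pu_form :: "real^4 \<Rightarrow> real" where
  "pu_form p = (A + D) / (A + C) * ((p $ 1)\<^sup>2 / A) + (B + D) / (B + C) * ((p $ 2)\<^sup>2 / B)"

text \<open>Where the third entry vanishes, one of \<open>nu2\<close>, \<open>nu3\<close> is - C.
  With m the other one, comparing \<open>pu_form p\<close> with 1 decides on which side of - C the
  value m lies. The positive factor is a weighted mean of 1 / (A + C) and 1 / (B + C) with weights
  depending on \<open>nu1\<close>.\<close>

lemma pu_form_nu:
  assumes p: "p \<in> M" and n: "nu2 p = - C \<and> m = nu3 p \<or> nu3 p = - C \<and> m = nu2 p"
  obtains K where "K > 0" "pu_form p = 1 - (m + C) * K"
proof -
  define n1 where "n1 = nu1 p"
  define K where "K = ((A - n1) / (A + C) + (n1 - B) / (B + C)) / (A - B)"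
  have rg: "B \<le> n1" "n1 \<le> A" using nu_range[OF p] by (auto simp: n1_def)
  have "(A - n1) / (A + C) + (n1 - B) / (B + C) > 0"
  proof (cases "n1 = A")
    case True
    then show ?thesis using AB CD by simp
  next
    case False
    then show ?thesis using rg AB CD by (intro add_pos_nonneg) auto
  qed
  then have K: "K > 0" using AB by (simp add: K_def)
  have x: "(p $ 1)\<^sup>2 = XX * ((A - n1) * (A + C) * (A - m))"
    and y: "(p $ 2)\<^sup>2 = YY * ((n1 - B) * (B + C) * (B - m))"
    using nu_coords(1,2)[OF p] n by (auto simp: n1_def)
  have "(A + D) / (A + C) * ((p $ 1)\<^sup>2 / A) = (A - n1) * (A - m) / ((A - B) * (A + C))"
    unfolding x XX_def using AB CD by (simp add: divide_simps)
  moreover have "(B + D) / (B + C) * ((p $ 2)\<^sup>2 / B) = (n1 - B) * (B - m) / ((A - B) * (B + C))"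
    unfolding y YY_def using AB CD by (simp add: divide_simps)
  moreover have "(A - n1) * (A - m) / ((A - B) * (A + C)) + (n1 - B) * (B - m) / ((A - B) * (B + C))
      = 1 - (m + C) * K"
    unfolding K_def using AB CD by (simp add: divide_simps) algebra
  ultimately have "pu_form p = 1 - (m + C) * K" by (simp add: pu_form_def)
  with K show thesis by (rule that)
qed

text \<open>Conditions in the entries of the point suit closures and charts; \<open>mem_W\<close>
  translates them into ellipsoidal coordinates. The sign \<sigma> of the fourth entry tells the two
  partially umbilic curves apart.\<close>

definition W :: "(real^4) set" where "W = {p \<in> M. p $ 3 = 0 \<and> pu_form p < 1}"
definition P :: "real \<Rightarrow> (real^4) set" where "P \<sigma> = {p \<in> M. p $ 3 = 0 \<and> pu_form p = 1 \<and> \<sigma> * p $ 4 > 0}"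

lemma z_zero_iff: "p \<in> M \<Longrightarrow> p $ 3 = 0 \<longleftrightarrow> nu2 p = - C \<or> nu3 p = - C"
  using nu_coords(3)[of p] nu_range[of p] coeff_pos CD by auto

lemma pu_form_cases:
  assumes p: "p \<in> M"
  shows "p $ 3 = 0 \<and> pu_form p < 1 \<longleftrightarrow> nu2 p = - C \<and> - C < nu3 p"
    and "p $ 3 = 0 \<and> pu_form p = 1 \<longleftrightarrow> nu2 p = nu3 p"
proof -
  note rg = nu_range[OF p]
  have 2: "pu_form p < 1 \<longleftrightarrow> - C < nu3 p" "pu_form p = 1 \<longleftrightarrow> nu3 p = - C" if n: "nu2 p = - C"
  proof -
    obtain K where "K > 0" "pu_form p = 1 - (nu3 p + C) * K" using pu_form_nu[OF p, of "nu3 p"] n by blast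
    then show "pu_form p < 1 \<longleftrightarrow> - C < nu3 p" "pu_form p = 1 \<longleftrightarrow> nu3 p = - C"
      by (auto simp: zero_less_mult_iff)
  qed
  have 3: "\<not> pu_form p < 1" "pu_form p = 1 \<longleftrightarrow> nu2 p = - C" if n: "nu3 p = - C"
  proof -
    obtain K where "K > 0" "pu_form p = 1 - (nu2 p + C) * K" using pu_form_nu[OF p, of "nu2 p"] n by blast
    then show "\<not> pu_form p < 1" "pu_form p = 1 \<longleftrightarrow> nu2 p = - C"
      using rg(3) by (auto simp: zero_less_mult_iff)
  qed
  show "p $ 3 = 0 \<and> pu_form p < 1 \<longleftrightarrow> nu2 p = - C \<and> - C < nu3 p"
    using 2(1) 3(1) rg(3,4) unfolding z_zero_iff[OF p] by (cases "nu2 p = - C"; cases "nu3 p = - C") simp_all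
  show "p $ 3 = 0 \<and> pu_form p = 1 \<longleftrightarrow> nu2 p = nu3 p"
    using 2(2) 3(2) rg(3,4) unfolding z_zero_iff[OF p] by (cases "nu2 p = - C"; cases "nu3 p = - C") simp_all
qed

lemma mem_W: "p \<in> W \<longleftrightarrow> p \<in> M \<and> nu2 p = - C \<and> - C < nu3 p"
  using pu_form_cases(1) by (auto simp: W_def)

lemma W_dom: "W = {p \<in> dom 3. nu2 p = - C}"
  by (auto simp: mem_W dom_def)

lemma P_nu: "p \<in> P \<sigma> \<Longrightarrow> nu2 p = - C \<and> nu3 p = - C"
  using pu_form_cases(2)[of p] nu_range[of p] by (auto simp: P_def)

lemma P_notin_dom: "p \<in> P \<sigma> \<Longrightarrow> p \<notin> dom 3"
  using P_nu by (fastforce simp: dom_def)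

lemma part_umb_23_M: "part_umb_23 M N = {p \<in> M. p $ 3 = 0 \<and> pu_form p = 1}"
proof -
  have "p \<in> part_umb_23 M N \<longleftrightarrow> p $ 3 = 0 \<and> pu_form p = 1" if "p \<in> M" for p
    using umbilic_cases(3)[OF ellipsoidal_nu[OF that]] pu_form_cases(2)[OF that] by simp
  moreover have "part_umb_23 M N \<subseteq> M" by (auto simp: part_umb_23_def)
  ultimately show ?thesis by blast
qed

lemma part_umb_set_M: "part_umb_set M N = {p \<in> M. p $ 3 = 0 \<and> pu_form p = 1}"
  by (simp add: part_umb_set_def part_umb_12_empty part_umb_23_M)

text \<open>At a partially umbilic point the square of the fourth entry is TT (D + nu1) (C - D)^2 >
  0, so the two signs split the set into two disjoint pieces.\<close>

lemma part_umb_set_P: "part_umb_set M N = P 1 \<union> P (- 1)" "P 1 \<inter> P (- 1) = {}"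
proof -
  have "p $ 4 \<noteq> 0" if "p \<in> M" "p $ 3 = 0" "pu_form p = 1" for p
  proof -
    have n: "nu2 p = - C" "nu3 p = - C"
      using pu_form_cases(2)[OF that(1)] nu_range[OF that(1)] that(2,3) by auto
    have "(p $ 4)\<^sup>2 > 0" unfolding nu_coords(4)[OF that(1)] n
      using coeff_pos nu_range[OF that(1)] CD by simp
    then show ?thesis by auto
  qed
  then show "part_umb_set M N = P 1 \<union> P (- 1)"
    unfolding part_umb_set_M P_def by (auto simp: linorder_neq_iff)
  show "P 1 \<inter> P (- 1) = {}" by (auto simp: P_def)
qed

lemma leaf_through_same:
  assumes i: "i \<in> {1, 2, 3}" and q: "q \<in> leaf_through M N i p"
  shows "q \<in> dom i" "i \<noteq> 2 \<Longrightarrow> nu2 q = nu2 p"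
proof -
  obtain \<gamma> \<alpha> \<beta> t0 t1 where g: "integral_curve M N i \<gamma> \<alpha> \<beta>"
    and t: "t0 \<in> {\<alpha><..<\<beta>}" "t1 \<in> {\<alpha><..<\<beta>}" and pq: "\<gamma> t0 = p" "\<gamma> t1 = q"
    using leaf_throughD[OF q] by metis
  show "q \<in> dom i" using integral_curve_dom(1)[OF i g t(2)] pq by simp
  show "nu2 q = nu2 p" if "i \<noteq> 2" using nu_conserved(2)[OF i g t that] pq by simp
qed

lemma compact_leaf_3:
  assumes p: "p \<in> dom 3" and n: "nu2 p \<noteq> - C"
  shows "compact (leaf_through M N 3 p)"
proof -
  obtain m1 m2 m3 m4 J where L: "leaf_through M N 3 p = c3 m1 m2 m3 m4 ` J"
    "J = (if nu2 p = - C then {- (pi / 2)<..<pi / 2} else UNIV)"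
    using leaf_3[OF p] by metis
  have "compact (range (c3 m1 m2 m3 m4))"
  proof (rule compact_range_circle)
    show "isCont (c3 m1 m2 m3 m4) s" for s
      by (rule has_vector_derivative_continuous[OF c3_deriv(1)])
  qed (simp add: c3_def w3_def)
  then show ?thesis using L n by simp
qed

lemma compact_leaves_3:
  assumes "L \<in> leaves M N 3" "L \<inter> W = {}"
  shows "compact L"
proof -
  obtain p where p: "p \<in> dom 3" "L = leaf_through M N 3 p" using assms by (auto simp: leaves_dom)
  have "p \<in> L" using leaf_3[OF p(1)] p(2) by metis
  then have "nu2 p \<noteq> - C" using assms(2) p(1) by (auto simp: W_dom)
  then show ?thesis using compact_leaf_3 p by simp
qed

text \<open>A leaf off \<open>W\<close> is compact, so a limiting endpoint would lie on it, yet
  partially umbilic points are outside the domain. A leaf in \<open>W\<close> is an open arc whose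
  continuation has fourth entry \<open>m4\<close> at pi/2 and \<open>- m4\<close> at - pi/2; it thus
  joins both curves, and the separatrix surface of either curve is all of \<open>W\<close>.\<close>

lemma separatrix_surface_P:
  assumes \<sigma>: "\<sigma> \<in> {1, - 1}"
  shows "separatrix_surface M N 3 (P \<sigma>) = W"
proof (intro subset_antisym subsetI)
  have i: "(3 :: nat) \<in> {1, 2, 3}" by simp
  fix x assume "x \<in> separatrix_surface M N 3 (P \<sigma>)"
  then obtain L q where L: "L \<in> leaves M N 3" "x \<in> L" "q \<in> P \<sigma>" "limiting_endpoint M N 3 L q"
    by (auto simp: separatrix_surface_def)
  then obtain p where p: "p \<in> dom 3" "L = leaf_through M N 3 p" by (auto simp: leaves_dom)
  have "nu2 p = - C"
  proof (rule ccontr)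
    assume "nu2 p \<noteq> - C"
    then have "closed L" using compact_leaf_3[OF p(1)] p(2) compact_imp_closed by blast
    obtain \<gamma> \<alpha> \<beta> where g: "integral_curve M N 3 \<gamma> \<alpha> \<beta>" "\<gamma> ` {\<alpha><..<\<beta>} = L"
      "(\<gamma> \<longlongrightarrow> q) (at_right \<alpha>) \<or> (\<gamma> \<longlongrightarrow> q) (at_left \<beta>)"
      using L(4) by (auto simp: limiting_endpoint_def)
    have ab: "\<alpha> < \<beta>" using g(1) by (simp add: integral_curve_def)
    have "\<forall>\<^sub>F s in at_right \<alpha>. \<gamma> s \<in> L"
      using g(2) unfolding eventually_at_right_field by (intro exI[of _ \<beta>]) (use ab in auto)
    moreover have "\<forall>\<^sub>F s in at_left \<beta>. \<gamma> s \<in> L"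
      using g(2) unfolding eventually_at_left_field by (intro exI[of _ \<alpha>]) (use ab in auto)
    ultimately have "q \<in> L"
      using g(3) Lim_in_closed_set[OF \<open>closed L\<close>, of \<gamma> _ q] by auto
    then show False using leaf_through_same(1)[OF i] p(2) P_notin_dom[OF L(3)] by blast
  qed
  then show "x \<in> W"
    using leaf_through_same[OF i, of x p] L(2) p(2) by (simp add: W_dom)
next
  fix x assume x: "x \<in> W"
  then have p: "x \<in> dom 3" "nu2 x = - C" by (auto simp: W_dom)
  obtain m1 m2 m3 m4 J where L: "leaf_through M N 3 x = c3 m1 m2 m3 m4 ` J"
    and ic: "\<And>\<alpha> \<beta>. \<alpha> < \<beta> \<Longrightarrow> {\<alpha><..<\<beta>} \<subseteq> J \<Longrightarrow> integral_curve M N 3 (c3 m1 m2 m3 m4) \<alpha> \<beta>"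
    and ell: "\<And>s. ellipsoidal (c3 m1 m2 m3 m4 s) (nu1 x) (nu2 x) (w3 s)" and m4: "m4 > 0"
    and xJ: "x \<in> c3 m1 m2 m3 m4 ` J"
    and J: "J = (if nu2 x = - C then {- (pi / 2)<..<pi / 2} else UNIV)"
    using leaf_3[OF p(1)] by metis
  let ?c = "c3 m1 m2 m3 m4"
  have J: "J = {- (pi / 2)<..<pi / 2}" using J p by simp
  have ic: "integral_curve M N 3 ?c (- (pi / 2)) (pi / 2)" by (rule ic) (auto simp: J)
  have cont: "isCont ?c s" for s by (rule has_vector_derivative_continuous[OF c3_deriv(1)])
  have endpt: "?c s \<in> P \<sigma>" if "sin s = \<sigma>" "cos s = 0" for s
  proof -
    have M: "?c s \<in> M" by (rule ellipsoidal_M[OF ell])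
    have "w3 s = - C" using w3_eq(1)[of s] that by simp
    then have "nu2 (?c s) = nu3 (?c s)" using nu_eqI[OF ell[of s]] p by simp
    then have "?c s $ 3 = 0 \<and> pu_form (?c s) = 1" using pu_form_cases(2)[OF M] by simp
    moreover have "\<sigma> * ?c s $ 4 > 0" using m4 \<sigma> that by (auto simp: c3_def vector_4)
    ultimately show ?thesis using M by (simp add: P_def)
  qed
  have "\<exists>q\<in>P \<sigma>. limiting_endpoint M N 3 (?c ` J) q"
  proof (cases "\<sigma> = 1")
    case True
    have "(?c \<longlongrightarrow> ?c (pi / 2)) (at_left (pi / 2))"
      using cont[of "pi / 2"] by (simp add: isCont_def filterlim_at_split)
    then show ?thesis using ic endpt[of "pi / 2"] True unfolding limiting_endpoint_def J by auto
  next
    case False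
    have "(?c \<longlongrightarrow> ?c (- (pi / 2))) (at_right (- (pi / 2)))"
      using cont[of "- (pi / 2)"] by (simp add: isCont_def filterlim_at_split)
    then show ?thesis using ic endpt[of "- (pi / 2)"] False \<sigma> unfolding limiting_endpoint_def J by auto
  qed
  moreover have "?c ` J \<in> leaves M N 3" using L p(1) by (auto simp: leaves_dom)
  ultimately show "x \<in> separatrix_surface M N 3 (P \<sigma>)"
    using xJ unfolding separatrix_surface_def by blast
qed

lemma continuous_pu_form: "continuous_on U pu_form"
  unfolding pu_form_def by (intro continuous_intros) (use pos in auto)

lemma closure_W: "closure W \<inter> M - W = P 1 \<union> P (- 1)"
proof (intro subset_antisym subsetI)
  fix p assume p: "p \<in> closure W \<inter> M - W"
  have "closed ({p::real^4. p $ 3 = 0} \<inter> {p. pu_form p \<le> 1})"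
    by (intro closed_Int closed_Collect_eq closed_Collect_le continuous_intros continuous_pu_form)
  moreover have "W \<subseteq> {p. p $ 3 = 0} \<inter> {p. pu_form p \<le> 1}" by (auto simp: W_def)
  ultimately have "p $ 3 = 0 \<and> pu_form p \<le> 1" using p closure_minimal by blast
  then have "p $ 3 = 0" "pu_form p = 1" using p by (auto simp: W_def)
  then show "p \<in> P 1 \<union> P (- 1)" using p unfolding part_umb_set_P(1)[symmetric] part_umb_set_M by simp
next
  fix p assume p: "p \<in> P 1 \<union> P (- 1)"
  then have pM: "p \<in> M" by (auto simp: P_def)
  have n: "nu2 p = - C" "nu3 p = - C" using p P_nu by blast+
  define n1 where "n1 = nu1 p"
  have rg: "B \<le> n1" "n1 \<le> A" using nu_range[OF pM] by (auto simp: n1_def)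
  have AC: "A + C > 0" "B + C > 0" using AB CD by auto
  have p4: "(p $ 4)\<^sup>2 = TT * ((D + n1) * (C - D)) * (C - D)" "p $ 3 = 0"
    using nu_coords(3,4)[OF pM] n by (simp_all add: n1_def algebra_simps)
  have m: "(p $ 1 / sqrt (A + C))\<^sup>2 = XX * ((A - n1) * (A - (- C)))"
    "(p $ 2 / sqrt (B + C))\<^sup>2 = YY * ((n1 - B) * (B - (- C)))"
    "0\<^sup>2 = ZZ * ((C + n1) * (- C - (- C))) * (C - D)"
    "(p $ 4)\<^sup>2 = TT * ((D + n1) * (- D - (- C))) * (C - D)"
    using nu_coords(1,2)[OF pM] n AC p4 by (simp_all add: n1_def power_divide)
  \<comment> \<open>The arc in \<open>W\<close> that ends at \<open>p\<close> for s = pi/2; the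
    fourth constant may have either sign, which covers both curves.\<close>
  let ?c = "c3 (p $ 1 / sqrt (A + C)) (p $ 2 / sqrt (B + C)) 0 (p $ 4)"
  have ell: "ellipsoidal (?c s) n1 (- C) (w3 s)" for s
    by (rule ellipsoidal_c3[OF rg order_refl m])
  have "?c s \<in> W" if "- (pi / 2) < s" "s < pi / 2" for s
  proof -
    have "cos s > 0" using that by (intro cos_gt_zero_pi)
    then have "C + w3 s > 0" unfolding w3_eq using CD by simp
    then show ?thesis unfolding mem_W using nu_eqI[OF ell[of s]] ellipsoidal_M[OF ell[of s]] by simp
  qed
  then have "\<forall>\<^sub>F s in at_left (pi / 2). ?c s \<in> closure W"
    unfolding eventually_at_left_field using closure_subset[of W]
    by (intro exI[of _ "- (pi / 2)"]) auto
  moreover have "isCont ?c (pi / 2)" by (rule has_vector_derivative_continuous[OF c3_deriv(1)])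
  then have "(?c \<longlongrightarrow> ?c (pi / 2)) (at_left (pi / 2))" by (simp add: isCont_def filterlim_at_split)
  moreover have "?c (pi / 2) = p"
  proof -
    have "w3 (pi / 2) = - C" by (simp add: w3_def)
    then show ?thesis using AC p4(2) by (simp add: vec_eq_4 c3_def vector_4)
  qed
  ultimately have "p \<in> closure W" using Lim_in_closed_set[of "closure W" ?c "at_left (pi / 2)" p] by simp
  moreover have "p \<notin> W" using n by (simp add: mem_W)
  ultimately show "p \<in> closure W \<inter> M - W" using pM by blast
qed

end

section \<open>The band and the partially umbilic curves\<close>

lemma mem_sphere_pair: "(x, y) \<in> sphere 0 1 \<longleftrightarrow> x\<^sup>2 + y\<^sup>2 = 1" for x y :: real
  by (simp add: norm_Pair)

context quadric
begin

text \<open>Coefficients of \<open>pu_form\<close> once the entries are divided by the semi-axes.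
  They are below 1 because D < C, and this makes the radicand of \<open>half_width\<close>
  positive.\<close>

definition al :: real where "al = (A + D) / (A + C)"
definition be :: real where "be = (B + D) / (B + C)"

lemma al_be: "0 < al" "al < 1" "0 < be" "be < 1"
  using AB CD by (simp_all add: al_def be_def)

lemma quad_less:
  assumes "x \<noteq> 0 \<or> y \<noteq> 0"
  shows "0 < al * x\<^sup>2 + be * y\<^sup>2" "al * x\<^sup>2 + be * y\<^sup>2 < x\<^sup>2 + y\<^sup>2" "0 < x\<^sup>2 + y\<^sup>2"
proof -
  have "0 < k * x\<^sup>2 + l * y\<^sup>2" if "k > 0" "l > 0" for k l :: real
  proof (cases "x = 0")
    case True
    then show ?thesis using assms that by simp
  next
    case False
    then show ?thesis using that by (intro add_pos_nonneg) auto
  qed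
  from this[of al be] this[of "1 - al" "1 - be"] this[of 1 1]
  show "0 < al * x\<^sup>2 + be * y\<^sup>2" "al * x\<^sup>2 + be * y\<^sup>2 < x\<^sup>2 + y\<^sup>2" "0 < x\<^sup>2 + y\<^sup>2"
    using al_be by (simp_all add: algebra_simps)
qed

text \<open>On the ray of direction \<open>(x, y)\<close>, the half-width of the band in the coordinate
  \<open>t / sqrt D\<close>.\<close>

definition half_width :: "real \<Rightarrow> real \<Rightarrow> real" where
  "half_width x y = sqrt ((x\<^sup>2 + y\<^sup>2) / (al * x\<^sup>2 + be * y\<^sup>2) - 1)"

lemma half_width_arg_pos: "x \<noteq> 0 \<or> y \<noteq> 0 \<Longrightarrow> 0 < (x\<^sup>2 + y\<^sup>2) / (al * x\<^sup>2 + be * y\<^sup>2) - 1"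
  using quad_less[of x y] by simp

lemma half_width_scale: "k \<noteq> 0 \<Longrightarrow> half_width (k * x) (k * y) = half_width x y"
proof -
  assume k: "k \<noteq> 0"
  have "(k * x)\<^sup>2 + (k * y)\<^sup>2 = k\<^sup>2 * (x\<^sup>2 + y\<^sup>2)" "al * (k * x)\<^sup>2 + be * (k * y)\<^sup>2 = k\<^sup>2 * (al * x\<^sup>2 + be * y\<^sup>2)"
    by (simp_all add: power_mult_distrib algebra_simps)
  then show ?thesis using k by (simp add: half_width_def)
qed

lemma smooth_on_half_width:
  assumes "open U" "smooth_on f U" "smooth_on g U" "\<And>u. u \<in> U \<Longrightarrow> f u \<noteq> 0 \<or> g u \<noteq> 0"
  shows "smooth_on (\<lambda>u. half_width (f u) (g u)) U"
  unfolding half_width_def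
proof (intro smooth_on_intros assms)
  fix u assume "u \<in> U"
  then show "al * (f u)\<^sup>2 + be * (g u)\<^sup>2 \<noteq> 0" "0 < ((f u)\<^sup>2 + (g u)\<^sup>2) / (al * (f u)\<^sup>2 + be * (g u)\<^sup>2) - 1"
    using assms(4) quad_less[of "f u" "g u"] half_width_arg_pos[of "f u" "g u"] by auto
qed

lemma W_coords:
  "p \<in> W \<longleftrightarrow> p $ 3 = 0 \<and> (p $ 1 / sqrt A)\<^sup>2 + (p $ 2 / sqrt B)\<^sup>2 = 1 + (p $ 4 / sqrt D)\<^sup>2 \<and>
    al * (p $ 1 / sqrt A)\<^sup>2 + be * (p $ 2 / sqrt B)\<^sup>2 < 1"
  using pos by (auto simp: W_def mem_M pu_form_def al_def be_def power_divide)

lemma P_coords: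
  "p \<in> P \<sigma> \<longleftrightarrow> p $ 3 = 0 \<and> (p $ 1 / sqrt A)\<^sup>2 + (p $ 2 / sqrt B)\<^sup>2 = 1 + (p $ 4 / sqrt D)\<^sup>2 \<and>
    al * (p $ 1 / sqrt A)\<^sup>2 + be * (p $ 2 / sqrt B)\<^sup>2 = 1 \<and> \<sigma> * p $ 4 > 0"
  using pos by (auto simp: P_def mem_M pu_form_def al_def be_def power_divide)

text \<open>Write X, Y, T for the first, second and fourth entries divided by the semi-axes. On
  \<open>W\<close> one has X^2 + Y^2 = 1 + T^2, so a point is determined by the direction of (X, Y)
  and by T, and the inequality for \<open>pu_form\<close> becomes |T| < \<open>half_width\<close>.
  Rescaling T by this bound gives the diffeomorphism.\<close>

lemma open_band_W: "open_band W"
proof -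
  define X Y where "X p = p $ 1 / sqrt A" and "Y p = p $ 2 / sqrt B" for p :: "real^4"
  define r where "r p = sqrt ((X p)\<^sup>2 + (Y p)\<^sup>2)" for p
  define f where "f p = ((X p / r p, Y p / r p), (1 + (p $ 4 / sqrt D) / half_width (X p) (Y p)) / 2)" for p
  \<comment> \<open>Undoes the rescaling: 2 s - 1 maps (0,1) onto (-1,1).\<close>
  define \<tau> where "\<tau> u = (2 * snd u - 1) * half_width (fst (fst u)) (snd (fst u))" for u :: "(real \<times> real) \<times> real"
  define \<rho> where "\<rho> u = sqrt (1 + (\<tau> u)\<^sup>2)" for u
  define g where "g u = (vector [sqrt A * (\<rho> u * fst (fst u)), sqrt B * (\<rho> u * snd (fst u)), 0, sqrt D * \<tau> u] :: real^4)" for u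
  define U where "U = {p :: real^4. 0 < (X p)\<^sup>2 + (Y p)\<^sup>2}"
  define V where "V = {u :: (real \<times> real) \<times> real. 0 < (fst (fst u))\<^sup>2 + (snd (fst u))\<^sup>2}"
  have U: "open U" unfolding U_def X_def Y_def by (intro open_Collect_less continuous_intros) (use pos in auto)
  have V: "open V" unfolding V_def by (intro open_Collect_less continuous_intros)
  have nzU: "X p \<noteq> 0 \<or> Y p \<noteq> 0" if "p \<in> U" for p using that by (auto simp: U_def)
  have nzV: "fst (fst u) \<noteq> 0 \<or> snd (fst u) \<noteq> 0" if "u \<in> V" for u using that by (auto simp: V_def)
  have half_width_pos: "half_width (X p) (Y p) > 0" if "p \<in> U" for p
    using half_width_arg_pos[OF nzU[OF that]] by (simp add: half_width_def)
  have rU: "r p > 0" if "p \<in> U" for p using that by (simp add: U_def r_def)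
  have sX: "smooth_on X U" "smooth_on Y U" unfolding X_def Y_def
    by (intro smooth_on_intros U; use pos in simp)+
  have sr: "smooth_on r U" unfolding r_def
    by (intro smooth_on_intros U sX) (auto simp: U_def)
  have sf: "smooth_on f U" unfolding f_def
    by (intro smooth_on_intros smooth_on_half_width U sX sr nzU)
      (use pos half_width_pos rU in \<open>auto simp: less_imp_neq[symmetric]\<close>)
  have s\<tau>: "smooth_on \<tau> V" unfolding \<tau>_def
    by (intro smooth_on_intros smooth_on_half_width V nzV)
  have s\<rho>: "smooth_on \<rho> V" unfolding \<rho>_def
    by (intro smooth_on_intros V s\<tau> add_pos_nonneg) auto
  have sg: "smooth_on g V" unfolding g_def
    by (intro smooth_on_intros V s\<tau> s\<rho>)
  have half_width_less: "t\<^sup>2 < (half_width x y)\<^sup>2 \<longleftrightarrow> (1 + t\<^sup>2) * (al * x\<^sup>2 + be * y\<^sup>2) < x\<^sup>2 + y\<^sup>2" if "x \<noteq> 0 \<or> y \<noteq> 0" for t x y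
  proof -
    have "(half_width x y)\<^sup>2 = (x\<^sup>2 + y\<^sup>2) / (al * x\<^sup>2 + be * y\<^sup>2) - 1"
      using half_width_arg_pos[OF that] by (simp add: half_width_def)
    then have "t\<^sup>2 < (half_width x y)\<^sup>2 \<longleftrightarrow> 1 + t\<^sup>2 < (x\<^sup>2 + y\<^sup>2) / (al * x\<^sup>2 + be * y\<^sup>2)" by auto
    then show ?thesis using quad_less(1)[OF that] by (simp add: pos_less_divide_eq)
  qed
  have sq1: "0 < 1 + t\<^sup>2" for t :: real by (rule add_pos_nonneg) auto
  show ?thesis unfolding open_band_def
  proof (rule diffeomorphicI[OF U sf _ V sg])
    show WU: "W \<subseteq> U"
      by (auto simp: W_coords U_def X_def Y_def sq1)
    show "sphere (0 :: real \<times> real) 1 \<times> {0<..<1} \<subseteq> V"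
      by (auto simp: V_def norm_Pair)
  next
    fix p assume p: "p \<in> W"
    then have pU: "p \<in> U" by (auto simp: W_coords U_def X_def Y_def sq1)
    define t where "t = p $ 4 / sqrt D"
    have pw: "p $ 3 = 0" "(X p)\<^sup>2 + (Y p)\<^sup>2 = 1 + t\<^sup>2" "al * (X p)\<^sup>2 + be * (Y p)\<^sup>2 < 1"
      using p by (auto simp: W_coords X_def Y_def t_def)
    have r2: "(r p)\<^sup>2 = 1 + t\<^sup>2" unfolding r_def using pw(2) by simp
    have "(1 + t\<^sup>2) * (al * (X p)\<^sup>2 + be * (Y p)\<^sup>2) < (1 + t\<^sup>2) * 1"
      using pw(3) by (intro mult_strict_left_mono) (auto intro: add_pos_nonneg)
    then have "t\<^sup>2 < (half_width (X p) (Y p))\<^sup>2" using half_width_less[OF nzU[OF pU], of t] pw(2) by simp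
    then have "\<bar>t\<bar> < half_width (X p) (Y p)" using half_width_pos[OF pU] by (metis abs_le_square_iff abs_of_pos not_le)
    then have t: "- 1 < t / half_width (X p) (Y p)" "t / half_width (X p) (Y p) < 1"
      using half_width_pos[OF pU] by (auto simp: pos_less_divide_eq pos_divide_less_eq abs_less_iff)
    have "(X p / r p)\<^sup>2 + (Y p / r p)\<^sup>2 = ((X p)\<^sup>2 + (Y p)\<^sup>2) / (r p)\<^sup>2"
      by (simp add: power_divide add_divide_distrib)
    also have "\<dots> = 1" using r2 pw(2) sq1[of t] by simp
    finally have S: "(X p / r p)\<^sup>2 + (Y p / r p)\<^sup>2 = 1" .
    have 1: "f p \<in> sphere 0 1 \<times> {0<..<1}"
      unfolding f_def t_def[symmetric]
    proof (rule SigmaI)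
      show "(X p / r p, Y p / r p) \<in> sphere 0 1" using S unfolding mem_sphere_pair .
    qed (use t in auto)
    have "half_width (X p / r p) (Y p / r p) = half_width (X p) (Y p)"
      using half_width_scale[of "1 / r p" "X p" "Y p"] rU[OF pU] by simp
    moreover have "(2 * ((1 + t / k) / 2) - 1) * k = t" if "k > 0" for k :: real
      using that by (simp add: field_simps)
    ultimately have \<tau>: "\<tau> (f p) = t"
      using half_width_pos[OF pU] unfolding \<tau>_def f_def fst_conv snd_conv t_def[symmetric] by simp
    then have \<rho>: "\<rho> (f p) = r p" using r2 rU[OF pU] unfolding \<rho>_def \<tau> by (metis abs_of_pos real_sqrt_abs)
    have "g (f p) = p"
      unfolding g_def \<tau> \<rho> using rU[OF pU] pos pw(1)
      by (simp add: vec_eq_4 vector_4 f_def X_def Y_def t_def)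
    then show "f p \<in> sphere 0 1 \<times> {0<..<1} \<and> g (f p) = p" using 1 by blast
  next
    fix u assume u: "u \<in> sphere (0 :: real \<times> real) 1 \<times> {0<..<1::real}"
    obtain x y s where us: "u = ((x, y), s)" by (metis prod.collapse)
    have xy: "x\<^sup>2 + y\<^sup>2 = 1" and s: "0 < s" "s < 1"
      using u by (auto simp: us norm_Pair)
    have nz: "x \<noteq> 0 \<or> y \<noteq> 0" using xy by auto
    have hw0: "half_width x y > 0" using half_width_arg_pos[OF nz] by (simp add: half_width_def)
    have \<rho>0: "\<rho> u > 0" "(\<rho> u)\<^sup>2 = 1 + (\<tau> u)\<^sup>2" using sq1[of "\<tau> u"] by (simp_all add: \<rho>_def)
    have XY: "X (g u) = \<rho> u * x" "Y (g u) = \<rho> u * y" "g u $ 4 / sqrt D = \<tau> u" "g u $ 3 = 0"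
      using pos by (simp_all add: X_def Y_def g_def vector_4 us)
    have sum: "(X (g u))\<^sup>2 + (Y (g u))\<^sup>2 = (\<rho> u)\<^sup>2"
      using xy by (simp add: XY power_mult_distrib flip: distrib_left)
    have "\<bar>2 * s - 1\<bar> < 1" using s by (simp add: abs_less_iff)
    then have "(2 * s - 1)\<^sup>2 < 1" by (simp add: abs_square_less_1)
    then have "(2 * s - 1)\<^sup>2 * (half_width x y)\<^sup>2 < 1 * (half_width x y)\<^sup>2" using hw0 by (intro mult_strict_right_mono) auto
    then have "(\<tau> u)\<^sup>2 < (half_width x y)\<^sup>2" by (simp add: \<tau>_def us power_mult_distrib)
    then have "(1 + (\<tau> u)\<^sup>2) * (al * x\<^sup>2 + be * y\<^sup>2) < 1" using half_width_less[OF nz] xy by simp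
    then have "al * (X (g u))\<^sup>2 + be * (Y (g u))\<^sup>2 < 1"
      unfolding XY power_mult_distrib \<rho>0(2) by (simp add: algebra_simps)
    then have gW: "g u \<in> W"
      using XY(3,4) sum unfolding W_coords X_def Y_def \<rho>0(2) by simp
    have r: "r (g u) = \<rho> u" unfolding r_def sum using \<rho>0(1) by simp
    have "half_width (X (g u)) (Y (g u)) = half_width x y" unfolding XY using \<rho>0(1) by (intro half_width_scale) simp
    then have "f (g u) = u"
      unfolding f_def r XY using \<rho>0(1) hw0 by (simp add: us \<tau>_def)
    then show "g u \<in> W \<and> f (g u) = u" using gW by blast
  qed
qed

text \<open>Scaling the axes carries the unit circle to the ellipse al X^2 + be Y^2 = 1. As both
  coefficients are below 1, the ellipse lies outside the circle X^2 + Y^2 = 1, which keeps the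
  radicand positive and the root smooth.\<close>

lemma P_circle:
  assumes \<sigma>: "\<sigma> \<in> {1, - 1}" and u: "u\<^sup>2 + v\<^sup>2 = 1"
  defines "p \<equiv> vector [sqrt A * (u / sqrt al), sqrt B * (v / sqrt be), 0,
     \<sigma> * sqrt D * sqrt ((u / sqrt al)\<^sup>2 + (v / sqrt be)\<^sup>2 - 1)] :: real^4"
  shows "0 < (u / sqrt al)\<^sup>2 + (v / sqrt be)\<^sup>2 - 1" "p \<in> P \<sigma>"
proof -
  have "u / sqrt al \<noteq> 0 \<or> v / sqrt be \<noteq> 0" using u al_be by auto
  from quad_less(2)[OF this] show pos1: "0 < (u / sqrt al)\<^sup>2 + (v / sqrt be)\<^sup>2 - 1"
    using u al_be by (simp add: power_divide)
  show "p \<in> P \<sigma>"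
    unfolding P_coords p_def vector_4 using pos1 pos \<sigma> u al_be
    by (auto simp: power_divide power_mult_distrib zero_less_mult_iff)
qed

lemma P_eq:
  assumes p: "p \<in> P \<sigma>" and \<sigma>: "\<sigma> \<in> {1, - 1}"
  defines "u \<equiv> sqrt al * (p $ 1 / sqrt A)" and "v \<equiv> sqrt be * (p $ 2 / sqrt B)"
  shows "u\<^sup>2 + v\<^sup>2 = 1" "p = vector [sqrt A * (u / sqrt al), sqrt B * (v / sqrt be), 0,
     \<sigma> * sqrt D * sqrt ((u / sqrt al)\<^sup>2 + (v / sqrt be)\<^sup>2 - 1)]"
proof -
  have "u\<^sup>2 = al * (p $ 1 / sqrt A)\<^sup>2" "v\<^sup>2 = be * (p $ 2 / sqrt B)\<^sup>2"
    unfolding u_def v_def power_mult_distrib using al_be by simp_all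
  then show "u\<^sup>2 + v\<^sup>2 = 1" using p unfolding P_coords by simp
  have "(u / sqrt al)\<^sup>2 + (v / sqrt be)\<^sup>2 - 1 = (p $ 4 / sqrt D)\<^sup>2"
    using p al_be unfolding P_coords u_def v_def by simp
  then have "\<sigma> * sqrt D * sqrt ((u / sqrt al)\<^sup>2 + (v / sqrt be)\<^sup>2 - 1) = \<sigma> * sqrt D * \<bar>p $ 4 / sqrt D\<bar>"
    by simp
  also have "\<dots> = \<sigma> * \<bar>p $ 4\<bar>" using pos by simp
  also have "\<dots> = p $ 4" using p \<sigma> unfolding P_coords by auto
  finally show "p = vector [sqrt A * (u / sqrt al), sqrt B * (v / sqrt be), 0,
     \<sigma> * sqrt D * sqrt ((u / sqrt al)\<^sup>2 + (v / sqrt be)\<^sup>2 - 1)]"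
    using p al_be pos unfolding P_coords u_def v_def by (simp add: vec_eq_4 vector_4)
qed

lemma regular_curve_P:
  assumes \<sigma>: "\<sigma> \<in> {1, - 1}"
  shows "regular_curve (P \<sigma>)"
proof -
  define c where "c u v = (vector [sqrt A * (u / sqrt al), sqrt B * (v / sqrt be), 0,
     \<sigma> * sqrt D * sqrt ((u / sqrt al)\<^sup>2 + (v / sqrt be)\<^sup>2 - 1)] :: real^4)" for u v
  define \<xi> \<eta> where "\<xi> p = sqrt al * (p $ 1 / sqrt A)" and "\<eta> p = sqrt be * (p $ 2 / sqrt B)" for p :: "real^4"
  have cP: "c u v \<in> P \<sigma>" if "u\<^sup>2 + v\<^sup>2 = 1" for u v
    unfolding c_def by (rule P_circle(2)[OF \<sigma> that])
  have \<xi>c: "\<xi> (c u v) = u" "\<eta> (c u v) = v" for u v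
    using al_be pos by (simp_all add: \<xi>_def \<eta>_def c_def vector_4)
  have Pc: "(\<xi> p)\<^sup>2 + (\<eta> p)\<^sup>2 = 1" "c (\<xi> p) (\<eta> p) = p" if "p \<in> P \<sigma>" for p
    using P_eq[OF that \<sigma>] by (simp_all add: c_def \<xi>_def \<eta>_def)
  have im: "P \<sigma> = (\<lambda>s. c (cos s) (sin s)) ` UNIV"
  proof (intro subset_antisym subsetI)
    fix p assume p: "p \<in> P \<sigma>"
    obtain s where "\<xi> p = cos s" "\<eta> p = sin s" using sincos_total_2pi Pc(1)[OF p] by metis
    then have "p = c (cos s) (sin s)" using Pc(2)[OF p] by simp
    then show "p \<in> (\<lambda>s. c (cos s) (sin s)) ` UNIV" by (rule image_eqI) simp
  qed (use cP in auto)
  have "connected (P \<sigma>)" unfolding im c_def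
    by (intro connected_continuous_image continuous_on_vector_4 continuous_intros connected_UNIV)
      (use al_be in auto)
  moreover have "P \<sigma> \<noteq> {}" unfolding im by simp
  moreover have "\<exists>V. open V \<and> p \<in> V \<and> diffeomorphic (P \<sigma> \<inter> V) {0<..<1::real}" if p: "p \<in> P \<sigma>" for p
  proof -
    define x y where "x = \<xi> p" and "y = \<eta> p"
    have xy: "x\<^sup>2 + y\<^sup>2 = 1" using Pc(1)[OF p] by (simp add: x_def y_def)
    \<comment> \<open>In the circle coordinates this cuts out the open half circle centred at the
      image (x, y) of \<open>p\<close>.\<close>
    define V where "V = {q. 0 < \<xi> q * x + \<eta> q * y}"
    have s\<xi>: "smooth_on \<xi> UNIV" "smooth_on \<eta> UNIV" unfolding \<xi>_def \<eta>_def
      by (intro smooth_on_intros open_UNIV; use pos in simp)+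
    have V: "open V" unfolding V_def \<xi>_def \<eta>_def
      by (intro open_Collect_less continuous_intros) (use pos in auto)
    have pV: "p \<in> V" using xy by (simp add: V_def x_def y_def power2_eq_square)
    \<comment> \<open>The component orthogonal to (x, y), which runs over (-1,1) on the half circle,
      rescaled to (0,1); the component along (x, y) is recovered as the positive root
      \<open>z\<close>.\<close>
    define f where "f q = (1 + (\<eta> q * x - \<xi> q * y)) / 2" for q
    define w where "w r = 2 * r - 1" for r :: real
    define z where "z r = sqrt (1 - (w r)\<^sup>2)" for r
    define u v where "u r = z r * x - w r * y" and "v r = z r * y + w r * x" for r
    have w1: "0 < 1 - (w r)\<^sup>2" if "r \<in> {0<..<1}" for r
    proof -
      have "\<bar>w r\<bar> < 1" using that by (auto simp: w_def abs_less_iff)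
      then show ?thesis by (simp add: abs_square_less_1)
    qed
    have z: "z r > 0" "(z r)\<^sup>2 = 1 - (w r)\<^sup>2" if "r \<in> {0<..<1}" for r
      using w1[OF that] by (simp_all add: z_def)
    have uv: "(u r)\<^sup>2 + (v r)\<^sup>2 = 1" if "r \<in> {0<..<1}" for r
    proof -
      have "(u r)\<^sup>2 + (v r)\<^sup>2 = ((z r)\<^sup>2 + (w r)\<^sup>2) * (x\<^sup>2 + y\<^sup>2)" unfolding u_def v_def by algebra
      then show ?thesis using z(2)[OF that] xy by simp
    qed
    have op: "open {0<..<1::real}" by simp
    have sz: "smooth_on z {0<..<1}" unfolding z_def w_def
      by (intro smooth_on_intros op) (use w1 in \<open>simp add: w_def\<close>)
    have suv: "smooth_on u {0<..<1}" "smooth_on v {0<..<1}" unfolding u_def v_def w_def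
      by (intro smooth_on_intros op sz)+
    have "diffeomorphic (P \<sigma> \<inter> V) {0<..<1::real}"
    proof (rule diffeomorphicI[where f=f and g="\<lambda>r. c (u r) (v r)" and U=UNIV and V="{0<..<1}"])
      show "smooth_on f UNIV" unfolding f_def by (intro smooth_on_intros open_UNIV s\<xi>) auto
      show "smooth_on (\<lambda>r. c (u r) (v r)) {0<..<1}" unfolding c_def
        by (intro smooth_on_intros op suv) (use P_circle(1)[OF \<sigma> uv] al_be in auto)
    next
      fix q assume q: "q \<in> P \<sigma> \<inter> V"
      define k l where "k = \<xi> q * x + \<eta> q * y" and "l = \<eta> q * x - \<xi> q * y"
      have kl: "k\<^sup>2 + l\<^sup>2 = 1"
      proof -
        have "k\<^sup>2 + l\<^sup>2 = ((\<xi> q)\<^sup>2 + (\<eta> q)\<^sup>2) * (x\<^sup>2 + y\<^sup>2)" unfolding k_def l_def by algebra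
        then show ?thesis using Pc(1)[of q] q xy by simp
      qed
      have k: "k > 0" using q by (simp add: V_def k_def)
      have "l\<^sup>2 < 1" using kl k zero_less_power[OF k, of 2] by linarith
      then have l: "\<bar>l\<bar> < 1" by (simp add: abs_square_less_1)
      have wf: "w (f q) = l" by (simp add: w_def f_def l_def field_simps)
      have zf: "z (f q) = k"
      proof -
        have "1 - l\<^sup>2 = k\<^sup>2" using kl by simp
        then show ?thesis unfolding z_def wf using k by simp
      qed
      have "u (f q) = \<xi> q * (x\<^sup>2 + y\<^sup>2)" unfolding u_def wf zf k_def l_def by algebra
      moreover have "v (f q) = \<eta> q * (x\<^sup>2 + y\<^sup>2)" unfolding v_def wf zf k_def l_def by algebra
      ultimately have "c (u (f q)) (v (f q)) = q" using Pc(2)[of q] q xy by simp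
      then show "f q \<in> {0<..<1} \<and> c (u (f q)) (v (f q)) = q"
        using l by (simp add: f_def l_def[symmetric] abs_less_iff)
    next
      fix r :: real assume r: "r \<in> {0<..<1}"
      have "\<xi> (c (u r) (v r)) * x + \<eta> (c (u r) (v r)) * y = z r * (x\<^sup>2 + y\<^sup>2)"
        unfolding \<xi>c u_def v_def by algebra
      then have "c (u r) (v r) \<in> V" using z[OF r] xy by (simp add: V_def)
      moreover have "\<eta> (c (u r) (v r)) * x - \<xi> (c (u r) (v r)) * y = w r * (x\<^sup>2 + y\<^sup>2)"
        unfolding \<xi>c u_def v_def by algebra
      then have "f (c (u r) (v r)) = r" using xy by (simp add: f_def w_def)
      ultimately show "c (u r) (v r) \<in> P \<sigma> \<inter> V \<and> f (c (u r) (v r)) = r" using cP[OF uv[OF r]] by blast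
    qed auto
    then show ?thesis using V pV by blast
  qed
  ultimately show ?thesis unfolding regular_curve_def by blast
qed

end

section \<open>Type \<open>D\<^sub>1\<close>\<close>

lemma smooth_on_deriv:
  fixes g :: "real \<Rightarrow> real"
  assumes U: "open U" and g: "smooth_on g U"
  shows "\<And>x. x \<in> U \<Longrightarrow> (g has_real_derivative deriv g x) (at x)" "smooth_on (deriv g) U"
proof -
  have "Ck_on (Suc n) g U" for n using g unfolding smooth_on_def by blast
  then have d: "\<forall>x\<in>U. g differentiable at x" "Ck_on n (\<lambda>x. frechet_derivative g (at x) 1) U" for n
    by simp_all
  show D: "(g has_real_derivative deriv g x) (at x)" if "x \<in> U" for x
    using d(1) that by (simp add: DERIV_deriv_iff_real_differentiable)
  have "frechet_derivative g (at x) 1 = deriv g x" if "x \<in> U" for x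
    using frechet_derivative_at[OF D[OF that, unfolded has_field_derivative_def]] by (metis mult.right_neutral)
  then have "Ck_on n (deriv g) U" for n
    using Ck_on_cong[OF U _ d(2)] by metis
  then show "smooth_on (deriv g) U" by (simp add: smooth_on_def)
qed

text \<open>By the Leibniz rule only the term 3 * 2 * g'(0) survives at 0. Each further
  \<open>deriv\<close> needs equality on a neighbourhood, hence the open set.\<close>

lemma third_derivative_square_mult:
  fixes f g :: "real \<Rightarrow> real"
  assumes U: "open U" "0 \<in> U" and g: "smooth_on g U" and f: "\<And>s. s \<in> U \<Longrightarrow> f s = s\<^sup>2 * g s"
  shows "(deriv ^^ 3) f 0 = 6 * deriv g 0"
proof -
  define g1 g2 g3 where "g1 = deriv g" and "g2 = deriv g1" and "g3 = deriv g2"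
  have s1: "smooth_on g1 U" unfolding g1_def by (rule smooth_on_deriv(2)[OF U(1) g])
  have s2: "smooth_on g2 U" unfolding g2_def by (rule smooth_on_deriv(2)[OF U(1) s1])
  note d0 = smooth_on_deriv(1)[OF U(1) g, folded g1_def]
  note d1 = smooth_on_deriv(1)[OF U(1) s1, folded g2_def]
  note d2 = smooth_on_deriv(1)[OF U(1) s2, folded g3_def]
  have tr: "deriv u s = u' s" if "\<And>s. s \<in> U \<Longrightarrow> u s = v s" "\<And>s. s \<in> U \<Longrightarrow> (v has_real_derivative u' s) (at s)" "s \<in> U"
    for u v u' :: "real \<Rightarrow> real" and s
    using that U(1) by (metis DERIV_imp_deriv has_field_derivative_transform_within_open)
  have 1: "deriv f s = 2 * s * g s + s\<^sup>2 * g1 s" if "s \<in> U" for s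
    by (rule tr[OF f _ that]) (auto intro!: derivative_eq_intros d0)
  have 2: "deriv (deriv f) s = 2 * g s + 4 * s * g1 s + s\<^sup>2 * g2 s" if "s \<in> U" for s
    by (rule tr[OF 1 _ that]) (auto intro!: derivative_eq_intros d0 d1)
  have 3: "deriv (deriv (deriv f)) s = 6 * g1 s + 6 * s * g2 s + s\<^sup>2 * g3 s" if "s \<in> U" for s
    by (rule tr[OF 2 _ that]) (auto intro!: derivative_eq_intros d0 d1 d2)
  show ?thesis using 3[OF U(2)] by (simp add: numeral_3_eq_3 g1_def)
qed

text \<open>The side condition picks the root at which the derivative of the quadratic in y is
  positive. The root is written with rationalized numerator, so that the formula remains valid for
  \<alpha> = 0.\<close>

lemma quadratic_branch:
  fixes \<alpha> \<beta> q y :: real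
  assumes "\<beta> > 0" "\<beta>\<^sup>2 - \<alpha> * q > 0"
  shows "\<alpha> * y + \<beta> > 0 \<and> \<alpha> * y\<^sup>2 + 2 * \<beta> * y + q = 0 \<longleftrightarrow> y = - q / (\<beta> + sqrt (\<beta>\<^sup>2 - \<alpha> * q))"
proof -
  define s where "s = sqrt (\<beta>\<^sup>2 - \<alpha> * q)"
  have s: "s > 0" "s\<^sup>2 = \<beta>\<^sup>2 - \<alpha> * q" using assms(2) by (simp_all add: s_def)
  have bs: "\<beta> + s > 0" using assms(1) s(1) by simp
  have y: "y = - q / (\<beta> + s) \<longleftrightarrow> y * (\<beta> + s) = - q" using bs by (simp add: field_simps)
  show ?thesis unfolding s_def[symmetric] y
  proof
    assume *: "\<alpha> * y + \<beta> > 0 \<and> \<alpha> * y\<^sup>2 + 2 * \<beta> * y + q = 0"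
    then have "(\<alpha> * y + \<beta>)\<^sup>2 = s\<^sup>2" unfolding s(2) by algebra
    then have s': "s = \<alpha> * y + \<beta>" using * s(1) by (auto simp: power2_eq_iff)
    have "y * (\<beta> + s) = \<alpha> * y\<^sup>2 + 2 * \<beta> * y"
      unfolding s' by (simp add: algebra_simps power2_eq_square)
    then show "y * (\<beta> + s) = - q" using * by linarith
  next
    assume *: "y * (\<beta> + s) = - q"
    then have "(\<alpha> * y) * (\<beta> + s) = (s - \<beta>) * (\<beta> + s)" using s(2) by algebra
    then have "\<alpha> * y = s - \<beta>" using bs by simp
    then show "\<alpha> * y + \<beta> > 0 \<and> \<alpha> * y\<^sup>2 + 2 * \<beta> * y + q = 0" using * s(1) by (simp, algebra)
  qed
qed

context quadric
begin

text \<open>Over the tangent space the quadric is a quadratic equation in the height, so the graph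
  function is explicit. On the double eigenspace Am z = - (z - (z . p) Am p) / C. Hence the
  quadratic term is a multiple of the squared norm, while the linear coefficient in the height
  varies with z . p; expanding the quotient gives the cubic part.\<close>

lemma type_D1_P:
  assumes \<sigma>: "\<sigma> \<in> {1, - 1}" and p: "p \<in> P \<sigma>"
  shows "type_D1_point M N p"
proof -
  have pM: "p \<in> M" and p3: "p $ 3 = 0" using p by (auto simp: P_def)
  define n1 where "n1 = nu1 p"
  have n1: "n1 > 0" using nu_range[OF pM] by (simp add: n1_def)
  have ell: "ellipsoidal p n1 (- C) (- C)"
    using ellipsoidal_nu[OF pM] P_nu[OF p] by (simp add: n1_def)
  define G where "G = norm (Am p)"
  have G: "G > 0" using Am_nz[OF pM] by (simp add: G_def)
  define n where "n = N p"
  have n: "n = (1 / G) *\<^sub>R Am p" by (simp add: n_def N_def sgn_div_norm G_def divide_inverse)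
  have AmG: "Am p = G *\<^sub>R n" using G by (simp add: n)
  have GG: "Am p \<bullet> Am p = G\<^sup>2" by (simp add: G_def power2_norm_eq_inner)
  have nn: "n \<bullet> n = 1" unfolding n using G GG by (simp add: power2_eq_square)
  have pn: "p \<bullet> n = 1 / G" using pM G by (simp add: n M_def inner_commute)
  obtain w where w: "w \<noteq> 0" "S p w = (- C) *\<^sub>R w" "w $ 3 = 0" "w \<bullet> p = 1"
    using double_eigenvector[OF ell] by blast
  have "\<Phi> p n1 = 0" by (simp add: ellipsoidal_Phi[OF ell])
  then obtain v where v: "v \<noteq> 0" "S p v = n1 *\<^sub>R v" by (rule S_eigenvector)
  \<comment> \<open>This basis is the rotation required by the normal form: for z in the double
    eigenspace it makes z . p depend on \<open>x1\<close> only, since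
    \<open>w \<bullet> p = 1\<close> while the third axis is orthogonal to \<open>p\<close>.\<close>
  define e1 e2 e3 :: "real^4" where "e1 = (1 / norm w) *\<^sub>R w" and "e2 = axis 3 1" and "e3 = (1 / norm v) *\<^sub>R v"
  have S1: "S p e1 = (- C) *\<^sub>R e1" unfolding e1_def using w(2) linear_S[of p] by (simp add: linear_scale)
  have S2: "S p e2 = (- C) *\<^sub>R e2" using p3 by (simp add: e2_def vec_eq_4 S_nth axis_def inner_4)
  have S3: "S p e3 = n1 *\<^sub>R e3" unfolding e3_def using v(2) linear_S[of p] by (simp add: linear_scale)
  have norm1: "norm e1 = 1" "norm e2 = 1" "norm e3 = 1"
    using w(1) v(1) by (simp_all add: e1_def e2_def e3_def)
  have orth: "x \<bullet> y = 0" if "S p x = k *\<^sub>R x" "S p y = l *\<^sub>R y" "k \<noteq> l" for x y k l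
    using S_sym[of p x y] that by simp
  have e12: "e1 \<bullet> e2 = 0" using w(3) by (simp add: e1_def e2_def inner_4 axis_def)
  have e13: "e1 \<bullet> e3 = 0" "e2 \<bullet> e3 = 0" using orth[OF S1 S3] orth[OF S2 S3] n1 pos by auto
  have S0: "S p (Am p) = 0 *\<^sub>R Am p" using S_Am[OF pM] by simp
  have eA: "e1 \<bullet> Am p = 0" "e2 \<bullet> Am p = 0" "e3 \<bullet> Am p = 0"
    using orth[OF S1 S0] orth[OF S2 S0] orth[OF S3 S0] n1 pos by auto
  have ne: "e1 \<noteq> 0" "e2 \<noteq> 0" "e3 \<noteq> 0" using norm1 by auto
  have neq: "e1 \<noteq> e2" "e1 \<noteq> e3" "e2 \<noteq> e3" using e12 e13 norm1 by (auto simp: norm_eq_1)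
  have indep: "independent {e1, e2, e3}" "independent {e1, e2}"
    by (rule pairwise_orthogonal_independent;
        use e12 e13 ne in \<open>auto simp: pairwise_def orthogonal_def inner_commute\<close>)+
  have T: "tangent_space M p = {x. x \<bullet> Am p = 0}" by (rule tangent_space_M[OF pM])
  have spT: "span {e1, e2, e3} = tangent_space M p"
  proof (rule subspace_dim_equal)
    show "subspace (tangent_space M p)" unfolding T by (simp add: subspace_def inner_add_left)
    then show "span {e1, e2, e3} \<subseteq> tangent_space M p" using eA by (intro span_minimal) (auto simp: T)
    have "dim (tangent_space M p) = 3"
      unfolding T using dim_hyperplane[OF Am_nz[OF pM]] by (simp add: inner_commute)
    moreover have "dim (span {e1, e2, e3}) = 3"
      using dim_span_eq_card_independent[OF indep(1)] neq by simp
    ultimately show "dim (tangent_space M p) \<le> dim (span {e1, e2, e3})" by simp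
  qed simp
  have E: "eigenspace M N p (- 1 / (G * (- C))) = {x. S p x = (- C) *\<^sub>R x}"
    unfolding G_def by (rule eigenspace_M[OF pM]) (use pos in simp)
  have spE: "span {e1, e2} = {x. S p x = (- C) *\<^sub>R x}"
  proof (rule subspace_dim_equal)
    show "subspace {x. S p x = (- C) *\<^sub>R x}"
      using linear_S[of p] by (auto simp: subspace_def linear_0 linear_add linear_scale scaleR_right_distrib)
    then show "span {e1, e2} \<subseteq> {x. S p x = (- C) *\<^sub>R x}" using S1 S2 by (intro span_minimal) auto
    have "{i :: nat. i < 4 \<and> [n1, - C, - C, 0] ! i = - C} \<subseteq> {1, 2}"
    proof
      fix i assume i: "i \<in> {i :: nat. i < 4 \<and> [n1, - C, - C, 0] ! i = - C}"
      then have "i = 0 \<or> i = 1 \<or> i = 2 \<or> i = 3" by auto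
      then show "i \<in> {1, 2}" using i n1 pos by auto
    qed
    from card_mono[OF _ this] have "dim {x. S p x = (- C) *\<^sub>R x} \<le> 2"
      unfolding S_eigenspace_dim[OF ell] by simp
    moreover have "dim (span {e1, e2}) = 2"
      using dim_span_eq_card_independent[OF indep(2)] neq by simp
    ultimately show "dim {x. S p x = (- C) *\<^sub>R x} \<le> dim (span {e1, e2})" by simp
  qed simp

  \<comment> \<open>The point p + x + y n lies on the quadric iff \<alpha> y^2 + 2 (b x) y + Q x =
    0, by \<open>memM\<close> below; \<open>hh\<close> is the branch of solutions that vanishes at x
    = 0.\<close>
  define \<alpha> where "\<alpha> = Am n \<bullet> n"
  define b where "b x = G + Am x \<bullet> n" for x
  define Q where "Q x = Am x \<bullet> x" for x
  define hh where "hh x = - Q x / (b x + sqrt ((b x)\<^sup>2 - \<alpha> * Q x))" for x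
  define X where "X u = fst u *\<^sub>R e1 + fst (snd u) *\<^sub>R e2 + snd (snd u) *\<^sub>R e3" for u :: "real \<times> real \<times> real"
  define h where "h u = hh (X u)" for u
  define D where "D = {x. 0 < b x \<and> 0 < (b x)\<^sup>2 - \<alpha> * Q x}"
  define U where "U = {u. X u \<in> D}"
  define xr where "xr r = r - p - ((r - p) \<bullet> n) *\<^sub>R n" for r
  \<comment> \<open>The second condition excludes the other root of the quadratic over the same
    tangent vector.\<close>
  define V where "V = {r. xr r \<in> D \<and> 0 < \<alpha> * ((r - p) \<bullet> n) + b (xr r)}"
  have lin: "linear Am" by (rule linear_Am)
  have cAm: "continuous_on UNIV (\<lambda>x. Am (f x))" if "continuous_on UNIV f" for f :: "'b::euclidean_space \<Rightarrow> real^4"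
    by (rule linear_continuous_on_compose[OF that lin])
  have cb: "continuous_on UNIV (\<lambda>x. b (f x))" "continuous_on UNIV (\<lambda>x. Q (f x))"
    if "continuous_on UNIV f" for f :: "'b::euclidean_space \<Rightarrow> real^4"
    unfolding b_def Q_def by (intro continuous_intros cAm that)+
  have oD: "open {x. f x \<in> D}" if "continuous_on UNIV f" for f :: "'b::euclidean_space \<Rightarrow> real^4"
    unfolding D_def mem_Collect_eq
    by (intro open_Collect_conj open_Collect_less continuous_intros cb that)
  have cX: "continuous_on UNIV X" unfolding X_def by (intro continuous_intros)
  have oU: "open U" unfolding U_def by (rule oD[OF cX])
  have cxr: "continuous_on UNIV xr" unfolding xr_def by (intro continuous_intros)
  have oV: "open V" unfolding V_def mem_Collect_eq
    by (intro open_Collect_conj oD[unfolded mem_Collect_eq] open_Collect_less continuous_intros cb cxr)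
  have D0: "0 \<in> D" using G lin by (simp add: D_def b_def Q_def linear_0)
  have X0: "X (0, 0, 0) = 0" by (simp add: X_def)
  have U0: "(0, 0, 0) \<in> U" using D0 X0 by (simp add: U_def)
  have pV: "p \<in> V" using D0 G lin by (simp add: V_def xr_def b_def linear_0)
  have sX: "smooth_on (\<lambda>u. X u $ k) U" for k
    unfolding X_def vector_add_component vector_scaleR_component real_scaleR_def
    by (intro smooth_on_intros oU)
  have sb: "smooth_on (\<lambda>u. b (X u)) U" "smooth_on (\<lambda>u. Q (X u)) U"
    unfolding b_def Q_def inner_4 Am_nth
    by (intro smooth_on_intros oU sX; use pos in simp)+
  have sh: "smooth_on h U" unfolding h_def hh_def
  proof (intro smooth_on_intros oU sb)
    fix u assume "u \<in> U"
    then have u: "0 < b (X u)" "0 < (b (X u))\<^sup>2 - \<alpha> * Q (X u)" by (auto simp: U_def D_def)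
    show "0 < (b (X u))\<^sup>2 - \<alpha> * Q (X u)" by (rule u)
    have "0 < b (X u) + sqrt ((b (X u))\<^sup>2 - \<alpha> * Q (X u))" using u by (intro add_pos_pos) auto
    then show "b (X u) + sqrt ((b (X u))\<^sup>2 - \<alpha> * Q (X u)) \<noteq> 0" by simp
  qed
  have memM: "p + x + y *\<^sub>R n \<in> M \<longleftrightarrow> \<alpha> * y\<^sup>2 + 2 * b x * y + Q x = 0" if x: "x \<bullet> Am p = 0" for x y
  proof -
    have 1: "Am p \<bullet> p = 1" "Am p \<bullet> x = 0" "Am x \<bullet> p = 0" using pM x Am_sym[of x p]
      by (auto simp: M_def inner_commute)
    have 2: "Am p \<bullet> n = G" "Am n \<bullet> p = G"
      using Am_sym[of n p] nn unfolding AmG by (simp_all add: inner_commute)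
    have 3: "Am n \<bullet> x = Am x \<bullet> n" using Am_sym[of n x] by (simp add: inner_commute)
    have "Am (p + x + y *\<^sub>R n) \<bullet> (p + x + y *\<^sub>R n) = 1 + (\<alpha> * y\<^sup>2 + 2 * b x * y + Q x)"
      using lin by (simp add: linear_add linear_scale inner_add_left inner_add_right 1 2 3 \<alpha>_def b_def Q_def
          power2_eq_square algebra_simps)
    then show ?thesis by (simp add: M_def)
  qed
  have br: "0 < \<alpha> * y + b x \<and> \<alpha> * y\<^sup>2 + 2 * b x * y + Q x = 0 \<longleftrightarrow> y = hh x" if "x \<in> D" for x y
    unfolding hh_def using that by (intro quadratic_branch) (auto simp: D_def)
  have tX: "X u \<bullet> Am p = 0" for u by (simp add: X_def inner_add_left eA)
  have onX: "\<exists>u. x = X u" if "x \<bullet> Am p = 0" for x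
  proof -
    have "x \<in> span {e1, e2, e3}" using that unfolding spT T by simp
    then obtain k1 k2 k3 where "x - k1 *\<^sub>R e1 - k2 *\<^sub>R e2 - k3 *\<^sub>R e3 = 0"
      by (auto simp: span_breakdown_eq)
    then have "x = X (k1, k2, k3)" by (simp add: X_def algebra_simps)
    then show ?thesis by blast
  qed
  have graph: "M \<inter> V = {p + x1 *\<^sub>R e1 + x2 *\<^sub>R e2 + x3 *\<^sub>R e3 + h (x1, x2, x3) *\<^sub>R N p | x1 x2 x3.
                   (x1, x2, x3) \<in> U}"
  proof -
    have "M \<inter> V = {p + X u + h u *\<^sub>R n | u. u \<in> U}"
    proof (intro subset_antisym subsetI)
      fix r assume r: "r \<in> M \<inter> V"
      define y where "y = (r - p) \<bullet> n"
      have "xr r \<bullet> Am p = 0" unfolding xr_def AmG using nn by (simp add: inner_diff_left)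
      then obtain u where u: "xr r = X u" using onX by blast
      have req: "r = p + X u + y *\<^sub>R n" unfolding u[symmetric] xr_def y_def by simp
      have "u \<in> U" "0 < \<alpha> * y + b (X u)" using r u by (auto simp: V_def U_def y_def)
      moreover have "\<alpha> * y\<^sup>2 + 2 * b (X u) * y + Q (X u) = 0"
        using r memM[OF tX, of u y] req by simp
      ultimately have "y = h u" using br[of "X u" y] by (simp add: U_def h_def)
      then show "r \<in> {p + X u + h u *\<^sub>R n | u. u \<in> U}" using req \<open>u \<in> U\<close> by blast
    next
      fix r assume "r \<in> {p + X u + h u *\<^sub>R n | u. u \<in> U}"
      then obtain u where u: "u \<in> U" "r = p + X u + h u *\<^sub>R n" by blast
      have uD: "X u \<in> D" using u by (simp add: U_def)
      have "X u \<bullet> n = 0" using tX[of u] G by (simp add: AmG)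
      then have y: "(r - p) \<bullet> n = h u" "xr r = X u"
        using u(2) nn by (simp_all add: xr_def inner_add_left)
      have "0 < \<alpha> * h u + b (X u) \<and> \<alpha> * (h u)\<^sup>2 + 2 * b (X u) * h u + Q (X u) = 0"
        using br[OF uD, of "h u"] by (simp add: h_def)
      moreover from this have "r \<in> M" using memM[OF tX, of u "h u"] u(2) by simp
      ultimately show "r \<in> M \<inter> V" using uD unfolding V_def Int_iff mem_Collect_eq y by blast
    qed
    also have "\<dots> = {p + x1 *\<^sub>R e1 + x2 *\<^sub>R e2 + x3 *\<^sub>R e3 + h (x1, x2, x3) *\<^sub>R N p | x1 x2 x3.
                   (x1, x2, x3) \<in> U}"
      by (auto simp: X_def n_def add.assoc)
    finally show ?thesis .
  qed

  \<comment> \<open>Chosen so that \<open>Am z \<bullet> n\<close> equals G k x1 below: that product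
    is z . p times G / C, and z . p is x1 / norm w.\<close>
  define k where "k = 1 / (C * norm w)"
  have k: "k > 0" using w(1) pos by (simp add: k_def)
  \<comment> \<open>Read off from 6 g'(0) = - 3 Q0 k x1 / G with Q0 = (x1^2 + x2^2) / C; the
    coefficients of the normal form are then 3 B0, B0 and 0.\<close>
  define B0 where "B0 = - k / (C * G)"
  have third: "(deriv ^^ 3) (\<lambda>s. h (s * x1, s * x2, 0)) 0 = (3 * B0) * x1 ^ 3 + 3 * B0 * x1 * x2 ^ 2 + 0 * x2 ^ 3"
    for x1 x2
  proof -
    define z where "z = x1 *\<^sub>R e1 + x2 *\<^sub>R e2"
    define Q0 where "Q0 = (x1\<^sup>2 + x2\<^sup>2) / C"
    have Xs: "X (s * x1, s * x2, 0) = s *\<^sub>R z" for s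
      by (simp add: X_def z_def scaleR_right_distrib)
    have zA: "z \<bullet> Am p = 0" by (simp add: z_def inner_add_left eA)
    have "S p z = (- C) *\<^sub>R z" unfolding z_def using linear_S[of p] S1 S2
      by (simp add: linear_add linear_scale algebra_simps)
    then have "Dm z - (z \<bullet> p) *\<^sub>R p = (- C) *\<^sub>R z" by (simp add: S_def)
    then have "Am (Dm z - (z \<bullet> p) *\<^sub>R p) = Am ((- C) *\<^sub>R z)" by simp
    then have "z - (z \<bullet> p) *\<^sub>R Am p = (- C) *\<^sub>R Am z"
      using lin by (simp only: linear_diff linear_scale Am_Dm)
    then have "(- 1 / C) *\<^sub>R (z - (z \<bullet> p) *\<^sub>R Am p) = (- 1 / C) *\<^sub>R ((- C) *\<^sub>R Am z)" by simp
    then have Amz: "Am z = (- 1 / C) *\<^sub>R (z - (z \<bullet> p) *\<^sub>R Am p)" using pos by simp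
    have zz: "z \<bullet> z = x1\<^sup>2 + x2\<^sup>2"
      using norm1 e12 unfolding z_def norm_eq_1
      by (simp add: inner_add_left inner_add_right inner_commute power2_eq_square)
    have Qz: "Q z = - Q0"
    proof -
      have "Am p \<bullet> z = 0" using zA by (simp add: inner_commute)
      then show ?thesis using zz unfolding Q_def Amz by (simp add: inner_diff_left Q0_def)
    qed
    have zp: "z \<bullet> p = x1 / norm w"
      using w(4) p3 by (simp add: z_def e1_def e2_def inner_add_left) (simp add: inner_4 axis_def)
    have zn: "z \<bullet> n = 0" using zA G by (simp add: AmG)
    have Azn: "Am z \<bullet> n = G * k * x1"
      unfolding Amz AmG using zn nn pos by (simp add: inner_diff_left zp k_def)
    define \<beta> where "\<beta> s = G + s * (G * k * x1)" for s
    define g where "g s = Q0 / (\<beta> s + sqrt ((\<beta> s)\<^sup>2 + \<alpha> * (s\<^sup>2 * Q0)))" for s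
    define I where "I = {s. 0 < \<beta> s \<and> 0 < (\<beta> s)\<^sup>2 + \<alpha> * (s\<^sup>2 * Q0)}"
    have oI: "open I" unfolding I_def \<beta>_def
      by (intro open_Collect_conj open_Collect_less continuous_intros)
    have I0: "0 \<in> I" using G by (simp add: I_def \<beta>_def)
    have bs: "b (s *\<^sub>R z) = \<beta> s" "Q (s *\<^sub>R z) = - (s\<^sup>2 * Q0)" for s
      using lin Azn Qz by (simp_all add: b_def \<beta>_def Q_def linear_scale power2_eq_square)
    have hs: "h (s * x1, s * x2, 0) = s\<^sup>2 * g s" for s
      by (simp add: h_def hh_def Xs bs g_def)
    have s\<beta>: "smooth_on \<beta> I" unfolding \<beta>_def by (intro smooth_on_intros oI)
    have sg: "smooth_on g I" unfolding g_def
    proof (intro smooth_on_intros oI s\<beta>)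
      fix s assume s: "s \<in> I"
      then show "0 < (\<beta> s)\<^sup>2 + \<alpha> * (s\<^sup>2 * Q0)" by (simp add: I_def)
      have "0 < \<beta> s + sqrt ((\<beta> s)\<^sup>2 + \<alpha> * (s\<^sup>2 * Q0))" using s by (intro add_pos_pos) (auto simp: I_def)
      then show "\<beta> s + sqrt ((\<beta> s)\<^sup>2 + \<alpha> * (s\<^sup>2 * Q0)) \<noteq> 0" by simp
    qed
    have d\<beta>: "(\<beta> has_real_derivative G * k * x1) (at s)" for s
      unfolding \<beta>_def by (auto intro!: derivative_eq_intros)
    have \<beta>0: "\<beta> 0 = G" by (simp add: \<beta>_def)
    have "((\<lambda>s. (\<beta> s)\<^sup>2 + \<alpha> * (s\<^sup>2 * Q0)) has_real_derivative 2 * G * (G * k * x1)) (at 0)"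
      using d\<beta>[of 0] \<beta>0 by (auto intro!: derivative_eq_intros)
    then have "((\<lambda>s. sqrt ((\<beta> s)\<^sup>2 + \<alpha> * (s\<^sup>2 * Q0))) has_real_derivative
        (inverse (sqrt ((\<beta> 0)\<^sup>2 + \<alpha> * (0\<^sup>2 * Q0))) / 2) * (2 * G * (G * k * x1))) (at 0)"
      using G by (intro DERIV_chain2[where f=sqrt] DERIV_real_sqrt) (auto simp: \<beta>0)
    then have "((\<lambda>s. sqrt ((\<beta> s)\<^sup>2 + \<alpha> * (s\<^sup>2 * Q0))) has_real_derivative G * k * x1) (at 0)"
      using G by (simp add: \<beta>0 field_simps)
    from DERIV_add[OF d\<beta>[of 0] this]
    have dd: "((\<lambda>s. \<beta> s + sqrt ((\<beta> s)\<^sup>2 + \<alpha> * (s\<^sup>2 * Q0))) has_real_derivative 2 * (G * k * x1)) (at 0)"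
      by (simp add: mult.assoc)
    have g0: "\<beta> 0 + sqrt ((\<beta> 0)\<^sup>2 + \<alpha> * (0\<^sup>2 * Q0)) = 2 * G" using G by (simp add: \<beta>0)
    then have "\<beta> 0 + sqrt ((\<beta> 0)\<^sup>2 + \<alpha> * (0\<^sup>2 * Q0)) \<noteq> 0" using G by simp
    from DERIV_divide[OF DERIV_const[of Q0] dd this, unfolded g0]
    have "(g has_real_derivative (0 * (2 * G) - Q0 * (2 * (G * k * x1))) / ((2 * G) * (2 * G))) (at 0)"
      unfolding g_def .
    then have "deriv g 0 = (0 * (2 * G) - Q0 * (2 * (G * k * x1))) / ((2 * G) * (2 * G))"
      by (rule DERIV_imp_deriv)
    also have "\<dots> = - (Q0 * k * x1) / (2 * G)" using G by (simp add: divide_simps)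
    finally have "6 * deriv g 0 = 3 * (- (Q0 * k * x1) / G)" by simp
    also have "\<dots> = 3 * B0 * (x1\<^sup>2 + x2\<^sup>2) * x1" by (simp add: B0_def Q0_def mult_ac)
    finally have "6 * deriv g 0 = 3 * B0 * (x1\<^sup>2 + x2\<^sup>2) * x1" .
    moreover have "(deriv ^^ 3) (\<lambda>s. h (s * x1, s * x2, 0)) 0 = 6 * deriv g 0"
      by (rule third_derivative_square_mult[OF oI I0 sg hs])
    ultimately show ?thesis by (simp add: power3_eq_cube power2_eq_square algebra_simps)
  qed
  have B0: "B0 < 0" using k G pos by (simp add: B0_def)
  have ineq: "B0 * (B0 - 3 * B0) \<noteq> 0" "(3 * B0) / B0 > (0 / (2 * B0))\<^sup>2 + 2" using B0 by auto
  have pu: "p \<in> part_umb_set M N" unfolding part_umb_set_M using p by (simp add: P_def)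
  show ?thesis
    unfolding type_D1_point_def
    using pu norm1 e12 e13 spT spE E oU U0 sh oV pV graph third ineq by blast
qed


lemma type_D1_curve_P: "\<sigma> \<in> {1, - 1} \<Longrightarrow> type_D1_curve M N (P \<sigma>)"
  by (simp add: type_D1_curve_def regular_curve_P type_D1_P)

lemma principal_configuration:
  "umbilic_set M N = {} \<and>
    (\<exists>P1 P2 W.
       part_umb_set M N = P1 \<union> P2 \<and> P1 \<inter> P2 = {} \<and> P1 \<union> P2 \<subseteq> part_umb_23 M N \<and>
       type_D1_curve M N P1 \<and> type_D1_curve M N P2 \<and>
       W = separatrix_surface M N 3 P1 \<union> separatrix_surface M N 3 P2 \<and>
       open_band W \<and> (closure W \<inter> M) - W = P1 \<union> P2 \<and>
       (\<forall>L\<in>leaves M N 3. L \<inter> W = {} \<longrightarrow> compact L)) \<and>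
    (\<forall>L\<in>leaves M N 2. diffeomorphic L (UNIV :: real set)) \<and>
    (\<forall>L\<in>leaves M N 1. compact L)"
proof (intro conjI exI ballI impI)
  show "part_umb_set M N = P 1 \<union> P (- 1)" "P 1 \<inter> P (- 1) = {}" by (rule part_umb_set_P)+
  show "P 1 \<union> P (- 1) \<subseteq> part_umb_23 M N"
    unfolding part_umb_set_P(1)[symmetric] part_umb_set_M part_umb_23_M ..
  show "type_D1_curve M N (P 1)" "type_D1_curve M N (P (- 1))" by (simp_all add: type_D1_curve_P)
  show "W = separatrix_surface M N 3 (P 1) \<union> separatrix_surface M N 3 (P (- 1))"
    by (simp add: separatrix_surface_P)
  show "umbilic_set M N = {}" by (rule umbilic_set_empty)
  show "open_band W" by (rule open_band_W)
  show "closure W \<inter> M - W = P 1 \<union> P (- 1)" by (rule closure_W)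
  show "compact L" if "L \<in> leaves M N 3" "L \<inter> W = {}" for L using that by (rule compact_leaves_3)
  show "diffeomorphic L (UNIV :: real set)" if "L \<in> leaves M N 2" for L using that by (rule diffeomorphic_leaves_2)
  show "compact L" if "L \<in> leaves M N 1" for L using that by (rule compact_leaves_1)
qed

end

section \<open>Return to the semi-axes, the gradient normal and the given parametrization\<close>

lemma GDERIV_Q2_form:
  "GDERIV (Q2_form a b c d) p :> vector [2 * (p $ 1 / a\<^sup>2), 2 * (p $ 2 / b\<^sup>2), 2 * (- p $ 3 / c\<^sup>2), 2 * (- p $ 4 / d\<^sup>2)]"
proof -
  have sq: "((\<lambda>x::real^4. k * (x $ i)\<^sup>2) has_derivative (\<lambda>h. k * (2 * (p $ i * h $ i)))) (at p)" for k i
  proof -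
    have "((\<lambda>x::real^4. x $ i) has_derivative (\<lambda>h. h $ i)) (at p)"
      by (rule bounded_linear_imp_has_derivative[OF bounded_linear_vec_nth])
    from has_derivative_mult_right[OF has_derivative_power[OF this, of 2], of k]
    show ?thesis by (simp add: mult_ac)
  qed
  have "((\<lambda>x. 1 / a\<^sup>2 * (x $ 1)\<^sup>2 + 1 / b\<^sup>2 * (x $ 2)\<^sup>2 + (- 1 / c\<^sup>2) * (x $ 3)\<^sup>2 + (- 1 / d\<^sup>2) * (x $ 4)\<^sup>2)
    has_derivative (\<lambda>h. 1 / a\<^sup>2 * (2 * (p $ 1 * h $ 1)) + 1 / b\<^sup>2 * (2 * (p $ 2 * h $ 2))
      + (- 1 / c\<^sup>2) * (2 * (p $ 3 * h $ 3)) + (- 1 / d\<^sup>2) * (2 * (p $ 4 * h $ 4)))) (at p)"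
    by (intro has_derivative_add sq)
  moreover have "Q2_form a b c d = (\<lambda>x. 1 / a\<^sup>2 * (x $ 1)\<^sup>2 + 1 / b\<^sup>2 * (x $ 2)\<^sup>2
      + (- 1 / c\<^sup>2) * (x $ 3)\<^sup>2 + (- 1 / d\<^sup>2) * (x $ 4)\<^sup>2)"
    by (simp add: Q2_form_def fun_eq_iff)
  ultimately show ?thesis
    unfolding gderiv_def by (simp add: inner_4 vector_4 mult_ac)
qed

theorem theorem3:
  fixes a b c d :: real
  assumes "a > b" and "b > 0" and "c > d" and "d > 0"
  shows "let M = Q2 a b c d; N = Q2_normal a b c d in
    umbilic_set M N = {} \<and>
    (\<forall>\<sigma>\<in>{1, -1}. \<forall>u v w. u\<^sup>2 + v\<^sup>2 - w\<^sup>2 - 1 \<ge> 0 \<longrightarrow>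
       (Q2_param a b c d \<sigma> u v w \<in> part_umb_set M N \<longleftrightarrow>
        (d\<^sup>2 + a\<^sup>2) * u\<^sup>2 / (c\<^sup>2 + a\<^sup>2) + (b\<^sup>2 + d\<^sup>2) * v\<^sup>2 / (b\<^sup>2 + c\<^sup>2) - 1 = 0 \<and> w = 0)) \<and>
    (\<exists>P1 P2 W.
       part_umb_set M N = P1 \<union> P2 \<and> P1 \<inter> P2 = {} \<and> P1 \<union> P2 \<subseteq> part_umb_23 M N \<and>
       type_D1_curve M N P1 \<and> type_D1_curve M N P2 \<and>
       W = separatrix_surface M N 3 P1 \<union> separatrix_surface M N 3 P2 \<and>
       open_band W \<and> (closure W \<inter> M) - W = P1 \<union> P2 \<and>
       (\<forall>L\<in>leaves M N 3. L \<inter> W = {} \<longrightarrow> compact L)) \<and>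
    (\<forall>L\<in>leaves M N 2. diffeomorphic L (UNIV :: real set)) \<and>
    (\<forall>L\<in>leaves M N 1. compact L)"
proof -
  interpret quadric "a\<^sup>2" "b\<^sup>2" "c\<^sup>2" "d\<^sup>2"
    by unfold_locales (use assms in \<open>auto intro: power_strict_mono\<close>)
  have Q2: "Q2 a b c d = M"
    by (auto simp: Q2_def Q2_form_def mem_M)
  have N: "Q2_normal a b c d = N"
  proof
    fix p
    \<comment> \<open>The positive factor 2 disappears under \<open>sgn\<close>, so the two unit
      normals agree including orientation.\<close>
    have "gradient (Q2_form a b c d) p = 2 *\<^sub>R Am p"
      unfolding gradient_def
    proof (rule the_equality)
      have "vector [2 * (p $ 1 / a\<^sup>2), 2 * (p $ 2 / b\<^sup>2), 2 * (- p $ 3 / c\<^sup>2), 2 * (- p $ 4 / d\<^sup>2)] = 2 *\<^sub>R Am p"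
        by (simp add: vec_eq_4 vector_4 Am_nth)
      then show G: "GDERIV (Q2_form a b c d) p :> 2 *\<^sub>R Am p"
        using GDERIV_Q2_form[of a b c d p] by simp
      fix g assume "GDERIV (Q2_form a b c d) p :> g"
      then have "(\<lambda>h. h \<bullet> g) = (\<lambda>h. h \<bullet> (2 *\<^sub>R Am p))"
        using G unfolding gderiv_def by (rule has_derivative_unique)
      then show "g = 2 *\<^sub>R Am p" by (metis vector_eq_ldot)
    qed
    then show "Q2_normal a b c d p = N p"
      by (simp add: Q2_normal_def N_def sgn_scaleR)
  qed
  have param: "Q2_param a b c d \<sigma> u v w \<in> part_umb_set M N \<longleftrightarrow>
        (d\<^sup>2 + a\<^sup>2) * u\<^sup>2 / (c\<^sup>2 + a\<^sup>2) + (b\<^sup>2 + d\<^sup>2) * v\<^sup>2 / (b\<^sup>2 + c\<^sup>2) - 1 = 0 \<and> w = 0"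
    if "\<sigma> \<in> {1, - 1}" "u\<^sup>2 + v\<^sup>2 - w\<^sup>2 - 1 \<ge> 0" for \<sigma> u v w
  proof -
    let ?p = "Q2_param a b c d \<sigma> u v w"
    have p: "?p $ 1 = a * u" "?p $ 2 = b * v" "?p $ 3 = c * w" "(?p $ 4)\<^sup>2 = d\<^sup>2 * (u\<^sup>2 + v\<^sup>2 - w\<^sup>2 - 1)"
      using that by (auto simp: Q2_param_def vector_4 power_mult_distrib)
    have sq: "(?p $ 1)\<^sup>2 / a\<^sup>2 = u\<^sup>2" "(?p $ 2)\<^sup>2 / b\<^sup>2 = v\<^sup>2" "(?p $ 3)\<^sup>2 / c\<^sup>2 = w\<^sup>2"
      "(?p $ 4)\<^sup>2 / d\<^sup>2 = u\<^sup>2 + v\<^sup>2 - w\<^sup>2 - 1"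
      using pos unfolding p by (simp_all add: power_mult_distrib)
    have "?p \<in> M" unfolding mem_M sq by simp
    moreover have "?p $ 3 = 0 \<longleftrightarrow> w = 0" unfolding p using assms by simp
    ultimately show ?thesis
      unfolding part_umb_set_M mem_Collect_eq pu_form_def sq by (simp add: add.commute) blast
  qed
  show ?thesis unfolding Let_def Q2 N
  proof (rule conjI[OF principal_configuration[THEN conjunct1] conjI[OF _ principal_configuration[THEN conjunct2]]])
    show "\<forall>\<sigma>\<in>{1, - 1}. \<forall>u v w. u\<^sup>2 + v\<^sup>2 - w\<^sup>2 - 1 \<ge> 0 \<longrightarrow>
       (Q2_param a b c d \<sigma> u v w \<in> part_umb_set M N \<longleftrightarrow>
        (d\<^sup>2 + a\<^sup>2) * u\<^sup>2 / (c\<^sup>2 + a\<^sup>2) + (b\<^sup>2 + d\<^sup>2) * v\<^sup>2 / (b\<^sup>2 + c\<^sup>2) - 1 = 0 \<and> w = 0)"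
      by (intro ballI allI impI param)
  qed
qed

end
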